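(* Let $H$ be a stationary energy function with finite range $R>0$ and let $\Gamma$ be an infinite volume Gibbs point process with energy $H$, activity $z>0$ and inverse temperature $\beta\ge0$. Assume that for every $\gamma\in\mathcal{C}$ the function $x\mapsto h(x,\gamma)$ is differentiable on $\mathbb{R}^d\setminus\gamma$. Let $f:\mathbb{R}^d\times\mathcal{C}\to\mathbb{R}$ be differentiable and with compact support with respect to the first variable, and assume both terms below are integrable. Then $$E\Big(\sum_{x\in\Gamma}\nabla_xf(x,\Gamma\setminus\{x\})\Big)=\beta\,E\Big(\sum_{x\in\Gamma}f(x,\Gamma\setminus\{x\})\nabla_xh(x,\Gamma\setminus\{x\})\Big).$$
   Context: $\mathcal{C}$ is the set of locally finite subsets of $\mathbb{R}^d$, $\mathcal{C}_f$ the finite ones; $\gamma_\Lambda=\gamma\cap\Lambda$, $N_\Lambda(\gamma)=\#\gamma_\Lambda$; $\lambda^d$ Lebesgue measure; $\pi_\Delta$ the law of the Poisson process on $\Delta$ with intensity $\lambda^d$ restricted to $\Delta$. An energy function is a measurable $H:\mathcal{C}_f\to\mathbb{R}\cup\{+\infty\}$ with $H(\emptyset)<\infty$, hereditary and stable. $\tau_u\gamma=\{x+u:x\in\gamma\}$; $H$ stationary: $H(\tau_u\gamma)=H(\gamma)$. $H_\Delta(\gamma)=H(\gamma)-H(\gamma_{\Delta^c})$ (convention $\infty-\infty=0$); finite range $R$: $H_\Delta(\gamma)=H(\gamma_{\Delta\oplus B(0,R)})-H(\gamma_{(\Delta\oplus B(0,R))\setminus\Delta})$ for bounded $\Delta$,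 $\gamma\in\mathcal{C}_f$, extended by $H_\Delta(\gamma):=H_\Delta(\gamma_{\Delta\oplus B(0,R)})$. Local energy $h(x,\gamma)=H(\{x\}\cup\gamma)-H(\gamma)$ (convention $\infty-\infty=0$) for finite $\gamma$, $h(x,\gamma):=h(x,\gamma_{B(x,R)})$ for $\gamma\in\mathcal{C}$; $\nabla_x$ is the gradient in the first variable. An infinite volume Gibbs point process with parameters $z,\beta$ is a point process whose law $P$ is stationary and satisfies, for every bounded $\Delta$ with $\lambda^d(\Delta)>0$ and $P$-a.e. $\gamma_{\Delta^c}$, $P(d\gamma_\Delta|\gamma_{\Delta^c})=\frac{1}{Z_\Delta^{z,\beta}(\gamma_{\Delta^c})}z^{N_\Delta(\gamma)}e^{-\beta H_\Delta(\gamma)}\pi_\Delta(d\gamma_\Delta)$. *)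

theory Defs
  imports "HOL-Probability.Probability"
begin

definition locally_finite :: "'a::euclidean_space set \<Rightarrow> bool" where
  "locally_finite \<gamma> \<longleftrightarrow> (\<forall>B. bounded B \<longrightarrow> finite (\<gamma> \<inter> B))"

definition config_M :: "'a::euclidean_space set measure" where
  "config_M = sigma {\<gamma>. locally_finite \<gamma>}
     {{\<gamma>. locally_finite \<gamma> \<and> card (\<gamma> \<inter> B) = n} | B n. B \<in> sets lborel \<and> bounded B}"

definition transl :: "'a::euclidean_space \<Rightarrow> 'a set \<Rightarrow> 'a set" where
  "transl u \<gamma> = (\<lambda>x. x + u) ` \<gamma>"

definition enlarge :: "'a::euclidean_space set \<Rightarrow> real \<Rightarrow> 'a set" where
  "enlarge \<Delta> R = (\<Union>x\<in>\<Delta>. cball x R)"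

text \<open>pi_Delta: with probability exp(-lambda(Delta)) lambda(Delta)^n/n! there are
  n points, i.i.d. uniform on Delta; equivalently the n-th term is the image of
  Lebesgue measure on Delta^n under (x_1..x_n) |-> {x_1..x_n}, divided by n!.\<close>

definition poisson_pp :: "'a::euclidean_space set \<Rightarrow> 'a set measure" where
  "poisson_pp \<Delta> = measure_of (space config_M) (sets config_M)
     (\<lambda>A. ennreal (exp (- measure lborel \<Delta>)) *
        (\<Sum>n. emeasure (distr (PiM {..<n} (\<lambda>_. restrict_space lborel \<Delta>)) config_M
                              (\<lambda>xs. xs ` {..<n})) A / ennreal (fact n)))"

definition ediff :: "ereal \<Rightarrow> ereal \<Rightarrow> ereal" where
  "ediff a b = (if a = \<infinity> \<and> b = \<infinity> then 0 else a - b)"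

definition energy_function :: "('a::euclidean_space set \<Rightarrow> ereal) \<Rightarrow> bool" where
  "energy_function H \<longleftrightarrow>
     H \<in> borel_measurable (restrict_space config_M {\<gamma>. finite \<gamma>}) \<and>
     H {} < \<infinity> \<and>
     (\<forall>\<gamma> x. finite \<gamma> \<and> H \<gamma> = \<infinity> \<longrightarrow> H (insert x \<gamma>) = \<infinity>) \<and>
     (\<exists>A\<ge>0. \<forall>\<gamma>. finite \<gamma> \<longrightarrow> H \<gamma> \<ge> - ereal (A * real (card \<gamma>)))"

definition stationary_energy :: "('a::euclidean_space set \<Rightarrow> ereal) \<Rightarrow> bool" where
  "stationary_energy H \<longleftrightarrow> (\<forall>u \<gamma>. finite \<gamma> \<longrightarrow> H (transl u \<gamma>) = H \<gamma>)"

definition finite_range :: "('a::euclidean_space set \<Rightarrow> ereal) \<Rightarrow> real \<Rightarrow> bool" where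
  "finite_range H R \<longleftrightarrow>
     (\<forall>\<Delta> \<gamma>. bounded \<Delta> \<and> finite \<gamma> \<longrightarrow>
        ediff (H \<gamma>) (H (\<gamma> - \<Delta>)) =
        ediff (H (\<gamma> \<inter> enlarge \<Delta> R)) (H (\<gamma> \<inter> (enlarge \<Delta> R - \<Delta>))))"

text \<open>Local (conditional) energy H_Delta(gamma) for gamma in C, via the finite range R.\<close>
definition cond_energy :: "('a::euclidean_space set \<Rightarrow> ereal) \<Rightarrow> real \<Rightarrow> 'a set \<Rightarrow> 'a set \<Rightarrow> ereal" where
  "cond_energy H R \<Delta> \<gamma> =
     ediff (H (\<gamma> \<inter> enlarge \<Delta> R)) (H (\<gamma> \<inter> (enlarge \<Delta> R - \<Delta>)))"

definition loc_energy :: "('a::euclidean_space set \<Rightarrow> ereal) \<Rightarrow> real \<Rightarrow> 'a \<Rightarrow> 'a set \<Rightarrow> ereal" where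
  "loc_energy H R x \<gamma> = ediff (H (insert x (\<gamma> \<inter> cball x R))) (H (\<gamma> \<inter> cball x R))"

definition boltz :: "real \<Rightarrow> ereal \<Rightarrow> ennreal" where
  "boltz \<beta> v = (if v = \<infinity> then 0 else ennreal (exp (- \<beta> * real_of_ereal v)))"

definition gibbs_dens ::
  "('a::euclidean_space set \<Rightarrow> ereal) \<Rightarrow> real \<Rightarrow> real \<Rightarrow> real \<Rightarrow> 'a set \<Rightarrow> 'a set \<Rightarrow> 'a set \<Rightarrow> ennreal" where
  "gibbs_dens H R z \<beta> \<Delta> \<gamma> \<gamma>' =
     ennreal (z ^ card (\<gamma>' \<inter> \<Delta>)) * boltz \<beta> (cond_energy H R \<Delta> ((\<gamma>' \<inter> \<Delta>) \<union> (\<gamma> - \<Delta>)))"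

definition partition_fun ::
  "('a::euclidean_space set \<Rightarrow> ereal) \<Rightarrow> real \<Rightarrow> real \<Rightarrow> real \<Rightarrow> 'a set \<Rightarrow> 'a set \<Rightarrow> ennreal" where
  "partition_fun H R z \<beta> \<Delta> \<gamma> = (\<integral>\<^sup>+ \<gamma>'. gibbs_dens H R z \<beta> \<Delta> \<gamma> \<gamma>' \<partial>poisson_pp \<Delta>)"

definition stationary_pp :: "'a::euclidean_space set measure \<Rightarrow> bool" where
  "stationary_pp P \<longleftrightarrow> (\<forall>u. distr P config_M (transl u) = P)"

text \<open>Infinite volume Gibbs point process: stationary law P on C satisfying the DLR
  equations: for every bounded Borel Delta with positive volume, the conditional law
  of gamma_Delta given gamma_{Delta^c} is
  Z_Delta(gamma_{Delta^c})^{-1} z^{N_Delta} e^{-beta H_Delta} pi_Delta, P-a.s.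
  (written in the equivalent integrated form).\<close>
definition gibbs_pp ::
  "('a::euclidean_space set \<Rightarrow> ereal) \<Rightarrow> real \<Rightarrow> real \<Rightarrow> real \<Rightarrow> 'a set measure \<Rightarrow> bool" where
  "gibbs_pp H R z \<beta> P \<longleftrightarrow>
     prob_space P \<and> sets P = sets config_M \<and> stationary_pp P \<and>
     (\<forall>\<Delta>. \<Delta> \<in> sets lborel \<and> bounded \<Delta> \<and> emeasure lborel \<Delta> > 0 \<longrightarrow>
        (AE \<gamma> in P. 0 < partition_fun H R z \<beta> \<Delta> \<gamma> \<and> partition_fun H R z \<beta> \<Delta> \<gamma> < \<infinity>) \<and>
        (\<forall>A \<in> sets config_M.
           emeasure P A =
           (\<integral>\<^sup>+ \<gamma>. (\<integral>\<^sup>+ \<gamma>'. indicator A ((\<gamma>' \<inter> \<Delta>) \<union> (\<gamma> - \<Delta>)) * gibbs_dens H R z \<beta> \<Delta> \<gamma> \<gamma>'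
                        \<partial>poisson_pp \<Delta>) / partition_fun H R z \<beta> \<Delta> \<gamma> \<partial>P)))"

definition grad :: "('a::euclidean_space \<Rightarrow> real) \<Rightarrow> 'a \<Rightarrow> 'a" where
  "grad g x = (\<Sum>b\<in>Basis. frechet_derivative g (at x) b *\<^sub>R b)"

end

theory Submission
  imports Defs
begin

text \<open>
  The DLR equations on a ball and Mecke's formula for the Poisson process give the
  Georgii-Nguyen-Zessin equation: the expectation of the sum of \<open>F x (\<gamma> - {x})\<close> over \<open>x \<in> \<gamma>\<close> is
  the expectation of the Lebesgue integral of \<open>z * F x \<gamma> * exp (- \<beta> * h x \<gamma>)\<close>. Applied to both sides of
  the claim, it reduces the theorem to the vanishing, for almost every \<open>\<gamma>\<close>, of the integral of
  the gradient of \<open>f x \<gamma> * exp (- \<beta> * h x \<gamma>)\<close>, that is, to an integration by parts in \<open>x\<close>.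

  The only obstruction is that this function is differentiable only off \<open>\<gamma>\<close>, so in dimension one it
  could jump at the points of \<open>\<gamma>\<close>. Almost surely it does not: \<open>exp (- \<beta> * h x (insert y \<eta>)) * exp (- \<beta> * h y \<eta>)\<close>
  is symmetric in \<open>x\<close> and \<open>y\<close>, and for a symmetric function the points \<open>y\<close> of a line at which the two
  one-sided limits for \<open>x\<close> tending to \<open>y\<close> differ are countable. By the Georgii-Nguyen-Zessin equation,
  a Lebesgue null set of such \<open>y\<close> is not charged. The argument works in every dimension.
\<close>

section \<open>Measurability of maps between configurations\<close>


text \<open>A differentiable local energy is in particular finite, and together with stability this
  makes \<open>H\<close> finite on every finite configuration. So all energies are real numbers and
  the Boltzmann weight \<open>exp (- \<beta> * h x \<gamma>)\<close> is strictly positive. Its jumps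
  at a point \<open>y \<in> \<gamma>\<close> can therefore be read off from the symmetric product
  with \<open>\<eta> = \<gamma> - {y}\<close>, whose second factor is a positive constant in
  \<open>x\<close>.

  The reason for passing to \<open>\<gamma> - {y}\<close> is that the Georgii-Nguyen-Zessin equation
  then treats \<open>y\<close> as a Lebesgue point added to a fixed environment, so that it suffices
  to find a null set of exceptional \<open>y\<close> for each environment. Symmetry provides it: for
  two nearby points at which the product rises by the same amount, one and the same value would have
  to lie above the jump and below it.

  Space is never split into a line and a hyperplane. Averaging over unit segments in a fixed
  direction turns statements about lines into statements about space, both for null sets and for the
  integration by parts; this rests on translation invariance and Fubini's theorem alone.\<close>

lemma space_config_M: "space config_M = {\<gamma>. locally_finite \<gamma>}"
  by (simp add: config_M_def space_measure_of_conv)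

lemma locally_finite_subset: "locally_finite \<gamma> \<Longrightarrow> \<eta> \<subseteq> \<gamma> \<Longrightarrow> locally_finite \<eta>"
  unfolding locally_finite_def by (meson Int_mono finite_subset order_refl)

lemma finite_imp_locally_finite: "finite \<gamma> \<Longrightarrow> locally_finite \<gamma>"
  unfolding locally_finite_def by auto

lemma locally_finite_Un: "locally_finite \<gamma> \<Longrightarrow> locally_finite \<eta> \<Longrightarrow> locally_finite (\<gamma> \<union> \<eta>)"
  unfolding locally_finite_def by (auto simp: Int_Un_distrib2)

lemma locally_finite_insert: "locally_finite \<gamma> \<Longrightarrow> locally_finite (insert x \<gamma>)"
  using locally_finite_Un[OF finite_imp_locally_finite[of "{x}"]] by simp

lemma locally_finite_Int_bounded: "locally_finite \<gamma> \<Longrightarrow> bounded B \<Longrightarrow> finite (\<gamma> \<inter> B)"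
  unfolding locally_finite_def by auto

text \<open>An accumulation point would have infinitely many points of \<open>\<gamma>\<close> in
  its unit ball. Closedness makes the complement open, and there differentiability on the set means
  differentiability at each of its points.\<close>

lemma locally_finite_closed:
  fixes \<gamma> :: "'a::euclidean_space set"
  assumes "locally_finite \<gamma>"
  shows "closed \<gamma>"
  unfolding closed_limpt islimpt_eq_infinite_ball
  using assms bounded_ball[of _ 1] unfolding locally_finite_def by (meson zero_less_one)

lemma measurable_card_Int:
  assumes "B \<in> sets borel" "bounded B"
  shows "(\<lambda>\<gamma>. card (\<gamma> \<inter> B)) \<in> config_M \<rightarrow>\<^sub>M count_space UNIV"
proof (subst measurable_count_space_eq2_countable, intro conjI ballI)
  fix n
  have "(\<lambda>\<gamma>. card (\<gamma> \<inter> B)) -` {n} \<inter> space config_M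
      = {\<gamma>. locally_finite \<gamma> \<and> card (\<gamma> \<inter> B) = n}"
    by (auto simp: space_config_M)
  also have "\<dots> \<in> sets config_M"
    unfolding config_M_def by (rule in_measure_of) (use assms in auto)
  finally show "(\<lambda>\<gamma>. card (\<gamma> \<inter> B)) -` {n} \<inter> space config_M \<in> sets config_M" .
qed auto

text \<open>The sigma-algebra is generated by the counts in bounded Borel sets, so only these counts
  have to be tested. The operations on configurations below all reduce to this criterion.\<close>

lemma measurable_config_M:
  fixes T :: "'w \<Rightarrow> 'b::euclidean_space set"
  assumes lf: "\<And>w. w \<in> space N \<Longrightarrow> locally_finite (T w)"
    and card: "\<And>B. B \<in> sets borel \<Longrightarrow> bounded B \<Longrightarrow> (\<lambda>w. card (T w \<inter> B)) \<in> N \<rightarrow>\<^sub>M count_space UNIV"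
  shows "T \<in> N \<rightarrow>\<^sub>M config_M"
  unfolding config_M_def
proof (rule measurable_measure_of)
  fix y assume "y \<in> {{\<gamma>::'b set. locally_finite \<gamma> \<and> card (\<gamma> \<inter> B) = n} |B n. B \<in> sets lborel \<and> bounded B}"
  then obtain B n where y: "y = {\<gamma>. locally_finite \<gamma> \<and> card (\<gamma> \<inter> B) = n}" "B \<in> sets borel" "bounded B"
    by auto
  have "T -` y \<inter> space N = (\<lambda>w. card (T w \<inter> B)) -` {n} \<inter> space N"
    using lf by (auto simp: y)
  then show "T -` y \<inter> space N \<in> sets N"
    using card[OF y(2,3)] by (auto intro: measurable_sets)
qed (use lf in auto)

text \<open>On rectangles the count is an indicator times \<open>card\<close>, and Dynkin's argument
  extends this to all measurable sets. The bounded window \<open>K\<close> keeps the counts finite,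
  which is what allows subtraction in the complement step.\<close>

lemma measurable_emeasure_section:
  fixes K :: "'b::euclidean_space set"
  assumes K: "K \<in> sets borel" "bounded K" and E: "E \<in> sets (N \<Otimes>\<^sub>M borel)"
  shows "(\<lambda>p. emeasure (count_space UNIV) {y \<in> snd p \<inter> K. (fst p, y) \<in> E})
          \<in> borel_measurable (N \<Otimes>\<^sub>M config_M)"
    (is "?\<kappa> E \<in> _")
  using Int_stable_pair_measure_generator pair_measure_closed E unfolding sets_pair_measure
proof (induction rule: sigma_sets_induct_disjoint)
  have fin: "finite (snd p \<inter> K)" if "p \<in> space (N \<Otimes>\<^sub>M config_M)" for p
    using that K by (auto simp: space_pair_measure space_config_M locally_finite_def)
  have cardm: "(\<lambda>p. card (snd p \<inter> B)) \<in> N \<Otimes>\<^sub>M config_M \<rightarrow>\<^sub>M count_space UNIV"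
    if "B \<in> sets borel" "bounded B" for B :: "'b set"
    using measurable_card_Int[OF that] by measurable
  {
    case (basic X)
    then obtain A B where X: "X = A \<times> B" and A: "A \<in> sets N" and B: "B \<in> sets borel" by auto
    have "(\<lambda>p. indicator A (fst p) * ennreal (real (card (snd p \<inter> (K \<inter> B)))))
            \<in> borel_measurable (N \<Otimes>\<^sub>M config_M)"
    proof -
      have [measurable]: "(\<lambda>p. card (snd p \<inter> (K \<inter> B))) \<in> N \<Otimes>\<^sub>M config_M \<rightarrow>\<^sub>M count_space UNIV"
        using B K by (intro cardm) (auto intro: bounded_subset)
      show ?thesis using A by measurable
    qed
    moreover have "?\<kappa> X p = indicator A (fst p) * ennreal (real (card (snd p \<inter> (K \<inter> B))))"
      if "p \<in> space (N \<Otimes>\<^sub>M config_M)" for p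
    proof -
      have "{y \<in> snd p \<inter> K. (fst p, y) \<in> X} = (if fst p \<in> A then snd p \<inter> (K \<inter> B) else {})"
        by (auto simp: X)
      then show ?thesis using finite_subset[OF _ fin[OF that], of "snd p \<inter> (K \<inter> B)"]
        by (auto simp: emeasure_count_space ennreal_of_nat_eq_real_of_nat)
    qed
    ultimately show ?case by (subst measurable_cong) 
  next
    case empty
    then show ?case by simp
  next
    case (compl A)
    have "(\<lambda>p. ennreal (real (card (snd p \<inter> K))) - ?\<kappa> A p) \<in> borel_measurable (N \<Otimes>\<^sub>M config_M)"
      using cardm[OF K] compl by auto
    moreover have "?\<kappa> (space N \<times> space borel - A) p = ennreal (real (card (snd p \<inter> K))) - ?\<kappa> A p"
      if "p \<in> space (N \<Otimes>\<^sub>M config_M)" for p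
    proof -
      have eq: "{y \<in> snd p \<inter> K. (fst p, y) \<in> space N \<times> space borel - A}
          = (snd p \<inter> K) - {y \<in> snd p \<inter> K. (fst p, y) \<in> A}"
        using that by (auto simp: space_pair_measure)
      have "emeasure (count_space UNIV) {y \<in> snd p \<inter> K. (fst p, y) \<in> A} \<noteq> \<infinity>"
        using finite_subset[OF _ fin[OF that], of "{y \<in> snd p \<inter> K. (fst p, y) \<in> A}"]
        by (auto simp: emeasure_count_space)
      then show ?thesis unfolding eq
        by (subst emeasure_Diff) (use fin[OF that] in \<open>auto simp: emeasure_count_space ennreal_of_nat_eq_real_of_nat\<close>)
    qed
    ultimately show ?case by (subst measurable_cong) 
  next
    case (union A)
    have "?\<kappa> (\<Union>i. A i) p = (\<Sum>i. ?\<kappa> (A i) p)" for p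
    proof -
      have "{y \<in> snd p \<inter> K. (fst p, y) \<in> (\<Union>i. A i)} = (\<Union>i. {y \<in> snd p \<inter> K. (fst p, y) \<in> A i})"
        by auto
      moreover have "disjoint_family (\<lambda>i. {y \<in> snd p \<inter> K. (fst p, y) \<in> A i})"
        using union(1) by (auto simp: disjoint_family_on_def)
      ultimately show ?thesis by (simp add: suminf_emeasure)
    qed
    then show ?case using union(3) by simp
  }
qed

lemma nn_integral_count_space_bounded:
  fixes F :: "'b::euclidean_space \<Rightarrow> ennreal"
  shows "(\<integral>\<^sup>+y. F y \<partial>count_space \<gamma>)
    = (SUP k::nat. \<integral>\<^sup>+y. F y * indicator (cball 0 (real k)) y \<partial>count_space \<gamma>)"
proof -
  have "(SUP k::nat. F y * indicator (cball 0 (real k)) y) = F y" for y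
  proof -
    obtain k :: nat where "norm y \<le> real k" using real_arch_simple by blast
    then have "F y \<le> (SUP k::nat. F y * indicator (cball 0 (real k)) y)"
      by (intro SUP_upper2[of k]) auto
    then show ?thesis
      by (intro antisym SUP_least) (auto split: split_indicator)
  qed
  then have "(\<integral>\<^sup>+y. F y \<partial>count_space \<gamma>)
     = (\<integral>\<^sup>+y. (SUP k::nat. F y * indicator (cball 0 (real k)) y) \<partial>count_space \<gamma>)" by simp
  also have "\<dots> = (SUP k::nat. \<integral>\<^sup>+y. F y * indicator (cball 0 (real k)) y \<partial>count_space \<gamma>)"
    by (intro nn_integral_monotone_convergence_SUP)
       (auto simp: incseq_def le_fun_def split: split_indicator)
  finally show ?thesis .
qed

text \<open>The monotone class argument runs inside a fixed bounded window \<open>K\<close>, where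
  indicators reduce to \<open>measurable_emeasure_section\<close>; the window is removed at the end
  by monotone convergence.\<close>

lemma measurable_nn_integral_config:
  fixes F :: "'w \<times> 'b::euclidean_space \<Rightarrow> ennreal"
  assumes [measurable]: "F \<in> borel_measurable (N \<Otimes>\<^sub>M borel)"
  shows "(\<lambda>p. \<integral>\<^sup>+y. F (fst p, y) \<partial>count_space (snd p)) \<in> borel_measurable (N \<Otimes>\<^sub>M config_M)"
proof -
  have main: "(\<lambda>p. \<integral>\<^sup>+y. F (fst p, y) * indicator K y \<partial>count_space (snd p))
      \<in> borel_measurable (N \<Otimes>\<^sub>M config_M)" 
    if K[measurable]: "K \<in> sets borel" "bounded K" for K
    using assms
  proof (induction rule: borel_measurable_induct)
    case (cong f g)
    have "(\<integral>\<^sup>+y. f (fst p, y) * indicator K y \<partial>count_space (snd p))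
        = (\<integral>\<^sup>+y. g (fst p, y) * indicator K y \<partial>count_space (snd p))"
      if "p \<in> space (N \<Otimes>\<^sub>M config_M)" for p
      using that cong(3) by (intro nn_integral_cong) (auto simp: space_pair_measure)
    with cong(4) show ?case by (subst measurable_cong) (auto simp: cong_def)
  next
    case (set E)
    have "(\<integral>\<^sup>+y. indicator E (fst p, y) * indicator K y \<partial>count_space (snd p))
        = emeasure (count_space UNIV) {y \<in> snd p \<inter> K. (fst p, y) \<in> E}" for p
    proof -
      have "(\<integral>\<^sup>+y. indicator E (fst p, y) * indicator K y \<partial>count_space (snd p))
        = (\<integral>\<^sup>+y. indicator {y \<in> snd p \<inter> K. (fst p, y) \<in> E} y \<partial>count_space UNIV)"
        by (subst nn_integral_count_space_indicator, simp, rule nn_integral_cong)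
          (auto split: split_indicator)
      then show ?thesis by simp
    qed
    then show ?case using measurable_emeasure_section[OF K set] by simp
  next
    case (mult u v)
    then show ?case by (simp add: nn_integral_cmult mult.assoc)
  next
    case (add u v)
    then show ?case by (simp add: nn_integral_add distrib_right)
  next
    case (seq U)
    have "(\<integral>\<^sup>+y. (SUP i. U i) (fst p, y) * indicator K y \<partial>count_space (snd p))
      = (SUP i. \<integral>\<^sup>+y. U i (fst p, y) * indicator K y \<partial>count_space (snd p))" for p
    proof -
      have "(\<integral>\<^sup>+y. (SUP i. U i) (fst p, y) * indicator K y \<partial>count_space (snd p))
        = (\<integral>\<^sup>+y. (SUP i. U i (fst p, y) * indicator K y) \<partial>count_space (snd p))"
        by (intro nn_integral_cong) (auto simp: SUP_apply image_comp SUP_mult_right_ennreal)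
      also have "\<dots> = (SUP i. \<integral>\<^sup>+y. U i (fst p, y) * indicator K y \<partial>count_space (snd p))"
        using seq(3) by (intro nn_integral_monotone_convergence_SUP)
          (auto simp: incseq_def le_fun_def intro!: mult_right_mono)
      finally show ?thesis .
    qed
    then show ?case using seq by simp
  qed
  show ?thesis
    by (subst nn_integral_count_space_bounded) (auto intro!: borel_measurable_SUP main)
qed

lemma measurable_nn_integral_count_space:
  fixes F :: "'w \<Rightarrow> 'b::euclidean_space \<Rightarrow> ennreal"
  assumes "(\<lambda>p. F (fst p) (snd p)) \<in> borel_measurable (N \<Otimes>\<^sub>M borel)"
    and [measurable]: "T \<in> N \<rightarrow>\<^sub>M config_M"
  shows "(\<lambda>w. \<integral>\<^sup>+y. F w y \<partial>count_space (T w)) \<in> borel_measurable N"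
proof -
  have "(\<lambda>w. (w, T w)) \<in> N \<rightarrow>\<^sub>M N \<Otimes>\<^sub>M config_M" by measurable
  from measurable_compose[OF this measurable_nn_integral_config[OF assms(1)]]
  show ?thesis by simp
qed

section \<open>Set operations on configurations\<close>

lemma measurable_card_section:
  fixes T :: "'w \<Rightarrow> 'b::euclidean_space set"
  assumes T[measurable]: "T \<in> N \<rightarrow>\<^sub>M config_M" and E: "{p \<in> space (N \<Otimes>\<^sub>M borel). Q (fst p) (snd p)} \<in> sets (N \<Otimes>\<^sub>M borel)"
    and B: "B \<in> sets borel" "bounded B"
  shows "(\<lambda>w. card {y \<in> T w \<inter> B. Q w y}) \<in> N \<rightarrow>\<^sub>M count_space UNIV"
proof -
  let ?E = "{p \<in> space (N \<Otimes>\<^sub>M borel). Q (fst p) (snd p)}"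
  let ?c = "\<lambda>w. emeasure (count_space UNIV) {y \<in> T w \<inter> B. (w, y) \<in> ?E}"
  have "(\<lambda>w. (w, T w)) \<in> N \<rightarrow>\<^sub>M N \<Otimes>\<^sub>M config_M" by measurable
  from measurable_compose[OF this measurable_emeasure_section[OF B E]]
  have m: "?c \<in> borel_measurable N" by simp
  have fin: "finite (T w \<inter> B)" if "w \<in> space N" for w
    using measurable_space[OF T that] B by (auto simp: space_config_M locally_finite_def)
  have c: "?c w = ennreal (real (card {y \<in> T w \<inter> B. Q w y}))" if "w \<in> space N" for w
  proof -
    have "{y \<in> T w \<inter> B. (w, y) \<in> ?E} = {y \<in> T w \<inter> B. Q w y}" using that by (auto simp: space_pair_measure)
    moreover have "finite {y \<in> T w \<inter> B. Q w y}" by (rule finite_subset[OF _ fin[OF that]]) auto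
    ultimately show ?thesis by (simp add: emeasure_count_space ennreal_of_nat_eq_real_of_nat)
  qed
  show ?thesis
  proof (subst measurable_count_space_eq2_countable, intro conjI ballI)
    fix n
    have "(\<lambda>w. card {y \<in> T w \<inter> B. Q w y}) -` {n} \<inter> space N = {w \<in> space N. ?c w = ennreal (real n)}"
      using c by auto
    also have "\<dots> \<in> sets N" using m by measurable
    finally show "(\<lambda>w. card {y \<in> T w \<inter> B. Q w y}) -` {n} \<inter> space N \<in> sets N" .
  qed auto
qed

text \<open>Common source of three operations: deleting a random point, restricting to a Borel set,
  and restricting to a ball whose centre moves with the parameter.\<close>

lemma measurable_filter_config:
  fixes T :: "'w \<Rightarrow> 'b::euclidean_space set"
  assumes T[measurable]: "T \<in> N \<rightarrow>\<^sub>M config_M"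
    and E[measurable]: "Measurable.pred (N \<Otimes>\<^sub>M borel) (\<lambda>p. Q (fst p) (snd p))"
  shows "(\<lambda>w. {y \<in> T w. Q w y}) \<in> N \<rightarrow>\<^sub>M config_M"
proof (rule measurable_config_M)
  show "locally_finite {y \<in> T w. Q w y}" if "w \<in> space N" for w
    using measurable_space[OF T that] by (auto simp: space_config_M intro: locally_finite_subset)
  fix B :: "'b set" assume B: "B \<in> sets borel" "bounded B"
  have eq: "(\<lambda>w. card {y \<in> T w \<inter> B. Q w y}) = (\<lambda>w. card ({y \<in> T w. Q w y} \<inter> B))"
    by (intro ext arg_cong[where f=card]) auto
  have E': "{p \<in> space (N \<Otimes>\<^sub>M borel). Q (fst p) (snd p)} \<in> sets (N \<Otimes>\<^sub>M borel)" by measurable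
  from measurable_card_section[OF T E' B]
  show "(\<lambda>w. card ({y \<in> T w. Q w y} \<inter> B)) \<in> N \<rightarrow>\<^sub>M count_space UNIV" unfolding eq .
qed

text \<open>The diagonal is Borel, and the sum of its indicator over the points of
  \<open>T w\<close> is 1 or 0 according to whether \<open>u w\<close> is one of them.\<close>

lemma measurable_mem_config:
  fixes T :: "'w \<Rightarrow> 'b::euclidean_space set"
  assumes T[measurable]: "T \<in> N \<rightarrow>\<^sub>M config_M" and u[measurable]: "u \<in> N \<rightarrow>\<^sub>M borel"
  shows "Measurable.pred N (\<lambda>w. u w \<in> T w)"
proof -
  have "(\<lambda>w. \<integral>\<^sup>+y. (if u w = y then 1 else 0) \<partial>count_space (T w)) \<in> borel_measurable N"
    using measurable_compose[OF _ measurable_nn_integral_config[of "\<lambda>p. if u (fst p) = snd p then 1 else 0" N], 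
      of "\<lambda>w. (w, T w)" N] by simp
  moreover have "(\<integral>\<^sup>+y. (if u w = y then 1 else 0) \<partial>count_space (T w)) = (if u w \<in> T w then 1 else 0 :: ennreal)" for w
  proof -
    have "(\<integral>\<^sup>+y. (if u w = y then 1 else 0 :: ennreal) \<partial>count_space (T w)) 
        = (\<integral>\<^sup>+y. indicator (T w \<inter> {u w}) y \<partial>count_space UNIV)"
      by (subst nn_integral_count_space_indicator, simp, rule nn_integral_cong)
        (auto split: split_indicator)
    then show ?thesis by (auto simp: Int_insert_right)
  qed
  ultimately have "(\<lambda>w. (if u w \<in> T w then 1 else 0 :: ennreal)) \<in> borel_measurable N" by simp
  then have "Measurable.pred N (\<lambda>w. (if u w \<in> T w then 1 else 0 :: ennreal) = 1)" by measurable
  then show ?thesis by (simp split: if_splits cong: if_cong)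
qed

text \<open>Disjointness makes the counts additive. For overlapping sets the count of the union is
  not a function of the two counts.\<close>

lemma measurable_Un_config:
  fixes S T :: "'w \<Rightarrow> 'b::euclidean_space set"
  assumes S[measurable]: "S \<in> N \<rightarrow>\<^sub>M config_M" and T[measurable]: "T \<in> N \<rightarrow>\<^sub>M config_M"
    and disj: "\<And>w. w \<in> space N \<Longrightarrow> S w \<inter> T w = {}"
  shows "(\<lambda>w. S w \<union> T w) \<in> N \<rightarrow>\<^sub>M config_M"
proof (rule measurable_config_M)
  have lf: "locally_finite (S w)" "locally_finite (T w)" if "w \<in> space N" for w
    using measurable_space[OF S that] measurable_space[OF T that] by (auto simp: space_config_M)
  then show "locally_finite (S w \<union> T w)" if "w \<in> space N" for w
    using that by (auto intro: locally_finite_Un)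
  fix B :: "'b set" assume B: "B \<in> sets borel" "bounded B"
  have [measurable]: "(\<lambda>\<gamma>. card (\<gamma> \<inter> B)) \<in> config_M \<rightarrow>\<^sub>M count_space UNIV"
    by (rule measurable_card_Int[OF B])
  have "(\<lambda>w. card (S w \<inter> B) + card (T w \<inter> B)) \<in> N \<rightarrow>\<^sub>M count_space UNIV" by measurable
  moreover have "card ((S w \<union> T w) \<inter> B) = card (S w \<inter> B) + card (T w \<inter> B)" if "w \<in> space N" for w
    unfolding Int_Un_distrib2
    by (subst card_Un_disjoint) (use lf[OF that] disj[OF that] B in \<open>auto intro: locally_finite_Int_bounded\<close>)
  ultimately show "(\<lambda>w. card ((S w \<union> T w) \<inter> B)) \<in> N \<rightarrow>\<^sub>M count_space UNIV"
    by (subst measurable_cong) auto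
qed

lemma measurable_remove_config[measurable (raw)]:
  fixes T :: "'w \<Rightarrow> 'b::euclidean_space set"
  assumes [measurable]: "T \<in> N \<rightarrow>\<^sub>M config_M" and [measurable]: "u \<in> N \<rightarrow>\<^sub>M borel"
  shows "(\<lambda>w. T w - {u w}) \<in> N \<rightarrow>\<^sub>M config_M"
proof -
  have "(\<lambda>w. {y \<in> T w. y \<noteq> u w}) \<in> N \<rightarrow>\<^sub>M config_M"
    by (rule measurable_filter_config) measurable
  moreover have "{y \<in> T w. y \<noteq> u w} = T w - {u w}" for w by auto
  ultimately show ?thesis by simp
qed

lemma measurable_singleton_config:
  fixes u :: "'w \<Rightarrow> 'b::euclidean_space"
  assumes [measurable]: "u \<in> N \<rightarrow>\<^sub>M borel"
  shows "(\<lambda>w. {u w}) \<in> N \<rightarrow>\<^sub>M config_M"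
proof (rule measurable_config_M)
  fix B :: "'b set" assume [measurable]: "B \<in> sets borel" 
  have "(\<lambda>w. if u w \<in> B then 1 else 0 :: nat) \<in> N \<rightarrow>\<^sub>M count_space UNIV" by measurable
  moreover have "card ({u w} \<inter> B) = (if u w \<in> B then 1 else 0)" for w by auto
  ultimately show "(\<lambda>w. card ({u w} \<inter> B)) \<in> N \<rightarrow>\<^sub>M count_space UNIV" by simp
qed (auto intro: finite_imp_locally_finite)

lemma measurable_insert_config[measurable (raw)]:
  fixes T :: "'w \<Rightarrow> 'b::euclidean_space set"
  assumes [measurable]: "T \<in> N \<rightarrow>\<^sub>M config_M" and [measurable]: "u \<in> N \<rightarrow>\<^sub>M borel"
  shows "(\<lambda>w. insert (u w) (T w)) \<in> N \<rightarrow>\<^sub>M config_M"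
proof -
  \<comment> \<open>Deleting \<open>u w\<close> first makes the union disjoint, whether or not the
    point was already present.\<close>
  have "(\<lambda>w. {u w} \<union> (T w - {u w})) \<in> N \<rightarrow>\<^sub>M config_M"
    by (intro measurable_Un_config measurable_singleton_config) auto
  then show ?thesis by simp
qed

lemma measurable_Int_config[measurable (raw)]:
  assumes [measurable]: "T \<in> N \<rightarrow>\<^sub>M config_M" "B \<in> sets borel"
  shows "(\<lambda>w. T w \<inter> B) \<in> N \<rightarrow>\<^sub>M config_M"
proof -
  have "(\<lambda>w. {y \<in> T w. y \<in> B}) \<in> N \<rightarrow>\<^sub>M config_M"
    by (rule measurable_filter_config) measurable
  then show ?thesis by (simp add: Int_def)
qed

lemma measurable_Diff_config[measurable (raw)]:
  assumes [measurable]: "T \<in> N \<rightarrow>\<^sub>M config_M" "B \<in> sets borel"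
  shows "(\<lambda>w. T w - B) \<in> N \<rightarrow>\<^sub>M config_M"
  using measurable_Int_config[of T N "- B"] by (simp add: Diff_eq)

lemma measurable_Int_cball_config[measurable (raw)]:
  fixes T :: "'w \<Rightarrow> 'b::euclidean_space set"
  assumes [measurable]: "T \<in> N \<rightarrow>\<^sub>M config_M" "u \<in> N \<rightarrow>\<^sub>M borel"
  shows "(\<lambda>w. T w \<inter> cball (u w) R) \<in> N \<rightarrow>\<^sub>M config_M"
proof -
  have "(\<lambda>w. {y \<in> T w. dist (u w) y \<le> R}) \<in> N \<rightarrow>\<^sub>M config_M"
    by (rule measurable_filter_config) measurable
  then show ?thesis by (simp add: Int_def)
qed

lemma measurable_nn_integral_remove:
  fixes F :: "'b::euclidean_space \<Rightarrow> 'b set \<Rightarrow> ennreal"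
  assumes [measurable]: "(\<lambda>p. F (fst p) (snd p)) \<in> borel_measurable (borel \<Otimes>\<^sub>M config_M)"
  shows "(\<lambda>\<gamma>. \<integral>\<^sup>+x. F x (\<gamma> - {x}) \<partial>count_space \<gamma>) \<in> borel_measurable config_M"
proof (rule measurable_nn_integral_count_space)
  have "(\<lambda>p. (snd p, fst p - {snd p})) \<in> config_M \<Otimes>\<^sub>M borel \<rightarrow>\<^sub>M borel \<Otimes>\<^sub>M (config_M :: 'b set measure)"
    by measurable
  from measurable_compose[OF this assms]
  show "(\<lambda>p. F (snd p) (fst p - {snd p})) \<in> borel_measurable (config_M \<Otimes>\<^sub>M borel)" by simp
qed simp

lemma measurable_glue_config[measurable (raw)]:
  assumes [measurable]: "S \<in> N \<rightarrow>\<^sub>M config_M" "T \<in> N \<rightarrow>\<^sub>M config_M" "D \<in> sets borel"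
  shows "(\<lambda>w. (S w \<inter> D) \<union> (T w - D)) \<in> N \<rightarrow>\<^sub>M config_M"
  by (rule measurable_Un_config) auto

section \<open>The Poisson process and Mecke's formula\<close>


text \<open>The induction runs over the number \<open>m\<close> of coordinates that are used, while
  the product space keeps all \<open>n\<close> factors; each step then inserts one more
  coordinate.\<close>

lemma measurable_image_config:
  fixes \<Delta> :: "'a::euclidean_space set" and m n :: nat
  assumes "m \<le> n"
  shows "(\<lambda>xs. xs ` {..<m}) \<in> PiM {..<n} (\<lambda>_. restrict_space lborel \<Delta>) \<rightarrow>\<^sub>M config_M"
  using assms
proof (induction m)
  case 0
  then show ?case by (auto intro!: measurable_const simp: space_config_M finite_imp_locally_finite)
next
  case (Suc m)
  have c: "(\<lambda>xs. xs m) \<in> PiM {..<n} (\<lambda>_. restrict_space lborel \<Delta>) \<rightarrow>\<^sub>M restrict_space lborel \<Delta>"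
    using Suc(2) by (intro measurable_component_singleton) auto
  have "(\<lambda>x. x) \<in> restrict_space lborel \<Delta> \<rightarrow>\<^sub>M borel"
    by (intro measurable_restrict_space1) simp
  from measurable_compose[OF c this]
  have "(\<lambda>xs. insert (xs m) (xs ` {..<m})) \<in> PiM {..<n} (\<lambda>_. restrict_space lborel \<Delta>) \<rightarrow>\<^sub>M config_M"
    using Suc by (intro measurable_insert_config) auto
  then show ?case by (simp add: lessThan_Suc)
qed

lemmas measurable_image_config' [measurable] = measurable_image_config[OF order_refl]

text \<open>Integral over \<open>n\<close> ordered points, without the factor \<open>1 / n!\<close>
  of the Poisson law. Leaving out the factor gives clean recursions in \<open>n\<close>.\<close>

definition npoint :: "'b::euclidean_space set \<Rightarrow> nat \<Rightarrow> ('b set \<Rightarrow> ennreal) \<Rightarrow> ennreal" where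
  "npoint \<Delta> n \<phi> = (\<integral>\<^sup>+xs. \<phi> (xs ` {..<n}) \<partial>PiM {..<n} (\<lambda>_. restrict_space lborel \<Delta>))"

context
  fixes \<Delta> :: "'a::euclidean_space set"
  assumes D[measurable]: "\<Delta> \<in> sets borel" and bD: "bounded \<Delta>"
begin

interpretation \<mu>: finite_measure "restrict_space lborel \<Delta>"
  using D bD emeasure_bounded_finite[OF bD] by (intro finite_measureI) (auto simp: emeasure_restrict_space space_restrict_space)

interpretation PP: product_sigma_finite "\<lambda>_::nat. restrict_space lborel \<Delta>" ..

text \<open>\<open>measure_of\<close> returns the given set function only after countable additivity
  has been verified. Here it is a weighted series of image measures, and the two series are
  exchanged by Fubini for counting measures.\<close>

lemma emeasure_poisson_pp:
  assumes A: "A \<in> sets config_M"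
  shows "emeasure (poisson_pp \<Delta>) A
    = ennreal (exp (- measure lborel \<Delta>)) * (\<Sum>n. npoint \<Delta> n (indicator A) / ennreal (fact n))"
proof -
  let ?d = "\<lambda>n. distr (PiM {..<n} (\<lambda>_. restrict_space lborel \<Delta>)) config_M (\<lambda>xs. xs ` {..<n})"
  have np: "npoint \<Delta> n (indicator A) = emeasure (?d n) A" if "A \<in> sets config_M" for A n
    unfolding npoint_def using that
    by (subst nn_integral_indicator[symmetric]) (auto simp: nn_integral_distr simp del: nn_integral_indicator)
  have "emeasure (poisson_pp \<Delta>) A = ennreal (exp (- measure lborel \<Delta>)) * (\<Sum>n. emeasure (?d n) A / ennreal (fact n))"
    unfolding poisson_pp_def
  proof (rule emeasure_measure_of[OF refl])
    show "sets config_M \<subseteq> Pow (space config_M)" by (rule sets.space_closed)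
    show "A \<in> sets (measure_of (space config_M) (sets config_M)
      (\<lambda>A. ennreal (exp (- measure lborel \<Delta>)) * (\<Sum>n. emeasure (?d n) A / ennreal (fact n))))"
      using A by (simp add: sets.sigma_sets_eq)
    show "positive (sets (measure_of (space config_M) (sets config_M)
      (\<lambda>A. ennreal (exp (- measure lborel \<Delta>)) * (\<Sum>n. emeasure (?d n) A / ennreal (fact n)))))
      (\<lambda>A. ennreal (exp (- measure lborel \<Delta>)) * (\<Sum>n. emeasure (?d n) A / ennreal (fact n)))"
      by (simp add: positive_def)
    show "countably_additive (sets (measure_of (space config_M) (sets config_M)
      (\<lambda>A. ennreal (exp (- measure lborel \<Delta>)) * (\<Sum>n. emeasure (?d n) A / ennreal (fact n)))))
      (\<lambda>A. ennreal (exp (- measure lborel \<Delta>)) * (\<Sum>n. emeasure (?d n) A / ennreal (fact n)))"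
    proof (rule countably_additiveI)
      fix B :: "nat \<Rightarrow> 'a set set"
      assume "range B \<subseteq> sets (measure_of (space config_M) (sets config_M)
        (\<lambda>A. ennreal (exp (- measure lborel \<Delta>)) * (\<Sum>n. emeasure (?d n) A / ennreal (fact n))))"
        and dis: "disjoint_family B"
      then have B: "range B \<subseteq> sets config_M" by (simp add: sets.sigma_sets_eq)
      have "(\<Sum>i. ennreal (exp (- measure lborel \<Delta>)) * (\<Sum>n. emeasure (?d n) (B i) / ennreal (fact n)))
         = ennreal (exp (- measure lborel \<Delta>)) * (\<Sum>i. \<Sum>n. emeasure (?d n) (B i) / ennreal (fact n))"
        by simp
      also have "(\<Sum>i. \<Sum>n. emeasure (?d n) (B i) / ennreal (fact n))
         = (\<Sum>n. \<Sum>i. emeasure (?d n) (B i) / ennreal (fact n))"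
        unfolding nn_integral_count_space_nat[symmetric]
        by (rule pair_sigma_finite.Fubini') (auto simp: pair_sigma_finite_def sigma_finite_measure_count_space)
      also have "\<dots> = (\<Sum>n. emeasure (?d n) (\<Union>i. B i) / ennreal (fact n))"
        using B dis by (simp add: suminf_emeasure divide_ennreal_def)
      finally show "(\<Sum>i. ennreal (exp (- measure lborel \<Delta>)) * (\<Sum>n. emeasure (?d n) (B i) / ennreal (fact n)))
        = ennreal (exp (- measure lborel \<Delta>)) * (\<Sum>n. emeasure (?d n) (\<Union>i. B i) / ennreal (fact n))" .
    qed
  qed
  then show ?thesis using np[OF A] by simp
qed

lemma sets_poisson_pp [measurable_cong]: "sets (poisson_pp \<Delta>) = sets config_M"
  by (simp add: poisson_pp_def sets.sigma_sets_eq)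

lemma space_poisson_pp: "space (poisson_pp \<Delta>) = space config_M"
  by (simp add: poisson_pp_def space_measure_of_conv)

lemma npoint_cong: "(\<And>\<gamma>. \<gamma> \<in> space config_M \<Longrightarrow> \<phi> \<gamma> = \<psi> \<gamma>) \<Longrightarrow> npoint \<Delta> n \<phi> = npoint \<Delta> n \<psi>"
  unfolding npoint_def by (intro nn_integral_cong) (auto simp: space_config_M finite_imp_locally_finite)

lemma nn_integral_poisson_pp:
  assumes "\<phi> \<in> borel_measurable config_M"
  shows "(\<integral>\<^sup>+\<gamma>. \<phi> \<gamma> \<partial>poisson_pp \<Delta>)
    = ennreal (exp (- measure lborel \<Delta>)) * (\<Sum>n. npoint \<Delta> n \<phi> / ennreal (fact n))"
  using assms
proof (induction rule: borel_measurable_induct)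
  case (cong f g)
  have "(\<integral>\<^sup>+\<gamma>. f \<gamma> \<partial>poisson_pp \<Delta>) = (\<integral>\<^sup>+\<gamma>. g \<gamma> \<partial>poisson_pp \<Delta>)"
    using cong(3) by (intro nn_integral_cong) (auto simp: space_poisson_pp)
  with cong(4) npoint_cong[OF cong(3)] show ?case by simp
next
  case (set A)
  then show ?case using emeasure_poisson_pp[OF set] by (simp add: sets_poisson_pp)
next
  case (mult u c)
  have "npoint \<Delta> n (\<lambda>\<gamma>. c * u \<gamma>) = c * npoint \<Delta> n u" for n
    unfolding npoint_def using mult(2) by (intro nn_integral_cmult measurable_compose[OF measurable_image_config'])
  then show ?case using mult
    by (simp add: nn_integral_cmult measurable_cong_sets[OF sets_poisson_pp refl] divide_ennreal_def mult_ac
        ennreal_suminf_cmult[symmetric] del: ennreal_suminf_cmult)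
next
  case (add u v)
  have "npoint \<Delta> n (\<lambda>\<gamma>. v \<gamma> + u \<gamma>) = npoint \<Delta> n v + npoint \<Delta> n u" for n
    unfolding npoint_def using add(1,3) by (intro nn_integral_add measurable_compose[OF measurable_image_config'])
  then show ?case using add
    by (simp add: nn_integral_add measurable_cong_sets[OF sets_poisson_pp refl] divide_ennreal_def
        distrib_right suminf_add[symmetric] distrib_left)
next
  case (seq U)
  note [measurable] = seq(1)
  have np: "npoint \<Delta> n (SUP i. U i) = (SUP i. npoint \<Delta> n (U i))" for n
  proof -
    have "npoint \<Delta> n (SUP i. U i) = (\<integral>\<^sup>+xs. (SUP i. U i (xs ` {..<n})) \<partial>PiM {..<n} (\<lambda>_. restrict_space lborel \<Delta>))"
      unfolding npoint_def by (simp add: SUP_apply image_comp)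
    also have "\<dots> = (SUP i. npoint \<Delta> n (U i))"
      unfolding npoint_def using seq(3)
      by (intro nn_integral_monotone_convergence_SUP) (auto simp: incseq_def le_fun_def)
    finally show ?thesis .
  qed
  have inc: "incseq (\<lambda>i. npoint \<Delta> n (U i))" for n
    unfolding npoint_def using seq(3)
    by (auto simp: incseq_def le_fun_def intro!: nn_integral_mono)
  have "(\<integral>\<^sup>+\<gamma>. (SUP i. U i) \<gamma> \<partial>poisson_pp \<Delta>) = (SUP i. \<integral>\<^sup>+\<gamma>. U i \<gamma> \<partial>poisson_pp \<Delta>)"
    using seq(3) unfolding SUP_apply
    by (intro nn_integral_monotone_convergence_SUP) (auto simp: measurable_cong_sets[OF sets_poisson_pp refl])
  also have "\<dots> = (SUP i. ennreal (exp (- measure lborel \<Delta>)) * (\<Sum>n. npoint \<Delta> n (U i) / ennreal (fact n)))"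
    using seq.IH by simp
  also have "\<dots> = ennreal (exp (- measure lborel \<Delta>)) * (SUP i. \<Sum>n. npoint \<Delta> n (U i) / ennreal (fact n))"
    by (simp add: SUP_mult_left_ennreal)
  also have "(SUP i. \<Sum>n. npoint \<Delta> n (U i) / ennreal (fact n)) = (\<Sum>n. SUP i. npoint \<Delta> n (U i) / ennreal (fact n))"
    using inc by (intro ennreal_suminf_SUP_eq[symmetric]) (auto simp: incseq_def divide_ennreal_def intro!: mult_right_mono)
  also have "\<dots> = (\<Sum>n. npoint \<Delta> n (SUP i. U i) / ennreal (fact n))"
    by (simp add: np divide_ennreal_def SUP_mult_right_ennreal)
  finally show ?case .
qed

lemma npoint_0: "npoint \<Delta> 0 \<phi> = \<phi> {}"
  by (simp add: npoint_def PiM_empty nn_integral_count_space_finite)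

lemma npoint_Suc:
  assumes [measurable]: "\<phi> \<in> borel_measurable config_M"
  shows "npoint \<Delta> (Suc n) \<phi> = npoint \<Delta> n (\<lambda>\<gamma>. \<integral>\<^sup>+y. \<phi> (insert y \<gamma>) \<partial>restrict_space lborel \<Delta>)"
proof -
  have m: "(\<lambda>xs. \<phi> (xs ` insert n {..<n})) \<in> borel_measurable (PiM (insert n {..<n}) (\<lambda>_. restrict_space lborel \<Delta>))"
    unfolding lessThan_Suc[symmetric] by measurable
  have "npoint \<Delta> (Suc n) \<phi> = (\<integral>\<^sup>+xs. (\<integral>\<^sup>+y. \<phi> ((xs(n := y)) ` insert n {..<n}) \<partial>restrict_space lborel \<Delta>) 
      \<partial>PiM {..<n} (\<lambda>_. restrict_space lborel \<Delta>))"
    unfolding npoint_def lessThan_Suc by (intro PP.product_nn_integral_insert m) auto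
  also have "(\<lambda>xs y. (xs(n := y)) ` insert n {..<n}) = (\<lambda>xs y. insert y (xs ` {..<n}))"
    by (intro ext) (auto simp: image_iff)
  finally show ?thesis unfolding npoint_def by (simp add: fun_eq_iff)
qed

lemma npoint_Fubini:
  assumes G[measurable]: "(\<lambda>p. G (fst p) (snd p)) \<in> borel_measurable (borel \<Otimes>\<^sub>M config_M)"
  shows "npoint \<Delta> n (\<lambda>\<gamma>. \<integral>\<^sup>+y. G y \<gamma> \<partial>restrict_space lborel \<Delta>) = (\<integral>\<^sup>+y. npoint \<Delta> n (G y) \<partial>restrict_space lborel \<Delta>)"
proof -
  interpret P: sigma_finite_measure "PiM {..<n} (\<lambda>_::nat. restrict_space lborel \<Delta>)"
    by (rule PP.sigma_finite) simp
  interpret pair_sigma_finite "PiM {..<n} (\<lambda>_::nat. restrict_space lborel \<Delta>)" "restrict_space lborel \<Delta>" ..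
  have [measurable]: "(\<lambda>x. x) \<in> restrict_space lborel \<Delta> \<rightarrow>\<^sub>M borel"
    by (intro measurable_restrict_space1) simp
  have "(\<lambda>p. G (snd p) (fst p ` {..<n})) \<in> borel_measurable (PiM {..<n} (\<lambda>_. restrict_space lborel \<Delta>) \<Otimes>\<^sub>M restrict_space lborel \<Delta>)"
  proof -
    have "(\<lambda>p. (snd p, fst p ` {..<n})) \<in> PiM {..<n} (\<lambda>_. restrict_space lborel \<Delta>) \<Otimes>\<^sub>M restrict_space lborel \<Delta>
        \<rightarrow>\<^sub>M borel \<Otimes>\<^sub>M config_M"
      by (intro measurable_Pair measurable_compose[OF measurable_fst] measurable_compose[OF measurable_snd]) measurable
    from measurable_compose[OF this G] show ?thesis by simp
  qed
  then show ?thesis unfolding npoint_def by (subst Fubini') (auto simp: split_beta')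
qed

lemma measurable_nn_integral_restrict_space:
  assumes G[measurable]: "(\<lambda>p. G (fst p) (snd p)) \<in> borel_measurable (N \<Otimes>\<^sub>M borel)"
  shows "(\<lambda>w. \<integral>\<^sup>+y. G w y \<partial>restrict_space lborel \<Delta>) \<in> borel_measurable N"
proof -
  have "(\<lambda>w. \<integral>\<^sup>+y. G w y * indicator \<Delta> y \<partial>lborel) \<in> borel_measurable N"
    using G by (intro lborel.borel_measurable_nn_integral) (simp add: split_beta')
  then show ?thesis by (subst nn_integral_restrict_space) auto
qed

text \<open>Lebesgue measure has no atoms. Otherwise a new point could coincide with an old one and
  be swallowed by the set.\<close>

lemma AE_notin_finite: 
  assumes "finite \<gamma>" 
  shows "AE y in restrict_space lborel \<Delta>. y \<notin> \<gamma>"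
proof -
  have "AE y in lborel. y \<notin> \<gamma>"
    using assms by (intro AE_I'[of \<gamma>]) (auto simp: finite_imp_null_set_lborel)
  then show ?thesis by (subst AE_restrict_space_iff) auto
qed

text \<open>Adding a last point \<open>y\<close>, the sum over \<open>insert y \<gamma>\<close> splits for almost every \<open>y\<close>
  into the term of \<open>y\<close> and a sum over \<open>\<gamma>\<close> to which the induction hypothesis applies.\<close>

lemma npoint_Mecke:
  assumes G[measurable]: "(\<lambda>p. G (fst p) (snd p)) \<in> borel_measurable (borel \<Otimes>\<^sub>M config_M)"
  shows "npoint \<Delta> (Suc n) (\<lambda>\<gamma>. \<integral>\<^sup>+x. G x (\<gamma> - {x}) \<partial>count_space \<gamma>)
     = of_nat (Suc n) * (\<integral>\<^sup>+x. npoint \<Delta> n (G x) \<partial>restrict_space lborel \<Delta>)"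
  using G
proof (induction n arbitrary: G)
  case (0 G)
  have "(\<lambda>\<gamma>. \<integral>\<^sup>+x. G x (\<gamma> - {x}) \<partial>count_space \<gamma>) \<in> borel_measurable config_M"
    by (rule measurable_nn_integral_remove[OF 0])
  then show ?case by (simp add: npoint_0 npoint_Suc nn_integral_count_space_finite)
next
  case (Suc n G)
  note [measurable] = Suc(2)
  \<comment> \<open>\<open>G'\<close> absorbs the integration over the last point. The induction
    hypothesis holds for every integrand, so it applies to \<open>G'\<close> with one point
    fewer.\<close>
  define G' where "G' x \<gamma> = (\<integral>\<^sup>+y. G x (insert y \<gamma>) \<partial>restrict_space lborel \<Delta>)" for x \<gamma>
  have G'm[measurable]: "(\<lambda>p. G' (fst p) (snd p)) \<in> borel_measurable (borel \<Otimes>\<^sub>M config_M)"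
  proof -
    have "(\<lambda>q. (fst (fst q), insert (snd q) (snd (fst q)))) \<in> (borel \<Otimes>\<^sub>M config_M) \<Otimes>\<^sub>M borel
       \<rightarrow>\<^sub>M borel \<Otimes>\<^sub>M (config_M :: 'a set measure)" by measurable
    from measurable_compose[OF this Suc(2)] show ?thesis
      unfolding G'_def by (intro measurable_nn_integral_restrict_space) simp
  qed
  have Gx: "G x \<in> borel_measurable config_M" for x
    using measurable_compose[OF measurable_Pair1' Suc(2), of x] by simp
  let ?S = "\<lambda>\<gamma>. \<integral>\<^sup>+x. G x (\<gamma> - {x}) \<partial>count_space \<gamma>"
  let ?S' = "\<lambda>\<gamma>. \<integral>\<^sup>+x. G' x (\<gamma> - {x}) \<partial>count_space \<gamma>"
  have Sm[measurable]: "?S \<in> borel_measurable config_M" "?S' \<in> borel_measurable config_M"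
    by (rule measurable_nn_integral_remove[OF Suc(2)], rule measurable_nn_integral_remove[OF G'm])
  have Ym[measurable]: "(\<lambda>\<gamma>. \<integral>\<^sup>+y. G y \<gamma> \<partial>restrict_space lborel \<Delta>) \<in> borel_measurable config_M"
  proof -
    have "(\<lambda>q. (snd q, fst q)) \<in> config_M \<Otimes>\<^sub>M borel \<rightarrow>\<^sub>M borel \<Otimes>\<^sub>M (config_M :: 'a set measure)" by measurable
    from measurable_compose[OF this Suc(2)] show ?thesis
      by (intro measurable_nn_integral_restrict_space) simp
  qed
  have split: "(\<integral>\<^sup>+y. ?S (insert y \<gamma>) \<partial>restrict_space lborel \<Delta>)
      = (\<integral>\<^sup>+y. G y \<gamma> \<partial>restrict_space lborel \<Delta>) + ?S' \<gamma>" if fin: "finite \<gamma>" for \<gamma>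
  proof -
    have lf: "locally_finite \<gamma>" by (rule finite_imp_locally_finite[OF fin])
    have idm[measurable]: "(\<lambda>x. x) \<in> restrict_space lborel \<Delta> \<rightarrow>\<^sub>M borel"
      by (intro measurable_restrict_space1) simp
    have m1[measurable]: "G y \<in> borel_measurable config_M" for y by (rule Gx)
    have [measurable]: "(\<lambda>y. G y \<gamma>) \<in> borel_measurable (restrict_space lborel \<Delta>)"
    proof -
      have "(\<lambda>y. (y, \<gamma>)) \<in> restrict_space lborel \<Delta> \<rightarrow>\<^sub>M borel \<Otimes>\<^sub>M config_M"
        using lf by (intro measurable_Pair) (auto simp: space_config_M)
      from measurable_compose[OF this Suc(2)] show ?thesis by simp
    qed
    have [measurable]: "(\<lambda>y. G x (insert y (\<gamma> - {x}))) \<in> borel_measurable (restrict_space lborel \<Delta>)" for x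
    proof -
      have "(\<lambda>y. insert y (\<gamma> - {x})) \<in> restrict_space lborel \<Delta> \<rightarrow>\<^sub>M config_M"
        using fin by (intro measurable_insert_config measurable_const)
          (auto simp: space_config_M intro: finite_imp_locally_finite)
      from measurable_compose[OF this m1] show ?thesis .
    qed
    have "(\<integral>\<^sup>+y. ?S (insert y \<gamma>) \<partial>restrict_space lborel \<Delta>)
      = (\<integral>\<^sup>+y. G y \<gamma> + (\<Sum>x\<in>\<gamma>. G x (insert y (\<gamma> - {x}))) \<partial>restrict_space lborel \<Delta>)"
    proof (rule nn_integral_cong_AE, use AE_notin_finite[OF fin] in eventually_elim)
      fix y assume y: "y \<notin> \<gamma>"
      have "?S (insert y \<gamma>) = (\<Sum>x\<in>insert y \<gamma>. G x (insert y \<gamma> - {x}))"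
        using fin by (subst nn_integral_count_space_finite) auto
      also have "\<dots> = G y \<gamma> + (\<Sum>x\<in>\<gamma>. G x (insert y \<gamma> - {x}))"
        using fin y by simp
      also have "(\<Sum>x\<in>\<gamma>. G x (insert y \<gamma> - {x})) = (\<Sum>x\<in>\<gamma>. G x (insert y (\<gamma> - {x})))"
        using y by (intro sum.cong refl arg_cong2[where f=G]) auto
      finally show "?S (insert y \<gamma>) = G y \<gamma> + (\<Sum>x\<in>\<gamma>. G x (insert y (\<gamma> - {x})))" .
    qed
    also have "\<dots> = (\<integral>\<^sup>+y. G y \<gamma> \<partial>restrict_space lborel \<Delta>) + (\<Sum>x\<in>\<gamma>. G' x (\<gamma> - {x}))"
      unfolding G'_def by (subst nn_integral_add) (auto simp: nn_integral_sum)
    also have "(\<Sum>x\<in>\<gamma>. G' x (\<gamma> - {x})) = ?S' \<gamma>"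
      using fin by (simp add: nn_integral_count_space_finite)
    finally show ?thesis .
  qed
  have "npoint \<Delta> (Suc (Suc n)) ?S = npoint \<Delta> (Suc n) (\<lambda>\<gamma>. \<integral>\<^sup>+y. ?S (insert y \<gamma>) \<partial>restrict_space lborel \<Delta>)"
    by (rule npoint_Suc) (rule Sm)
  also have "\<dots> = npoint \<Delta> (Suc n) (\<lambda>\<gamma>. (\<integral>\<^sup>+y. G y \<gamma> \<partial>restrict_space lborel \<Delta>) + ?S' \<gamma>)"
    unfolding npoint_def by (intro nn_integral_cong split) auto
  also have "\<dots> = npoint \<Delta> (Suc n) (\<lambda>\<gamma>. \<integral>\<^sup>+y. G y \<gamma> \<partial>restrict_space lborel \<Delta>) + npoint \<Delta> (Suc n) ?S'"
    unfolding npoint_def 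
    by (intro nn_integral_add measurable_compose[OF measurable_image_config' Ym] measurable_compose[OF measurable_image_config' Sm(2)])
  also have "npoint \<Delta> (Suc n) ?S' = of_nat (Suc n) * (\<integral>\<^sup>+x. npoint \<Delta> n (G' x) \<partial>restrict_space lborel \<Delta>)"
    by (rule Suc(1)[OF G'm])
  \<comment> \<open>The point integrated out in \<open>G'\<close> becomes a coordinate again. The
    sum over old points is thus \<open>Suc n\<close> times the very integral that the new point
    contributes, and together they give the factor \<open>Suc (Suc n)\<close>.\<close>
  also have "(\<lambda>x. npoint \<Delta> n (G' x)) = (\<lambda>x. npoint \<Delta> (Suc n) (G x))"
    unfolding G'_def by (intro ext npoint_Suc[symmetric] Gx)
  also have "npoint \<Delta> (Suc n) (\<lambda>\<gamma>. \<integral>\<^sup>+y. G y \<gamma> \<partial>restrict_space lborel \<Delta>) = (\<integral>\<^sup>+y. npoint \<Delta> (Suc n) (G y) \<partial>restrict_space lborel \<Delta>)"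
    by (rule npoint_Fubini[OF Suc(2)])
  finally show ?case by (simp add: distrib_right)
qed

text \<open>The factor \<open>Suc n\<close> in the \<open>n\<close>-point identity turns
  \<open>1 / (Suc n)!\<close> into \<open>1 / n!\<close>, so the term of index \<open>Suc n\<close>
  on the left is the term of index \<open>n\<close> on the right. The empty configuration
  contributes nothing on the left, hence no term is lost in the shift.\<close>

lemma poisson_pp_Mecke:
  assumes G[measurable]: "(\<lambda>p. G (fst p) (snd p)) \<in> borel_measurable (borel \<Otimes>\<^sub>M config_M)"
  shows "(\<integral>\<^sup>+\<gamma>. (\<integral>\<^sup>+x. G x (\<gamma> - {x}) * indicator \<Delta> x \<partial>count_space \<gamma>) \<partial>poisson_pp \<Delta>)
     = (\<integral>\<^sup>+\<gamma>. (\<integral>\<^sup>+x. G x \<gamma> * indicator \<Delta> x \<partial>lborel) \<partial>poisson_pp \<Delta>)"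
proof -
  let ?G = "\<lambda>x \<gamma>. G x \<gamma> * indicator \<Delta> x"
  have Gm[measurable]: "(\<lambda>p. ?G (fst p) (snd p)) \<in> borel_measurable (borel \<Otimes>\<^sub>M config_M)" by measurable
  let ?S = "\<lambda>\<gamma>. \<integral>\<^sup>+x. ?G x (\<gamma> - {x}) \<partial>count_space \<gamma>"
  let ?I = "\<lambda>\<gamma>. \<integral>\<^sup>+x. ?G x \<gamma> \<partial>restrict_space lborel \<Delta>"
  have I_eq: "?I = (\<lambda>\<gamma>. \<integral>\<^sup>+x. ?G x \<gamma> \<partial>lborel)"
    by (subst nn_integral_restrict_space) (auto intro!: ext nn_integral_cong split: split_indicator)
  have Im: "?I \<in> borel_measurable config_M"
  proof -
    have "(\<lambda>q. (snd q, fst q)) \<in> config_M \<Otimes>\<^sub>M borel \<rightarrow>\<^sub>M borel \<Otimes>\<^sub>M (config_M :: 'a set measure)" by measurable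
    from measurable_compose[OF this Gm] show ?thesis
      by (intro measurable_nn_integral_restrict_space) simp
  qed
  have "npoint \<Delta> (Suc n) ?S / ennreal (fact (Suc n)) = npoint \<Delta> n ?I / ennreal (fact n)" for n
  proof -
    have "npoint \<Delta> (Suc n) ?S = of_nat (Suc n) * npoint \<Delta> n ?I"
      by (simp only: npoint_Mecke[OF Gm] npoint_Fubini[OF Gm])
    moreover have "ennreal (fact (Suc n)) = of_nat (Suc n) * ennreal (fact n)"
      by (simp add: ennreal_mult ennreal_of_nat_eq_real_of_nat)
    moreover have "(of_nat (Suc n) * a) / (of_nat (Suc n) * ennreal (fact n)) = a / ennreal (fact n)" for a
    proof -
      have "(of_nat (Suc n) * a) / (of_nat (Suc n) * ennreal (fact n))
          = ((a * of_nat (Suc n)) / of_nat (Suc n)) / ennreal (fact n)"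
        unfolding divide_ennreal_def
        by (subst ennreal_inverse_mult) (simp_all only: mult_ac of_nat_less_top ennreal_less_top)
      also have "(a * of_nat (Suc n)) / of_nat (Suc n) = a"
        by (rule mult_divide_eq_ennreal) (simp_all del: of_nat_Suc)
      finally show ?thesis .
    qed
    ultimately have "npoint \<Delta> (Suc n) ?S / ennreal (fact (Suc n)) = npoint \<Delta> n ?I / ennreal (fact n)"
      by (simp only:)
    then show ?thesis .
  qed
  then have "(\<Sum>n. npoint \<Delta> n ?I / ennreal (fact n)) = (\<Sum>n. npoint \<Delta> (Suc n) ?S / ennreal (fact (Suc n)))" by simp
  also have "\<dots> = (\<Sum>n. npoint \<Delta> n ?S / ennreal (fact n))"
    using suminf_offset[of "\<lambda>n. npoint \<Delta> n ?S / ennreal (fact n)" 1]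
    by (simp add: npoint_0 nn_integral_count_space_finite)
  finally have "(\<integral>\<^sup>+\<gamma>. ?S \<gamma> \<partial>poisson_pp \<Delta>) = (\<integral>\<^sup>+\<gamma>. ?I \<gamma> \<partial>poisson_pp \<Delta>)"
    by (subst (1 2) nn_integral_poisson_pp) (auto intro: Im measurable_nn_integral_remove Gm)
  then show ?thesis unfolding I_eq .
qed

text \<open>The total mass is dominated by the exponential series of the volume of \<Delta>. This
  finiteness gives measurability of integrals over \<open>poisson_pp \<Delta>\<close> that depend on
  a parameter.\<close>

lemma sigma_finite_poisson_pp: "sigma_finite_measure (poisson_pp \<Delta>)"
proof (rule sigma_finite_measure.intro, intro exI conjI)
  have one: "npoint \<Delta> n (\<lambda>_. 1) = ennreal (measure lborel \<Delta> ^ n)" for n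
  proof -
    have e: "emeasure lborel \<Delta> = ennreal (measure lborel \<Delta>)"
      using emeasure_bounded_finite[OF bD] by (intro emeasure_eq_ennreal_measure) auto
    have "npoint \<Delta> n (\<lambda>_. 1) = (\<Prod>i<n. emeasure lborel \<Delta>)"
      using D PP.emeasure_PiM[of "{..<n}" "\<lambda>_. \<Delta>"] unfolding npoint_def
      by (simp add: space_PiM emeasure_restrict_space space_restrict_space sets_restrict_space_iff)
    then show ?thesis by (simp add: e ennreal_power)
  qed
  have "emeasure (poisson_pp \<Delta>) (space config_M) = (\<integral>\<^sup>+\<gamma>. 1 \<partial>poisson_pp \<Delta>)"
    by (simp add: space_poisson_pp)
  also have "\<dots> = ennreal (exp (- measure lborel \<Delta>)) * (\<Sum>n. ennreal (measure lborel \<Delta> ^ n / fact n))"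
    by (subst nn_integral_poisson_pp) (auto simp: one divide_ennreal)
  also have "\<dots> < \<infinity>"
    using summable_exp[of "measure lborel \<Delta>"]
    by (subst suminf_ennreal2) (auto simp: divide_inverse mult_ac ennreal_mult_less_top)
  finally show "\<forall>a\<in>{space config_M}. emeasure (poisson_pp \<Delta>) a \<noteq> \<infinity>" by simp
qed (auto simp: sets_poisson_pp space_poisson_pp)

end

section \<open>Finite-range energies and the Georgii-Nguyen-Zessin equation\<close>


lemma enlarge_singleton: "enlarge {x} R = cball x R"
  by (simp add: enlarge_def)

lemma bounded_enlarge: "bounded \<Delta> \<Longrightarrow> bounded (enlarge \<Delta> R)"
proof -
  assume "bounded \<Delta>"
  then obtain B where B: "\<And>x. x \<in> \<Delta> \<Longrightarrow> norm x \<le> B" unfolding bounded_iff by auto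
  have "norm y \<le> B + R" if "x \<in> \<Delta>" "dist x y \<le> R" for x y
    using B[OF that(1)] that(2) norm_triangle_sub[of y x] by (simp add: dist_norm norm_minus_commute)
  then have "\<forall>y\<in>enlarge \<Delta> R. norm y \<le> B + R" by (auto simp: enlarge_def)
  then show ?thesis unfolding bounded_iff by blast
qed

text \<open>For a point outside the smaller ball the witness is its radial projection onto the
  sphere of radius \<open>c\<close>. The enlarged set is again a ball, hence Borel, and this is why
  the DLR equations are exploited on balls.\<close>

lemma enlarge_cball:
  fixes c :: real
  assumes "c > 0" "R \<ge> 0"
  shows "enlarge (cball (0::'a::euclidean_space) c) R = cball 0 (c + R)"
proof (intro set_eqI iffI)
  fix y :: 'a assume "y \<in> enlarge (cball 0 c) R"
  then obtain x where "norm x \<le> c" "dist x y \<le> R" by (auto simp: enlarge_def)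
  then show "y \<in> cball 0 (c + R)"
    using norm_triangle_sub[of y x] by (simp add: dist_norm norm_minus_commute)
next
  fix y :: 'a assume y: "y \<in> cball 0 (c + R)"
  show "y \<in> enlarge (cball 0 c) R"
  proof (cases "norm y \<le> c")
    case True
    then show ?thesis using assms by (auto simp: enlarge_def intro!: bexI[of _ y])
  next
    case False
    have y0: "y \<noteq> 0" using False assms(1) by (metis norm_zero less_imp_le)
    define x where "x = (c / norm y) *\<^sub>R y"
    have "x - y = (c / norm y - 1) *\<^sub>R y" by (simp add: x_def algebra_simps)
    then have "norm (x - y) = \<bar>c / norm y - 1\<bar> * norm y" by simp
    also have "\<dots> = norm y - c"
      using y0 False assms by (simp add: abs_if field_simps)
    finally have "norm (x - y) = norm y - c" .
    moreover have "norm x = c" using y0 assms by (simp add: x_def)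
    ultimately show ?thesis using y by (auto simp: enlarge_def dist_norm intro!: bexI[of _ x])
  qed
qed

text \<open>\<open>loc_fin\<close> records that a differentiable local energy is real-valued off the
  configuration, so there is no hard core.\<close>

locale finite_range_energy =
  fixes H :: "'a::euclidean_space set \<Rightarrow> ereal" and R :: real
  assumes energy: "energy_function H" and range: "finite_range H R" and R_pos: "R > 0"
    and loc_fin: "\<And>\<gamma> x. locally_finite \<gamma> \<Longrightarrow> x \<notin> \<gamma> \<Longrightarrow> \<bar>loc_energy H R x \<gamma>\<bar> \<noteq> \<infinity>"
begin

text \<open>Finite range for the one-point set \<open>{x}\<close>, whose enlargement is the ball of
  radius \<open>R\<close>: the increment of \<open>H\<close> sees this ball only.\<close>

lemma loc_energy_finite_config:
  assumes "finite \<gamma>" "x \<notin> \<gamma>"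
  shows "ediff (H (insert x \<gamma>)) (H \<gamma>) = loc_energy H R x \<gamma>"
proof -
  have "bounded {x}" by simp
  then have "ediff (H (insert x \<gamma>)) (H (insert x \<gamma> - {x}))
      = ediff (H (insert x \<gamma> \<inter> cball x R)) (H (insert x \<gamma> \<inter> (cball x R - {x})))"
    using range assms unfolding finite_range_def enlarge_singleton[symmetric] by blast
  moreover have "insert x \<gamma> - {x} = \<gamma>" "insert x \<gamma> \<inter> cball x R = insert x (\<gamma> \<inter> cball x R)"
      "insert x \<gamma> \<inter> (cball x R - {x}) = \<gamma> \<inter> cball x R"
    using assms R_pos by auto
  ultimately show ?thesis by (simp add: loc_energy_def)
qed

text \<open>Stability at the empty set gives \<open>H {} \<ge> 0\<close>, so \<open>H {}\<close> is
  finite; each further point adds a finite local energy.\<close>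

lemma H_finite: "finite \<gamma> \<Longrightarrow> \<bar>H \<gamma>\<bar> \<noteq> \<infinity>"
proof (induction rule: finite_induct)
  case empty
  obtain A where "\<forall>\<gamma>. finite \<gamma> \<longrightarrow> H \<gamma> \<ge> - ereal (A * real (card \<gamma>))"
    using energy unfolding energy_function_def by blast
  from this[rule_format, of "{}"] have "H {} \<ge> 0" by (simp add: zero_ereal_def)
  then show ?case using energy unfolding energy_function_def by (cases "H {}") auto
next
  case (insert x \<gamma>)
  have "\<bar>ediff (H (insert x \<gamma>)) (H \<gamma>)\<bar> \<noteq> \<infinity>"
    using loc_fin[OF finite_imp_locally_finite[OF insert(1)] insert(2)]
    by (simp add: loc_energy_finite_config[OF insert(1,2)])
  then show ?case using insert(3) by (cases "H \<gamma>"; cases "H (insert x \<gamma>)") (auto simp: ediff_def)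
qed

definition Hr :: "'a set \<Rightarrow> real" where "Hr \<gamma> = real_of_ereal (H \<gamma>)"

definition h :: "'a \<Rightarrow> 'a set \<Rightarrow> real" where "h x \<gamma> = real_of_ereal (loc_energy H R x \<gamma>)"

lemma H_eq: "finite \<gamma> \<Longrightarrow> H \<gamma> = ereal (Hr \<gamma>)"
  using H_finite[of \<gamma>] by (simp add: Hr_def ereal_real')

lemma ediff_H: "finite \<gamma> \<Longrightarrow> finite \<eta> \<Longrightarrow> ediff (H \<gamma>) (H \<eta>) = ereal (Hr \<gamma> - Hr \<eta>)"
  by (simp add: H_eq ediff_def)

lemma h_eq: "locally_finite \<gamma> \<Longrightarrow> h x \<gamma> = Hr (insert x (\<gamma> \<inter> cball x R)) - Hr (\<gamma> \<inter> cball x R)"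
  by (simp add: h_def loc_energy_def ediff_H locally_finite_Int_bounded)

text \<open>Inserting a point that is already present changes nothing. The value of \<open>h\<close>
  on \<gamma> is thus a convention, unrelated to the limits of \<open>h\<close> at such a
  point.\<close>

lemma h_in: "locally_finite \<gamma> \<Longrightarrow> x \<in> \<gamma> \<Longrightarrow> h x \<gamma> = 0"
  using R_pos by (simp add: h_eq insert_absorb)

text \<open>Any bounded window that contains the ball around \<open>x\<close> may replace the ball.
  Local energies at different points can so be expressed through one and the same finite
  configuration.\<close>

lemma h_window:
  assumes lf: "locally_finite \<gamma>" and x: "x \<notin> \<gamma>" and W: "bounded W" "cball x R \<subseteq> W"
  shows "h x \<gamma> = Hr (insert x (\<gamma> \<inter> W)) - Hr (\<gamma> \<inter> W)"
proof -
  have fin: "finite (\<gamma> \<inter> W)" using lf W by (auto intro: locally_finite_Int_bounded)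
  have "loc_energy H R x \<gamma> = loc_energy H R x (\<gamma> \<inter> W)"
    using W(2) by (simp add: loc_energy_def Int_assoc Int_absorb1)
  also have "\<dots> = ediff (H (insert x (\<gamma> \<inter> W))) (H (\<gamma> \<inter> W))"
    using fin x by (subst loc_energy_finite_config) auto
  finally show ?thesis using fin by (simp add: h_def ediff_H)
qed

text \<open>In a common window \<open>W\<close> for both balls, either side is the energy of the
  configuration with both points minus the energy with neither, and so does not depend on the order
  of insertion.\<close>

lemma h_insert_swap:
  assumes lf: "locally_finite \<gamma>" and xy: "x \<noteq> y" "x \<notin> \<gamma>" "y \<notin> \<gamma>"
  shows "h x (insert y \<gamma>) + h y \<gamma> = h y (insert x \<gamma>) + h x \<gamma>"
proof -
  define W where "W = insert x (insert y (cball x R \<union> cball y R))"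
  have W: "bounded W" "cball x R \<subseteq> W" "cball y R \<subseteq> W" "x \<in> W" "y \<in> W" by (auto simp: W_def)
  have "insert y \<gamma> \<inter> W = insert y (\<gamma> \<inter> W)" "insert x \<gamma> \<inter> W = insert x (\<gamma> \<inter> W)"
    using W by auto
  then show ?thesis
    using h_window[OF locally_finite_insert[OF lf, of y] _ W(1,2)] h_window[OF lf _ W(1,2)]
      h_window[OF locally_finite_insert[OF lf, of x] _ W(1,3)] h_window[OF lf _ W(1,3)] xy
    by (simp add: insert_commute)
qed

text \<open>With the window \<open>enlarge K R\<close> for all \<open>x\<close> at once, the
  subtracted energy is that of one fixed finite configuration, while stability bounds the energy
  with the additional point from below.\<close>

lemma h_bounded_below:
  assumes lf: "locally_finite \<gamma>" and K: "bounded K"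
  obtains c where "\<And>x. x \<in> K \<Longrightarrow> h x \<gamma> \<ge> c"
proof -
  obtain A where A: "A \<ge> 0" "\<forall>\<gamma>. finite \<gamma> \<longrightarrow> H \<gamma> \<ge> - ereal (A * real (card \<gamma>))"
    using energy unfolding energy_function_def by blast
  let ?W = "enlarge K R"
  have W: "bounded ?W" by (rule bounded_enlarge[OF K])
  have fin: "finite (\<gamma> \<inter> ?W)" by (rule locally_finite_Int_bounded[OF lf W])
  \<comment> \<open>The \<open>+ 1\<close> counts the additional point. The absolute value makes
    \<open>c\<close> nonpositive, which also covers the points of \<gamma>, where \<open>h\<close>
    is 0.\<close>
  define c where "c = - (A * (real (card (\<gamma> \<inter> ?W)) + 1)) - \<bar>Hr (\<gamma> \<inter> ?W)\<bar>"
  have "h x \<gamma> \<ge> c" if x: "x \<in> K" for x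
  proof (cases "x \<in> \<gamma>")
    case True
    have "0 \<le> A * (real (card (\<gamma> \<inter> ?W)) + 1)" using A(1) by simp
    then show ?thesis using True by (simp add: h_in[OF lf] c_def)
  next
    case False
    have "ereal (Hr (insert x (\<gamma> \<inter> ?W))) \<ge> - ereal (A * real (card (insert x (\<gamma> \<inter> ?W))))"
      using A(2)[rule_format, of "insert x (\<gamma> \<inter> ?W)"] fin by (simp add: H_eq)
    then have "Hr (insert x (\<gamma> \<inter> ?W)) \<ge> - (A * (real (card (\<gamma> \<inter> ?W)) + 1))"
      using False fin by (simp add: add.commute)
    moreover have "h x \<gamma> = Hr (insert x (\<gamma> \<inter> ?W)) - Hr (\<gamma> \<inter> ?W)"
      using x by (intro h_window[OF lf False W]) (auto simp: enlarge_def)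
    ultimately show ?thesis by (simp add: c_def)
  qed
  then show ?thesis by (rule that)
qed

lemma cond_energy_eq:
  assumes "locally_finite \<gamma>" "bounded \<Delta>"
  shows "cond_energy H R \<Delta> \<gamma> = ereal (Hr (\<gamma> \<inter> enlarge \<Delta> R) - Hr (\<gamma> \<inter> (enlarge \<Delta> R - \<Delta>)))"
  using bounded_enlarge[OF assms(2), of R] unfolding cond_energy_def
  by (intro ediff_H locally_finite_Int_bounded assms) (auto intro: bounded_subset)

text \<open>The energy subtracted in \<open>cond_energy\<close> involves only points outside
  \<Delta> and is not changed by \<open>x\<close>. The other energy grows by \<open>h\<close>, by
  \<open>h_window\<close> for the window \<open>enlarge \<Delta> R\<close>, and the additional point
  contributes one more factor \<open>z\<close>.\<close>

lemma gibbs_dens_insert: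
  assumes lf: "locally_finite \<gamma>" "locally_finite \<gamma>'" and D: "bounded \<Delta>" and x: "x \<in> \<Delta>" "x \<notin> \<gamma>'" and z: "z \<ge> 0"
  shows "gibbs_dens H R z \<beta> \<Delta> \<gamma> (insert x \<gamma>')
    = ennreal (z * exp (- \<beta> * h x ((\<gamma>' \<inter> \<Delta>) \<union> (\<gamma> - \<Delta>)))) * gibbs_dens H R z \<beta> \<Delta> \<gamma> \<gamma>'"
proof -
  let ?g = "(\<gamma>' \<inter> \<Delta>) \<union> (\<gamma> - \<Delta>)" and ?E = "enlarge \<Delta> R"
  have lfg: "locally_finite ?g"
    using lf by (auto intro!: locally_finite_Un intro: locally_finite_subset)
  have xE: "x \<in> ?E" "cball x R \<subseteq> ?E" using x R_pos by (auto simp: enlarge_def intro!: bexI[of _ x])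
  have xg: "x \<notin> ?g" using x by auto
  have ins: "(insert x \<gamma>' \<inter> \<Delta>) \<union> (\<gamma> - \<Delta>) = insert x ?g" using x by auto
  have "insert x ?g \<inter> ?E = insert x (?g \<inter> ?E)" "insert x ?g \<inter> (?E - \<Delta>) = ?g \<inter> (?E - \<Delta>)"
    using x xE by auto
  then have ce: "cond_energy H R \<Delta> (insert x ?g) 
      = ereal (h x ?g + (Hr (?g \<inter> ?E) - Hr (?g \<inter> (?E - \<Delta>))))"
    using h_window[OF lfg xg bounded_enlarge[OF D] xE(2)]
    by (simp add: cond_energy_eq[OF locally_finite_insert[OF lfg] D])
  have "insert x \<gamma>' \<inter> \<Delta> = insert x (\<gamma>' \<inter> \<Delta>)" using x by auto
  then have "card (insert x \<gamma>' \<inter> \<Delta>) = Suc (card (\<gamma>' \<inter> \<Delta>))"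
    using x locally_finite_Int_bounded[OF lf(2) D] by simp
  moreover have "boltz \<beta> (ereal (a + b)) = ennreal (exp (- \<beta> * a)) * boltz \<beta> (ereal b)" for a b
    by (simp add: boltz_def ennreal_mult'[symmetric] ring_distribs exp_add[symmetric])
  ultimately show ?thesis unfolding gibbs_dens_def ins ce cond_energy_eq[OF lfg D]
    using z by (simp add: ennreal_mult mult_ac)
qed

lemma measurable_H:
  assumes [measurable]: "T \<in> N \<rightarrow>\<^sub>M config_M" and "\<And>w. w \<in> space N \<Longrightarrow> finite (T w)"
  shows "(\<lambda>w. H (T w)) \<in> borel_measurable N"
proof -
  have "T \<in> N \<rightarrow>\<^sub>M restrict_space config_M {\<gamma>. finite \<gamma>}"
    using assms by (intro measurable_restrict_space2) auto
  moreover have "H \<in> borel_measurable (restrict_space config_M {\<gamma>. finite \<gamma>})"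
    using energy by (simp add: energy_function_def)
  ultimately show ?thesis by (rule measurable_compose)
qed

lemma measurable_ediff:
  "a \<in> borel_measurable N \<Longrightarrow> b \<in> borel_measurable N \<Longrightarrow> (\<lambda>w. ediff (a w) (b w)) \<in> borel_measurable N"
  unfolding ediff_def
  by (intro measurable_If borel_measurable_ereal_diff) (auto intro!: sets.sets_Collect_conj simp: pred_def[symmetric])

lemma measurable_h[measurable (raw)]:
  assumes T[measurable]: "T \<in> N \<rightarrow>\<^sub>M config_M" and u[measurable]: "u \<in> N \<rightarrow>\<^sub>M borel"
  shows "(\<lambda>w. h (u w) (T w)) \<in> borel_measurable N"
proof -
  have fin: "finite (T w \<inter> cball (u w) R)" if "w \<in> space N" for w
    using measurable_space[OF T that] by (auto simp: space_config_M intro: locally_finite_Int_bounded)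
  show ?thesis unfolding h_def loc_energy_def
    by (intro borel_measurable_real_of_ereal measurable_ediff measurable_H) (use fin in auto)
qed

lemma measurable_gibbs_dens:
  fixes \<Delta> :: "'a set" and N :: "'w measure"
  assumes D: "\<Delta> = cball 0 k" "k > 0"
    and S[measurable]: "S \<in> N \<rightarrow>\<^sub>M config_M" and T[measurable]: "T \<in> N \<rightarrow>\<^sub>M config_M"
  shows "(\<lambda>w. gibbs_dens H R z \<beta> \<Delta> (T w) (S w)) \<in> borel_measurable N"
proof -
  let ?E = "enlarge \<Delta> R" and ?g = "\<lambda>w. (S w \<inter> \<Delta>) \<union> (T w - \<Delta>)"
  have [measurable]: "\<Delta> \<in> sets borel" and bD: "bounded \<Delta>" by (auto simp: D)
  have [measurable]: "?E \<in> sets borel" using R_pos D by (simp add: enlarge_cball)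
  have bE: "bounded ?E" by (rule bounded_enlarge[OF bD])
  have g[measurable]: "?g \<in> N \<rightarrow>\<^sub>M config_M" by measurable
  have fin: "finite (?g w \<inter> ?E)" if "w \<in> space N" for w
    using measurable_space[OF g that] bE by (intro locally_finite_Int_bounded) (auto simp: space_config_M)
  have "(\<lambda>w. cond_energy H R \<Delta> (?g w)) \<in> borel_measurable N"
    unfolding cond_energy_def
    by (intro measurable_ediff measurable_H measurable_Int_config g) (auto intro: finite_subset[OF _ fin])
  then have [measurable]: "(\<lambda>w. boltz \<beta> (cond_energy H R \<Delta> (?g w))) \<in> borel_measurable N"
    unfolding boltz_def by measurable
  have "(\<lambda>w. card (S w \<inter> \<Delta>)) \<in> N \<rightarrow>\<^sub>M count_space UNIV"
    by (rule measurable_compose[OF S measurable_card_Int]) (use bD in auto)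
  then have [measurable]: "(\<lambda>w. ennreal (z ^ card (S w \<inter> \<Delta>))) \<in> borel_measurable N"
    by (rule measurable_compose) simp
  show ?thesis unfolding gibbs_dens_def by measurable
qed

end

section \<open>The DLR equations for functions and the Georgii-Nguyen-Zessin equation\<close>

locale gibbs = finite_range_energy H R
  for H :: "'a::euclidean_space set \<Rightarrow> ereal" and R +
  fixes z \<beta> :: real and P :: "'a set measure"
  assumes z_pos: "z > 0" and gibbs: "gibbs_pp H R z \<beta> P"
begin

lemma sets_P[measurable_cong]: "sets P = sets config_M"
  using gibbs by (simp add: gibbs_pp_def)

lemma space_P: "space P = {\<gamma>. locally_finite \<gamma>}"
  using sets_eq_imp_space_eq[OF sets_P] by (simp add: space_config_M)

lemma measurable_P: "borel_measurable P = borel_measurable config_M"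
  by (rule measurable_cong_sets[OF sets_P refl])

lemma AE_P_locally_finite: "AE \<gamma> in P. locally_finite \<gamma>"
  by (rule AE_I2) (simp add: space_P)

lemma measurable_poisson_integral:
  assumes D: "\<Delta> = cball 0 k" "k > 0" 
    and F: "(\<lambda>p. F (fst p) (snd p)) \<in> borel_measurable (config_M \<Otimes>\<^sub>M config_M)"
  shows "(\<lambda>\<gamma>. \<integral>\<^sup>+\<gamma>'. F \<gamma> \<gamma>' * gibbs_dens H R z \<beta> \<Delta> \<gamma> \<gamma>' \<partial>poisson_pp \<Delta>) \<in> borel_measurable config_M"
proof -
  have [measurable]: "\<Delta> \<in> sets borel" and bD: "bounded \<Delta>" by (auto simp: D)
  note [measurable_cong] = sets_poisson_pp[OF this]
  interpret sigma_finite_measure "poisson_pp \<Delta>" by (rule sigma_finite_poisson_pp) (use bD in auto)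
  have "(\<lambda>p. gibbs_dens H R z \<beta> \<Delta> (fst p) (snd p)) \<in> borel_measurable (config_M \<Otimes>\<^sub>M config_M)"
    by (rule measurable_gibbs_dens[OF D]) auto
  with F have "(\<lambda>p. F (fst p) (snd p) * gibbs_dens H R z \<beta> \<Delta> (fst p) (snd p)) \<in> borel_measurable (config_M \<Otimes>\<^sub>M config_M)"
    by measurable
  then show ?thesis
    by (intro borel_measurable_nn_integral) (simp add: split_beta' cong: measurable_cong_sets)
qed

lemma measurable_partition_fun:
  assumes D: "\<Delta> = cball 0 k" "k > 0" 
  shows "partition_fun H R z \<beta> \<Delta> \<in> borel_measurable config_M"
  using measurable_poisson_integral[OF D, of "\<lambda>_ _. 1"] by (simp add: partition_fun_def[abs_def])

text \<open>Division in \<open>ennreal\<close> is multiplication by the inverse, so every step of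
  the monotone class argument commutes with the normalisation, whatever the value of the partition
  function.\<close>

lemma DLR:
  assumes D: "\<Delta> = cball 0 k" "k > 0" and "\<phi> \<in> borel_measurable config_M"
  shows "(\<integral>\<^sup>+\<gamma>. \<phi> \<gamma> \<partial>P)
    = (\<integral>\<^sup>+\<gamma>. (\<integral>\<^sup>+\<gamma>'. \<phi> ((\<gamma>' \<inter> \<Delta>) \<union> (\<gamma> - \<Delta>)) * gibbs_dens H R z \<beta> \<Delta> \<gamma> \<gamma>' \<partial>poisson_pp \<Delta>)
          / partition_fun H R z \<beta> \<Delta> \<gamma> \<partial>P)"
  using assms(3)
proof (induction rule: borel_measurable_induct)
  have Dm[measurable]: "\<Delta> \<in> sets borel" and bD: "bounded \<Delta>" by (auto simp: D)
  note [measurable_cong] = sets_poisson_pp[OF Dm bD]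
  have Zm[measurable]: "partition_fun H R z \<beta> \<Delta> \<in> borel_measurable config_M"
    by (rule measurable_partition_fun[OF D])
  let ?g = "\<lambda>\<gamma> \<gamma>'. (\<gamma>' \<inter> \<Delta>) \<union> (\<gamma> - \<Delta>)"
  have g: "?g \<gamma> \<gamma>' \<in> space config_M" if "\<gamma> \<in> space P" "\<gamma>' \<in> space (poisson_pp \<Delta>)" for \<gamma> \<gamma>'
    using that Dm bD by (auto simp: space_P space_poisson_pp space_config_M 
        intro!: locally_finite_Un intro: locally_finite_subset)
  have dens: "gibbs_dens H R z \<beta> \<Delta> \<gamma> \<in> borel_measurable config_M" if "\<gamma> \<in> space P" for \<gamma>
    by (rule measurable_gibbs_dens[OF D, of "\<lambda>x. x" _ "\<lambda>_. \<gamma>"]) (use that in \<open>auto simp: space_P space_config_M\<close>)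
  have gm: "(\<lambda>\<gamma>'. ?g \<gamma> \<gamma>') \<in> config_M \<rightarrow>\<^sub>M config_M" if "\<gamma> \<in> space P" for \<gamma>
    by (intro measurable_glue_config) (use that in \<open>auto simp: space_P space_config_M\<close>)
  have gpm: "(\<lambda>p. ?g (fst p) (snd p)) \<in> config_M \<Otimes>\<^sub>M config_M \<rightarrow>\<^sub>M config_M" by measurable
  {
    case (cong f g')
    have "(\<integral>\<^sup>+\<gamma>. (\<integral>\<^sup>+\<gamma>'. f (?g \<gamma> \<gamma>') * gibbs_dens H R z \<beta> \<Delta> \<gamma> \<gamma>' \<partial>poisson_pp \<Delta>) / partition_fun H R z \<beta> \<Delta> \<gamma> \<partial>P)
       = (\<integral>\<^sup>+\<gamma>. (\<integral>\<^sup>+\<gamma>'. g' (?g \<gamma> \<gamma>') * gibbs_dens H R z \<beta> \<Delta> \<gamma> \<gamma>' \<partial>poisson_pp \<Delta>) / partition_fun H R z \<beta> \<Delta> \<gamma> \<partial>P)"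
      using cong(3) g by (intro nn_integral_cong arg_cong2[where f="(/)"] refl) auto
    moreover have "(\<integral>\<^sup>+\<gamma>. f \<gamma> \<partial>P) = (\<integral>\<^sup>+\<gamma>. g' \<gamma> \<partial>P)"
      using cong(3) by (intro nn_integral_cong) (auto simp: space_P space_config_M)
    ultimately show ?case using cong(4) by simp
  next
    case (set A)
    have "measure lborel \<Delta> > 0" using D by simp
    then have "emeasure lborel \<Delta> \<noteq> 0" by (auto simp: measure_def)
    then have "emeasure lborel \<Delta> > 0" by (simp add: zero_less_iff_neq_zero)
    then have "emeasure P A = (\<integral>\<^sup>+ \<gamma>. (\<integral>\<^sup>+ \<gamma>'. indicator A (?g \<gamma> \<gamma>') * gibbs_dens H R z \<beta> \<Delta> \<gamma> \<gamma>'
                        \<partial>poisson_pp \<Delta>) / partition_fun H R z \<beta> \<Delta> \<gamma> \<partial>P)"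
      using gibbs set Dm bD unfolding gibbs_pp_def by simp
    then show ?case using set by (simp add: sets_P)
  next
    case (mult u c)
    have "(\<integral>\<^sup>+\<gamma>. (\<integral>\<^sup>+\<gamma>'. c * u (?g \<gamma> \<gamma>') * gibbs_dens H R z \<beta> \<Delta> \<gamma> \<gamma>' \<partial>poisson_pp \<Delta>) / partition_fun H R z \<beta> \<Delta> \<gamma> \<partial>P)
      = (\<integral>\<^sup>+\<gamma>. c * ((\<integral>\<^sup>+\<gamma>'. u (?g \<gamma> \<gamma>') * gibbs_dens H R z \<beta> \<Delta> \<gamma> \<gamma>' \<partial>poisson_pp \<Delta>) / partition_fun H R z \<beta> \<Delta> \<gamma>) \<partial>P)"
    proof (intro nn_integral_cong)
      fix \<gamma> assume \<gamma>: "\<gamma> \<in> space P"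
      have "(\<integral>\<^sup>+\<gamma>'. c * u (?g \<gamma> \<gamma>') * gibbs_dens H R z \<beta> \<Delta> \<gamma> \<gamma>' \<partial>poisson_pp \<Delta>)
        = c * (\<integral>\<^sup>+\<gamma>'. u (?g \<gamma> \<gamma>') * gibbs_dens H R z \<beta> \<Delta> \<gamma> \<gamma>' \<partial>poisson_pp \<Delta>)"
        unfolding mult.assoc
        using measurable_compose[OF gm[OF \<gamma>] mult(2)] dens[OF \<gamma>] by (intro nn_integral_cmult) auto
      then show "(\<integral>\<^sup>+\<gamma>'. c * u (?g \<gamma> \<gamma>') * gibbs_dens H R z \<beta> \<Delta> \<gamma> \<gamma>' \<partial>poisson_pp \<Delta>) / partition_fun H R z \<beta> \<Delta> \<gamma>
        = c * ((\<integral>\<^sup>+\<gamma>'. u (?g \<gamma> \<gamma>') * gibbs_dens H R z \<beta> \<Delta> \<gamma> \<gamma>' \<partial>poisson_pp \<Delta>) / partition_fun H R z \<beta> \<Delta> \<gamma>)"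
        by (simp add: divide_ennreal_def mult.assoc)
    qed
    also have "\<dots> = c * (\<integral>\<^sup>+\<gamma>. u \<gamma> \<partial>P)"
      unfolding mult.IH
      by (intro nn_integral_cmult borel_measurable_divide_ennreal measurable_poisson_integral[OF D, unfolded measurable_P[symmetric]]
           Zm[unfolded measurable_P[symmetric]] measurable_compose[OF gpm mult(2)])
    finally show ?case using mult by (simp add: nn_integral_cmult measurable_P)
  next
    case (add u v)
    have "(\<integral>\<^sup>+\<gamma>. (\<integral>\<^sup>+\<gamma>'. (v (?g \<gamma> \<gamma>') + u (?g \<gamma> \<gamma>')) * gibbs_dens H R z \<beta> \<Delta> \<gamma> \<gamma>' \<partial>poisson_pp \<Delta>) / partition_fun H R z \<beta> \<Delta> \<gamma> \<partial>P)
      = (\<integral>\<^sup>+\<gamma>. (\<integral>\<^sup>+\<gamma>'. v (?g \<gamma> \<gamma>') * gibbs_dens H R z \<beta> \<Delta> \<gamma> \<gamma>' \<partial>poisson_pp \<Delta>) / partition_fun H R z \<beta> \<Delta> \<gamma>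
         + (\<integral>\<^sup>+\<gamma>'. u (?g \<gamma> \<gamma>') * gibbs_dens H R z \<beta> \<Delta> \<gamma> \<gamma>' \<partial>poisson_pp \<Delta>) / partition_fun H R z \<beta> \<Delta> \<gamma> \<partial>P)"
    proof (intro nn_integral_cong)
      fix \<gamma> assume \<gamma>: "\<gamma> \<in> space P"
      have "(\<integral>\<^sup>+\<gamma>'. (v (?g \<gamma> \<gamma>') + u (?g \<gamma> \<gamma>')) * gibbs_dens H R z \<beta> \<Delta> \<gamma> \<gamma>' \<partial>poisson_pp \<Delta>)
        = (\<integral>\<^sup>+\<gamma>'. v (?g \<gamma> \<gamma>') * gibbs_dens H R z \<beta> \<Delta> \<gamma> \<gamma>' \<partial>poisson_pp \<Delta>)
        + (\<integral>\<^sup>+\<gamma>'. u (?g \<gamma> \<gamma>') * gibbs_dens H R z \<beta> \<Delta> \<gamma> \<gamma>' \<partial>poisson_pp \<Delta>)"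
        unfolding distrib_right
        using measurable_compose[OF gm[OF \<gamma>] add(1)] measurable_compose[OF gm[OF \<gamma>] add(3)] dens[OF \<gamma>]
        by (intro nn_integral_add) auto
      then show "(\<integral>\<^sup>+\<gamma>'. (v (?g \<gamma> \<gamma>') + u (?g \<gamma> \<gamma>')) * gibbs_dens H R z \<beta> \<Delta> \<gamma> \<gamma>' \<partial>poisson_pp \<Delta>) / partition_fun H R z \<beta> \<Delta> \<gamma>
        = (\<integral>\<^sup>+\<gamma>'. v (?g \<gamma> \<gamma>') * gibbs_dens H R z \<beta> \<Delta> \<gamma> \<gamma>' \<partial>poisson_pp \<Delta>) / partition_fun H R z \<beta> \<Delta> \<gamma>
         + (\<integral>\<^sup>+\<gamma>'. u (?g \<gamma> \<gamma>') * gibbs_dens H R z \<beta> \<Delta> \<gamma> \<gamma>' \<partial>poisson_pp \<Delta>) / partition_fun H R z \<beta> \<Delta> \<gamma>"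
        by (simp add: divide_ennreal_def distrib_right)
    qed
    also have "\<dots> = (\<integral>\<^sup>+\<gamma>. v \<gamma> \<partial>P) + (\<integral>\<^sup>+\<gamma>. u \<gamma> \<partial>P)"
      unfolding add.IH
      by (intro nn_integral_add borel_measurable_divide_ennreal measurable_poisson_integral[OF D, unfolded measurable_P[symmetric]]
           Zm[unfolded measurable_P[symmetric]] measurable_compose[OF gpm add(1)] measurable_compose[OF gpm add(3)])
    finally show ?case using add by (simp add: nn_integral_add measurable_P)
  next
    case (seq U)
    have inc: "incseq U" by (rule seq(3))
    have "(\<integral>\<^sup>+\<gamma>. (SUP i. U i) \<gamma> \<partial>P) = (SUP i. \<integral>\<^sup>+\<gamma>. U i \<gamma> \<partial>P)"
      unfolding SUP_apply using inc seq(1) by (intro nn_integral_monotone_convergence_SUP) (auto simp: measurable_P)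
    also have "\<dots> = (SUP i. \<integral>\<^sup>+\<gamma>. (\<integral>\<^sup>+\<gamma>'. U i (?g \<gamma> \<gamma>') * gibbs_dens H R z \<beta> \<Delta> \<gamma> \<gamma>' \<partial>poisson_pp \<Delta>) / partition_fun H R z \<beta> \<Delta> \<gamma> \<partial>P)"
      using seq.IH by simp
    also have "\<dots> = (\<integral>\<^sup>+\<gamma>. (SUP i. (\<integral>\<^sup>+\<gamma>'. U i (?g \<gamma> \<gamma>') * gibbs_dens H R z \<beta> \<Delta> \<gamma> \<gamma>' \<partial>poisson_pp \<Delta>) / partition_fun H R z \<beta> \<Delta> \<gamma>) \<partial>P)"
      using inc
      by (intro nn_integral_monotone_convergence_SUP[symmetric] borel_measurable_divide_ennreal measurable_poisson_integral[OF D, unfolded measurable_P[symmetric]]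
           Zm[unfolded measurable_P[symmetric]] measurable_compose[OF gpm seq(1)])
        (auto simp: incseq_def le_fun_def divide_ennreal_def intro!: mult_right_mono nn_integral_mono)
    also have "\<dots> = (\<integral>\<^sup>+\<gamma>. (\<integral>\<^sup>+\<gamma>'. (SUP i. U i) (?g \<gamma> \<gamma>') * gibbs_dens H R z \<beta> \<Delta> \<gamma> \<gamma>' \<partial>poisson_pp \<Delta>) / partition_fun H R z \<beta> \<Delta> \<gamma> \<partial>P)"
    proof (intro nn_integral_cong)
      fix \<gamma> assume \<gamma>: "\<gamma> \<in> space P"
      have "(\<integral>\<^sup>+\<gamma>'. (SUP i. U i) (?g \<gamma> \<gamma>') * gibbs_dens H R z \<beta> \<Delta> \<gamma> \<gamma>' \<partial>poisson_pp \<Delta>)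
        = (\<integral>\<^sup>+\<gamma>'. (SUP i. U i (?g \<gamma> \<gamma>') * gibbs_dens H R z \<beta> \<Delta> \<gamma> \<gamma>') \<partial>poisson_pp \<Delta>)"
        by (intro nn_integral_cong) (simp add: SUP_apply image_comp SUP_mult_right_ennreal)
      also have "\<dots> = (SUP i. \<integral>\<^sup>+\<gamma>'. U i (?g \<gamma> \<gamma>') * gibbs_dens H R z \<beta> \<Delta> \<gamma> \<gamma>' \<partial>poisson_pp \<Delta>)"
        using inc measurable_compose[OF gm[OF \<gamma>] seq(1)] dens[OF \<gamma>]
        by (intro nn_integral_monotone_convergence_SUP) (auto simp: incseq_def le_fun_def intro!: mult_right_mono)
      finally show "(SUP i. (\<integral>\<^sup>+\<gamma>'. U i (?g \<gamma> \<gamma>') * gibbs_dens H R z \<beta> \<Delta> \<gamma> \<gamma>' \<partial>poisson_pp \<Delta>) / partition_fun H R z \<beta> \<Delta> \<gamma>)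
        = (\<integral>\<^sup>+\<gamma>'. (SUP i. U i) (?g \<gamma> \<gamma>') * gibbs_dens H R z \<beta> \<Delta> \<gamma> \<gamma>' \<partial>poisson_pp \<Delta>) / partition_fun H R z \<beta> \<Delta> \<gamma>"
        by (simp add: divide_ennreal_def SUP_mult_right_ennreal)
    qed
    finally show ?case .
  }
qed

text \<open>Inserting \<open>x\<close> multiplies the unnormalised density by \<open>z * exp (- \<beta> * h x \<gamma>)\<close>,
  so Mecke's formula for the Poisson process turns into the equation below.\<close>

lemma GNZ:
  assumes F[measurable]: "(\<lambda>p. F (fst p) (snd p)) \<in> borel_measurable (borel \<Otimes>\<^sub>M config_M)"
  shows "(\<integral>\<^sup>+\<gamma>. (\<integral>\<^sup>+x. F x (\<gamma> - {x}) \<partial>count_space \<gamma>) \<partial>P)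
     = (\<integral>\<^sup>+\<gamma>. (\<integral>\<^sup>+x. F x \<gamma> * ennreal (z * exp (- \<beta> * h x \<gamma>)) \<partial>lborel) \<partial>P)"
proof -
  \<comment> \<open>Localisation to a ball: the DLR equation resamples only the points inside
    \<Delta>, so only these may be counted. Increasing balls recover the full sum
    afterwards.\<close>
  have main: "(\<integral>\<^sup>+\<gamma>. (\<integral>\<^sup>+x. F x (\<gamma> - {x}) * indicator \<Delta> x \<partial>count_space \<gamma>) \<partial>P)
     = (\<integral>\<^sup>+\<gamma>. (\<integral>\<^sup>+x. F x \<gamma> * ennreal (z * exp (- \<beta> * h x \<gamma>)) * indicator \<Delta> x \<partial>lborel) \<partial>P)"
    if D: "\<Delta> = cball 0 k" "k > 0" for \<Delta> k
  proof -
    have Dm[measurable]: "\<Delta> \<in> sets borel" and bD: "bounded \<Delta>" by (auto simp: D)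
    let ?g = "\<lambda>\<gamma> \<gamma>'. (\<gamma>' \<inter> \<Delta>) \<union> (\<gamma> - \<Delta>)"
    let ?S = "\<lambda>\<gamma>. \<integral>\<^sup>+x. F x (\<gamma> - {x}) * indicator \<Delta> x \<partial>count_space \<gamma>"
    let ?I = "\<lambda>\<gamma>. \<integral>\<^sup>+x. F x \<gamma> * ennreal (z * exp (- \<beta> * h x \<gamma>)) * indicator \<Delta> x \<partial>lborel"
    have Sm: "?S \<in> borel_measurable config_M"
      by (rule measurable_nn_integral_remove) measurable
    have swap: "(\<lambda>q. (snd q, fst q)) \<in> config_M \<Otimes>\<^sub>M borel \<rightarrow>\<^sub>M borel \<Otimes>\<^sub>M (config_M :: 'a set measure)" by measurable
    have Im: "?I \<in> borel_measurable config_M"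
      using measurable_compose[OF swap F]
      by (intro lborel.borel_measurable_nn_integral) (simp add: split_beta')
    have "(\<integral>\<^sup>+\<gamma>'. ?S (?g \<gamma> \<gamma>') * gibbs_dens H R z \<beta> \<Delta> \<gamma> \<gamma>' \<partial>poisson_pp \<Delta>)
        = (\<integral>\<^sup>+\<gamma>'. ?I (?g \<gamma> \<gamma>') * gibbs_dens H R z \<beta> \<Delta> \<gamma> \<gamma>' \<partial>poisson_pp \<Delta>)"
      if \<gamma>: "\<gamma> \<in> space P" for \<gamma>
    proof -
      have lf: "locally_finite \<gamma>" using \<gamma> by (simp add: space_P)
      \<comment> \<open>The density is taken with \<open>x\<close> put back. Evaluated at
        \<open>\<gamma>' - {x}\<close> for a point \<open>x\<close> of \<gamma>', it is the density
        of \<gamma>' itself, as Mecke's formula requires.\<close>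
      let ?G = "\<lambda>x \<gamma>'. F x (?g \<gamma> \<gamma>') * gibbs_dens H R z \<beta> \<Delta> \<gamma> (insert x \<gamma>')"
      have "(\<lambda>p. (fst p, ?g \<gamma> (snd p))) \<in> borel \<Otimes>\<^sub>M config_M \<rightarrow>\<^sub>M borel \<Otimes>\<^sub>M config_M"
        using lf by (intro measurable_Pair measurable_glue_config measurable_const measurable_fst measurable_snd Dm)
           (auto simp: space_config_M)
      from measurable_compose[OF this F]
      have m1: "(\<lambda>p. F (fst p) (?g \<gamma> (snd p))) \<in> borel_measurable (borel \<Otimes>\<^sub>M config_M)" by simp
      have "(\<lambda>p. gibbs_dens H R z \<beta> \<Delta> \<gamma> (insert (fst p) (snd p))) \<in> borel_measurable (borel \<Otimes>\<^sub>M config_M)"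
        using lf by (intro measurable_gibbs_dens[OF D]) (auto simp: space_config_M)
      with m1 have Gm: "(\<lambda>p. ?G (fst p) (snd p)) \<in> borel_measurable (borel \<Otimes>\<^sub>M config_M)" by measurable
      have "(\<integral>\<^sup>+\<gamma>'. ?S (?g \<gamma> \<gamma>') * gibbs_dens H R z \<beta> \<Delta> \<gamma> \<gamma>' \<partial>poisson_pp \<Delta>)
          = (\<integral>\<^sup>+\<gamma>'. (\<integral>\<^sup>+x. ?G x (\<gamma>' - {x}) * indicator \<Delta> x \<partial>count_space \<gamma>') \<partial>poisson_pp \<Delta>)"
      proof (intro nn_integral_cong)
        fix \<gamma>'
        have "?S (?g \<gamma> \<gamma>') * gibbs_dens H R z \<beta> \<Delta> \<gamma> \<gamma>'
          = (\<integral>\<^sup>+x. F x (?g \<gamma> \<gamma>' - {x}) * indicator \<Delta> x * gibbs_dens H R z \<beta> \<Delta> \<gamma> \<gamma>' \<partial>count_space (?g \<gamma> \<gamma>'))"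
          by (simp add: nn_integral_multc)
        also have "\<dots> = (\<integral>\<^sup>+x. F x (?g \<gamma> \<gamma>' - {x}) * indicator \<Delta> x * gibbs_dens H R z \<beta> \<Delta> \<gamma> \<gamma>' * indicator (?g \<gamma> \<gamma>') x \<partial>count_space UNIV)"
          by (rule nn_integral_count_space_indicator) simp
        also have "\<dots> = (\<integral>\<^sup>+x. ?G x (\<gamma>' - {x}) * indicator \<Delta> x * indicator \<gamma>' x \<partial>count_space UNIV)"
        proof (intro nn_integral_cong)
          fix x
          show "F x (?g \<gamma> \<gamma>' - {x}) * indicator \<Delta> x * gibbs_dens H R z \<beta> \<Delta> \<gamma> \<gamma>' * indicator (?g \<gamma> \<gamma>') x
            = ?G x (\<gamma>' - {x}) * indicator \<Delta> x * indicator \<gamma>' x"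
          proof (cases "x \<in> \<Delta> \<and> x \<in> \<gamma>'")
            case True
            then have "?g \<gamma> (\<gamma>' - {x}) = ?g \<gamma> \<gamma>' - {x}" "insert x (\<gamma>' - {x}) = \<gamma>'" by auto
            then show ?thesis using True by simp
          qed (auto split: split_indicator)
        qed
        also have "\<dots> = (\<integral>\<^sup>+x. ?G x (\<gamma>' - {x}) * indicator \<Delta> x \<partial>count_space \<gamma>')"
          by (rule nn_integral_count_space_indicator[symmetric]) simp
        finally show "?S (?g \<gamma> \<gamma>') * gibbs_dens H R z \<beta> \<Delta> \<gamma> \<gamma>'
          = (\<integral>\<^sup>+x. ?G x (\<gamma>' - {x}) * indicator \<Delta> x \<partial>count_space \<gamma>')" .
      qed
      also have "\<dots> = (\<integral>\<^sup>+\<gamma>'. (\<integral>\<^sup>+x. ?G x \<gamma>' * indicator \<Delta> x \<partial>lborel) \<partial>poisson_pp \<Delta>)"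
        by (rule poisson_pp_Mecke[OF Dm bD Gm])
      also have "\<dots> = (\<integral>\<^sup>+\<gamma>'. ?I (?g \<gamma> \<gamma>') * gibbs_dens H R z \<beta> \<Delta> \<gamma> \<gamma>' \<partial>poisson_pp \<Delta>)"
      proof (intro nn_integral_cong)
        fix \<gamma>' assume "\<gamma>' \<in> space (poisson_pp \<Delta>)"
        then have lf': "locally_finite \<gamma>'" using Dm bD by (simp add: space_poisson_pp space_config_M)
        have lfg: "locally_finite (?g \<gamma> \<gamma>')"
          using lf lf' by (auto intro!: locally_finite_Un intro: locally_finite_subset)
        have m2[measurable]: "(\<lambda>x. F x (?g \<gamma> \<gamma>')) \<in> borel_measurable borel"
          using measurable_compose[OF measurable_Pair2' F, of "?g \<gamma> \<gamma>'"] lfg by (simp add: space_config_M)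
        have m3[measurable]: "(\<lambda>x. h x (?g \<gamma> \<gamma>')) \<in> borel_measurable borel"
          using lfg by (intro measurable_h) (auto simp: space_config_M)
        \<comment> \<open>After Mecke's formula \<open>x\<close> is a Lebesgue point of \<Delta>; it
          is almost everywhere absent from \<gamma>', and only then does
          \<open>gibbs_dens_insert\<close> apply.\<close>
        have "finite (\<gamma>' \<inter> \<Delta>)" by (rule locally_finite_Int_bounded[OF lf' bD])
        then have "AE x in lborel. x \<notin> \<gamma>' \<inter> \<Delta>"
          by (intro AE_I'[of "\<gamma>' \<inter> \<Delta>"]) (auto simp: finite_imp_null_set_lborel)
        then have "(\<integral>\<^sup>+x. ?G x \<gamma>' * indicator \<Delta> x \<partial>lborel)
           = (\<integral>\<^sup>+x. F x (?g \<gamma> \<gamma>') * ennreal (z * exp (- \<beta> * h x (?g \<gamma> \<gamma>'))) * indicator \<Delta> x * gibbs_dens H R z \<beta> \<Delta> \<gamma> \<gamma>' \<partial>lborel)"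
          by (intro nn_integral_cong_AE, eventually_elim)
            (auto simp: gibbs_dens_insert[OF lf lf' bD] z_pos[THEN less_imp_le] mult_ac split: split_indicator)
        also have "\<dots> = ?I (?g \<gamma> \<gamma>') * gibbs_dens H R z \<beta> \<Delta> \<gamma> \<gamma>'"
          by (intro nn_integral_multc) measurable
        finally show "(\<integral>\<^sup>+x. ?G x \<gamma>' * indicator \<Delta> x \<partial>lborel) = ?I (?g \<gamma> \<gamma>') * gibbs_dens H R z \<beta> \<Delta> \<gamma> \<gamma>'" .
      qed
      finally show ?thesis .
    qed
    \<comment> \<open>The inner integrals already agree before the division by the partition
      function, so the two DLR representations coincide.\<close>
    then show ?thesis
      unfolding DLR[OF D Sm] DLR[OF D Im] by (intro nn_integral_cong) simp
  qed
  \<comment> \<open>The radius is \<open>Suc k\<close> because \<open>main\<close> is stated for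
    positive radii.\<close>
  let ?C = "\<lambda>k::nat. cball (0::'a) (real (Suc k))"
  have sup: "(SUP k::nat. c * indicator (?C k) x) = c" for c :: ennreal and x
  proof -
    obtain k :: nat where "norm x \<le> real k" using real_arch_simple by blast
    then have "c \<le> (SUP k::nat. c * indicator (?C k) x)"
      by (intro SUP_upper2[of k]) auto
    then show ?thesis
      by (intro antisym SUP_least) (auto split: split_indicator)
  qed
  have inc: "incseq (\<lambda>k x. f x * indicator (?C k) x :: ennreal)" for f
    by (auto simp: incseq_def le_fun_def split: split_indicator)
  have swap: "(\<lambda>q. (snd q, fst q)) \<in> config_M \<Otimes>\<^sub>M borel \<rightarrow>\<^sub>M borel \<Otimes>\<^sub>M (config_M :: 'a set measure)" by measurable
  have Fx: "(\<lambda>x. F x \<gamma>) \<in> borel_measurable borel" if "\<gamma> \<in> space P" for \<gamma>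
    using measurable_compose[OF measurable_Pair2' F, of \<gamma>] that by (simp add: space_P space_config_M)
  have hx: "(\<lambda>x. h x \<gamma>) \<in> borel_measurable borel" if "\<gamma> \<in> space P" for \<gamma>
    using that by (intro measurable_h) (auto simp: space_config_M space_P)
  have "(\<integral>\<^sup>+\<gamma>. (\<integral>\<^sup>+x. F x (\<gamma> - {x}) \<partial>count_space \<gamma>) \<partial>P)
    = (\<integral>\<^sup>+\<gamma>. (SUP k. \<integral>\<^sup>+x. F x (\<gamma> - {x}) * indicator (?C k) x \<partial>count_space \<gamma>) \<partial>P)"
    by (subst nn_integral_monotone_convergence_SUP[symmetric, OF inc]) (simp, simp only: sup)
  also have "\<dots> = (SUP k. \<integral>\<^sup>+\<gamma>. (\<integral>\<^sup>+x. F x (\<gamma> - {x}) * indicator (?C k) x \<partial>count_space \<gamma>) \<partial>P)"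
  proof (rule nn_integral_monotone_convergence_SUP)
    show "incseq (\<lambda>k \<gamma>. \<integral>\<^sup>+x. F x (\<gamma> - {x}) * indicator (?C k) x \<partial>count_space \<gamma>)"
      by (auto simp: incseq_def le_fun_def intro!: nn_integral_mono mult_left_mono split: split_indicator)
    show "(\<lambda>\<gamma>. \<integral>\<^sup>+x. F x (\<gamma> - {x}) * indicator (?C k) x \<partial>count_space \<gamma>) \<in> borel_measurable P" for k
    proof -
      have [measurable]: "?C k \<in> sets borel" by simp
      show ?thesis unfolding measurable_P by (rule measurable_nn_integral_remove) measurable
    qed
  qed
  also have "\<dots> = (SUP k. \<integral>\<^sup>+\<gamma>. (\<integral>\<^sup>+x. F x \<gamma> * ennreal (z * exp (- \<beta> * h x \<gamma>)) * indicator (?C k) x \<partial>lborel) \<partial>P)"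
    by (intro SUP_cong refl main) auto
  also have "\<dots> = (\<integral>\<^sup>+\<gamma>. (SUP k. \<integral>\<^sup>+x. F x \<gamma> * ennreal (z * exp (- \<beta> * h x \<gamma>)) * indicator (?C k) x \<partial>lborel) \<partial>P)"
  proof (rule nn_integral_monotone_convergence_SUP[symmetric])
    show "incseq (\<lambda>k \<gamma>. \<integral>\<^sup>+x. F x \<gamma> * ennreal (z * exp (- \<beta> * h x \<gamma>)) * indicator (?C k) x \<partial>lborel)"
      by (auto simp: incseq_def le_fun_def intro!: nn_integral_mono mult_left_mono split: split_indicator)
    show "(\<lambda>\<gamma>. \<integral>\<^sup>+x. F x \<gamma> * ennreal (z * exp (- \<beta> * h x \<gamma>)) * indicator (?C k) x \<partial>lborel) \<in> borel_measurable P" for k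
    proof -
      have [measurable]: "?C k \<in> sets borel" by simp
      have [measurable]: "(\<lambda>q. F (snd q) (fst q)) \<in> borel_measurable (config_M \<Otimes>\<^sub>M borel)"
        using measurable_compose[OF swap F] by simp
      show ?thesis unfolding measurable_P
        by (intro lborel.borel_measurable_nn_integral) (unfold split_beta', measurable)
    qed
  qed
  also have "\<dots> = (\<integral>\<^sup>+\<gamma>. (\<integral>\<^sup>+x. F x \<gamma> * ennreal (z * exp (- \<beta> * h x \<gamma>)) \<partial>lborel) \<partial>P)"
  proof (intro nn_integral_cong)
    fix \<gamma> assume \<gamma>: "\<gamma> \<in> space P"
    show "(SUP k. \<integral>\<^sup>+x. F x \<gamma> * ennreal (z * exp (- \<beta> * h x \<gamma>)) * indicator (?C k) x \<partial>lborel)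
       = (\<integral>\<^sup>+x. F x \<gamma> * ennreal (z * exp (- \<beta> * h x \<gamma>)) \<partial>lborel)"
    proof -
      note [measurable] = Fx[OF \<gamma>] hx[OF \<gamma>]
      have "(\<lambda>x. F x \<gamma> * ennreal (z * exp (- \<beta> * h x \<gamma>)) * indicator (?C k) x) \<in> borel_measurable lborel" for k
      proof -
        have [measurable]: "?C k \<in> sets borel" by simp
        show ?thesis by measurable
      qed
      then show ?thesis
        by (subst nn_integral_monotone_convergence_SUP[symmetric, OF inc]) (assumption, simp only: sup)
    qed
  qed
  finally show ?thesis .
qed

end

section \<open>Absence of jumps\<close>


lemma nn_integral_lborel_translate:
  fixes F :: "'a::euclidean_space \<Rightarrow> ennreal"
  assumes [measurable]: "F \<in> borel_measurable borel"
  shows "(\<integral>\<^sup>+x. F (x + c) \<partial>lborel) = (\<integral>\<^sup>+x. F x \<partial>lborel)"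
proof -
  have "(\<integral>\<^sup>+x. F x \<partial>lborel) = (\<integral>\<^sup>+x. F x \<partial>distr lborel borel ((+) c))"
    by (simp add: lborel_distr_plus)
  also have "\<dots> = (\<integral>\<^sup>+x. F (c + x) \<partial>lborel)" by (subst nn_integral_distr) auto
  finally show ?thesis by (simp add: add.commute)
qed

lemma integral_lborel_translate:
  fixes F :: "'a::euclidean_space \<Rightarrow> real"
  assumes [measurable]: "F \<in> borel_measurable borel"
  shows "(\<integral>x. F (x + c) \<partial>lborel) = (\<integral>x. F x \<partial>lborel)"
proof -
  have "(\<integral>x. F x \<partial>lborel) = (\<integral>x. F x \<partial>distr lborel borel ((+) c))"
    by (simp add: lborel_distr_plus)
  also have "\<dots> = (\<integral>x. F (c + x) \<partial>lborel)" by (subst integral_distr) auto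
  finally show ?thesis by (simp add: add.commute)
qed

lemma integrable_lborel_translate:
  fixes F :: "'a::euclidean_space \<Rightarrow> real"
  assumes "integrable lborel F"
  shows "integrable lborel (\<lambda>x. F (x + c))"
proof -
  have "integrable (distr lborel borel ((+) c)) F" using assms by (simp add: lborel_distr_plus)
  then have "integrable lborel (\<lambda>x. F (c + x))" by (subst (asm) integrable_distr_eq) (use assms in auto)
  then show ?thesis by (simp add: add.commute)
qed

text \<open>By Tonelli the integral over \<open>x\<close> comes first; it does not depend on
  \<open>t\<close> by translation invariance, and the interval of \<open>t\<close> has length
  one.\<close>

lemma nn_integral_line_average:
  fixes F :: "'a::euclidean_space \<Rightarrow> ennreal"
  assumes [measurable]: "F \<in> borel_measurable borel"
  shows "(\<integral>\<^sup>+x. (\<integral>\<^sup>+t. F (x + t *\<^sub>R v) * indicator {0..1} t \<partial>lborel) \<partial>lborel) = (\<integral>\<^sup>+x. F x \<partial>lborel)"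
proof -
  have "(\<integral>\<^sup>+x. (\<integral>\<^sup>+t. F (x + t *\<^sub>R v) * indicator {0..1::real} t \<partial>lborel) \<partial>lborel)
    = (\<integral>\<^sup>+t. (\<integral>\<^sup>+x. F (x + t *\<^sub>R v) * indicator {0..1::real} t \<partial>lborel) \<partial>lborel)"
    by (rule lborel_pair.Fubini'[symmetric]) simp
  also have "\<dots> = (\<integral>\<^sup>+t. (\<integral>\<^sup>+x. F x \<partial>lborel) * indicator {0..1::real} t \<partial>lborel)"
    by (intro nn_integral_cong) (simp add: nn_integral_multc nn_integral_lborel_translate)
  also have "\<dots> = (\<integral>\<^sup>+x. F x \<partial>lborel)"
    by (subst nn_integral_cmult) auto
  finally show ?thesis .
qed

lemma null_if_countable_on_lines:
  fixes N :: "'a::euclidean_space set"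
  assumes [measurable]: "N \<in> sets borel" and c: "\<And>x. countable {t. x + t *\<^sub>R v \<in> N}"
  shows "emeasure lborel N = 0"
proof -
  have "emeasure lborel N = (\<integral>\<^sup>+x. (\<integral>\<^sup>+t. indicator N (x + t *\<^sub>R v) * indicator {0..1} t \<partial>lborel) \<partial>lborel)"
    by (subst nn_integral_line_average) auto
  moreover have "(\<integral>\<^sup>+t. indicator N (x + t *\<^sub>R v) * indicator {0..1} t \<partial>lborel) = 0" for x
  proof -
    have "AE t in lborel. t \<notin> {t. x + t *\<^sub>R v \<in> N}"
      using c[of x] by (intro AE_I'[of "{t. x + t *\<^sub>R v \<in> N}"]) (auto simp: countable_imp_null_set_lborel)
    then have "(\<integral>\<^sup>+t. indicator N (x + t *\<^sub>R v) * indicator {0..1::real} t \<partial>lborel) = nn_integral lborel (\<lambda>_::real. 0)"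
      by (intro nn_integral_cong_AE) (auto elim!: eventually_mono)
    then show ?thesis by simp
  qed
  ultimately show ?thesis by simp
qed

text \<open>The one-sided limits of \<open>g\<close> at a point of \<open>T\<close> exist because the derivative is integrable;
  if they agree, \<open>g\<close> extends continuously over \<open>T\<close>.\<close>

lemma FTC_removable:
  fixes g G :: "real \<Rightarrow> real"
  assumes T: "finite T" "0 \<notin> T" "1 \<notin> T"
    and der: "\<And>t. t \<in> {0..1} - T \<Longrightarrow> (g has_real_derivative G t) (at t)"
    and int: "G integrable_on {0..1}"
    and lim: "\<And>t L L'. t \<in> T \<Longrightarrow> t \<in> {0<..<1} \<Longrightarrow> (g \<longlongrightarrow> L) (at_left t) \<Longrightarrow> (g \<longlongrightarrow> L') (at_right t) \<Longrightarrow> L = L'"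
  shows "(G has_integral g 1 - g 0) {0..1}"
proof -
  have inc: "integral {a..b} G = g b - g a" if "0 \<le> a" "a \<le> b" "b \<le> 1" "{a..b} \<inter> T = {}" for a b
  proof -
    have "(G has_integral g b - g a) {a..b}"
    proof (intro fundamental_theorem_of_calculus that(2))
      fix t assume "t \<in> {a..b}"
      with that have "(g has_real_derivative G t) (at t)" by (intro der) auto
      then show "(g has_vector_derivative G t) (at t within {a..b})"
        unfolding has_real_derivative_iff_has_vector_derivative by (rule has_vector_derivative_at_within)
    qed
    then show ?thesis by blast
  qed
  have isub: "G integrable_on {a..b}" if "0 \<le> a" "b \<le> 1" for a b
    using that by (intro integrable_subinterval_real[OF int]) auto
  have ex: "\<exists>L. (g \<longlongrightarrow> L) (at t)" if t: "t \<in> T" "t \<in> {0<..<1}" for t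
  proof -
    have "open (- (T - {t}) \<inter> {0<..<1})" using T by (intro open_Int open_Compl finite_imp_closed) auto
    then obtain e where e: "e > 0" "ball t e \<subseteq> - (T - {t}) \<inter> {0<..<1}"
      using t by (meson openE ComplI DiffD2 IntI singletonI)
    define d where "d = e / 2"
    have d: "d > 0" and dd: "{t - d..t + d} \<subseteq> - (T - {t}) \<inter> {0<..<1}"
    proof -
      have "{t - d..t + d} \<subseteq> ball t e" using e(1) by (auto simp: d_def dist_real_def)
      then show "d > 0" "{t - d..t + d} \<subseteq> - (T - {t}) \<inter> {0<..<1}" using e by (auto simp: d_def)
    qed
    have tl: "t - d < t" and tr: "t < t + d" using d by auto
    have d01: "0 \<le> t - d" "t + d \<le> 1"
      using subsetD[OF dd, of "t - d"] subsetD[OF dd, of "t + d"] d by auto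
    have L: "(g \<longlongrightarrow> g (t - d) + integral {t - d..t} G) (at_left t)"
    proof -
      have "continuous_on {t - d..t} (\<lambda>u. integral {t - d..u} G)"
        using d01 t d by (intro indefinite_integral_continuous_1 isub) auto
      then have "((\<lambda>u. integral {t - d..u} G) \<longlongrightarrow> integral {t - d..t} G) (at t within {t - d..t})"
        using d by (auto simp: continuous_on_def)
      then have "((\<lambda>u. integral {t - d..u} G) \<longlongrightarrow> integral {t - d..t} G) (at_left t)"
        using d by (simp add: at_within_Icc_at_left)
      then have "((\<lambda>u. g (t - d) + integral {t - d..u} G) \<longlongrightarrow> g (t - d) + integral {t - d..t} G) (at_left t)"
        by (intro tendsto_intros)
      moreover have "eventually (\<lambda>u. g (t - d) + integral {t - d..u} G = g u) (at_left t)"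
        using eventually_at_left_real[OF tl]
      proof eventually_elim
        case (elim u)
        have "x \<notin> T" if "x \<in> {t - d..u}" for x using that elim subsetD[OF dd, of x] d by auto
        then show ?case using elim d d01 by (subst inc) auto
      qed
      ultimately show ?thesis by (rule Lim_transform_eventually)
    qed
    have R: "(g \<longlongrightarrow> g (t + d) - integral {t..t + d} G) (at_right t)"
    proof -
      have "continuous_on {t..t + d} (\<lambda>u. integral {u..t + d} G)"
        using d01 t d by (intro indefinite_integral_continuous_1' isub) auto
      then have "((\<lambda>u. integral {u..t + d} G) \<longlongrightarrow> integral {t..t + d} G) (at t within {t..t + d})"
        using d by (auto simp: continuous_on_def)
      then have "((\<lambda>u. integral {u..t + d} G) \<longlongrightarrow> integral {t..t + d} G) (at_right t)"
        using d by (simp add: at_within_Icc_at_right)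
      then have "((\<lambda>u. g (t + d) - integral {u..t + d} G) \<longlongrightarrow> g (t + d) - integral {t..t + d} G) (at_right t)"
        by (intro tendsto_intros)
      moreover have "eventually (\<lambda>u. g (t + d) - integral {u..t + d} G = g u) (at_right t)"
        using eventually_at_right_real[OF tr]
      proof eventually_elim
        case (elim u)
        have "x \<notin> T" if "x \<in> {u..t + d}" for x using that elim subsetD[OF dd, of x] d by auto
        then show ?case using elim d d01 by (subst inc) auto
      qed
      ultimately show ?thesis by (rule Lim_transform_eventually)
    qed
    from lim[OF t L R] L R have "(g \<longlongrightarrow> g (t - d) + integral {t - d..t} G) (at t)"
      by (simp add: filterlim_split_at)
    then show ?thesis by blast
  qed
  define k where "k t = (if t \<in> T then Lim (at t) g else g t)" for t
  have ev: "eventually (\<lambda>u. u \<notin> T) (at t)" for t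
  proof -
    have "eventually (\<lambda>u. u \<in> - (T - {t})) (nhds t)"
      using T by (intro eventually_nhds_in_open open_Compl finite_imp_closed) auto
    then show ?thesis by (auto simp: eventually_at_filter elim!: eventually_mono)
  qed
  have klim: "isCont k t" if t: "t \<in> {0..1}" for t
  proof -
    have "(g \<longlongrightarrow> k t) (at t)"
    proof (cases "t \<in> T")
      case True
      then have "t \<in> {0<..<1}" using t T by (auto simp: less_le)
      from ex[OF True this] obtain L where "(g \<longlongrightarrow> L) (at t)" by blast
      moreover from this have "Lim (at t) g = L" by (intro tendsto_Lim) auto
      ultimately show ?thesis using True by (simp add: k_def)
    next
      case False
      then have "isCont g t" using der[of t] t by (auto intro: DERIV_isCont)
      then show ?thesis using False by (simp add: k_def isCont_def)
    qed
    then have "(k \<longlongrightarrow> k t) (at t)"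
      by (rule Lim_transform_eventually) (use ev[of t] in \<open>auto elim!: eventually_mono simp: k_def\<close>)
    then show ?thesis by (simp add: isCont_def)
  qed
  have "(G has_integral k 1 - k 0) {0..1}"
  proof (rule fundamental_theorem_of_calculus_interior_strong[OF T(1)])
    show "continuous_on {0..1} k" using klim by (simp add: continuous_at_imp_continuous_on)
    fix t assume t: "t \<in> {0<..<1} - T"
    have "eventually (\<lambda>u. u \<in> - T) (nhds t)"
      using T t by (intro eventually_nhds_in_open open_Compl finite_imp_closed) auto
    then have "eventually (\<lambda>u. k u = g u) (nhds t)" by (rule eventually_mono) (auto simp: k_def)
    moreover have "(g has_real_derivative G t) (at t)" using der t by auto
    ultimately have "(k has_real_derivative G t) (at t)" by (subst DERIV_cong_ev[OF refl _ refl])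
    then show "(k has_vector_derivative G t) (at t)"
      by (simp add: has_real_derivative_iff_has_vector_derivative)
  qed simp
  \<comment> \<open>The end points are not in \<open>T\<close>, so the modified function
    \<open>k\<close> still has the values of \<open>g\<close> there.\<close>
  then show ?thesis using T by (simp add: k_def)
qed

text \<open>If the bound failed at \<open>d\<close>, continuity would make it fail on an interval to
  the left of \<open>d\<close>, which contains a rational below \<open>c\<close>. With this,
  \<open>jump\<close> may be defined by rational displacements only.\<close>

lemma ge_on_rationals:
  fixes \<phi> :: "real \<Rightarrow> real"
  assumes cont: "isCont \<phi> d" and d: "0 < d" "d < c"
    and ge: "\<And>q::rat. 0 < q \<Longrightarrow> of_rat q < c \<Longrightarrow> \<phi> (of_rat q) \<ge> s"
  shows "\<phi> d \<ge> s"
proof (rule ccontr)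
  assume "\<not> \<phi> d \<ge> s"
  then have "eventually (\<lambda>u. \<phi> u < s) (at_left d)"
    using cont by (intro order_tendstoD) (auto simp: isCont_def filterlim_at_split)
  moreover have "eventually (\<lambda>u. 0 < u) (at_left d)"
    using eventually_at_left_real[OF d(1)] by (auto elim: eventually_mono)
  ultimately have "eventually (\<lambda>u. \<phi> u < s \<and> 0 < u) (at_left d)" by (rule eventually_conj)
  then obtain a where a: "a < d" "\<And>u. a < u \<Longrightarrow> u < d \<Longrightarrow> \<phi> u < s \<and> 0 < u"
    unfolding eventually_at_left_field by auto
  obtain q where "a < of_rat q" "of_rat q < d" using of_rat_dense[OF a(1)] by auto
  with a(2) have "\<phi> (of_rat q) < s" "0 < (of_rat q :: real)" by blast+
  then show False using ge[of q] d \<open>of_rat q < d\<close> by simp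
qed

section \<open>Jumps of the Boltzmann weight of a pair\<close>

locale smooth_gibbs = gibbs +
  assumes h_diff: "\<And>\<gamma> x. locally_finite \<gamma> \<Longrightarrow> x \<notin> \<gamma> \<Longrightarrow> (\<lambda>x. h x \<gamma>) differentiable at x"
begin

text \<open>Boltzmann factor for adding first \<open>y\<close> and then \<open>x\<close> to \<eta>.
  For \<open>\<eta> = \<gamma> - {y}\<close> with \<open>y \<in> \<gamma>\<close> it is
  \<open>exp (- \<beta> * h x \<gamma>)\<close> times a positive factor that does not involve
  \<open>x\<close>.\<close>

definition S :: "'a \<Rightarrow> 'a \<Rightarrow> 'a set \<Rightarrow> real" where
  "S x y \<eta> = exp (- \<beta> * (h x (insert y \<eta>) + h y \<eta>))"

lemma S_sym: "locally_finite \<eta> \<Longrightarrow> x \<noteq> y \<Longrightarrow> x \<notin> \<eta> \<Longrightarrow> y \<notin> \<eta> \<Longrightarrow> S x y \<eta> = S y x \<eta>"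
  by (simp add: S_def h_insert_swap)

lemma S_isCont:
  assumes "locally_finite \<eta>" "x \<notin> \<eta>" "x \<noteq> y"
  shows "isCont (\<lambda>x. S x y \<eta>) x"
proof -
  have "isCont (\<lambda>x. h x (insert y \<eta>)) x"
    using assms by (intro differentiable_imp_continuous_within h_diff locally_finite_insert) auto
  then show ?thesis unfolding S_def by (intro continuous_intros)
qed

text \<open>Up to distance \<open>1 / Suc n\<close> the value is at least \<open>s\<close> ahead of
  \<open>y\<close> in direction \<open>v\<close> and at most \<open>r\<close> behind it. Rational
  displacements make this a countable conjunction, hence a measurable condition on \<open>y\<close>
  and \<eta>.\<close>

definition jump :: "'a \<Rightarrow> real \<Rightarrow> real \<Rightarrow> nat \<Rightarrow> 'a \<Rightarrow> 'a set \<Rightarrow> bool" where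
  "jump v r s n y \<eta> \<longleftrightarrow> y \<notin> \<eta> \<and> (\<forall>q::rat. 0 < q \<and> of_rat q < 1 / real (Suc n) \<longrightarrow>
      s \<le> S (y + of_rat q *\<^sub>R v) y \<eta> \<and> S (y - of_rat q *\<^sub>R v) y \<eta> \<le> r)"

text \<open>Two jump points \<open>p\<close>, \<open>p'\<close> on a line at distance \<open>d < 1 / Suc n\<close> would give
  \<open>s \<le> S p' p \<eta> = S p p' \<eta> \<le> r\<close>.\<close>

lemma countable_jump:
  assumes lf: "locally_finite \<eta>" and v: "v \<noteq> 0" and rs: "r < s"
  shows "countable {t. jump v r s n (x + t *\<^sub>R v) \<eta>}"
proof (rule countableI'[where f="\<lambda>t. \<lfloor>t * real (Suc n)\<rfloor>"])
  have aux: False if "jump v r s n (x + t *\<^sub>R v) \<eta>" "jump v r s n (x + t' *\<^sub>R v) \<eta>" "t < t'"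
    "t' - t < 1 / real (Suc n)" for t t'
  proof -
    define p p' d where "p = x + t *\<^sub>R v" and "p' = x + t' *\<^sub>R v" and "d = t' - t"
    have d: "0 < d" "d < 1 / real (Suc n)" using that by (auto simp: d_def)
    have p': "p' = p + d *\<^sub>R v" and p: "p = p' - d *\<^sub>R v" by (auto simp: p_def p'_def d_def algebra_simps)
    have j: "jump v r s n p \<eta>" "jump v r s n p' \<eta>" using that by (auto simp: p_def p'_def)
    have ne: "p \<noteq> p'" "p \<notin> \<eta>" "p' \<notin> \<eta>" using d v j by (auto simp: p' jump_def)
    have "isCont (\<lambda>e. S (p + e *\<^sub>R v) p \<eta>) d"
    proof (rule isCont_o2[where g="\<lambda>x. S x p \<eta>"])
      show "isCont (\<lambda>x. S x p \<eta>) (p + d *\<^sub>R v)"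
        using S_isCont[OF lf ne(3), of p] ne(1) by (simp add: p')
    qed (intro continuous_intros)
    from ge_on_rationals[OF this d, of s] have 1: "s \<le> S p' p \<eta>"
      using j(1) p' by (auto simp: jump_def simp del: of_nat_Suc)
    have "isCont (\<lambda>e. - S (p' - e *\<^sub>R v) p' \<eta>) d"
    proof (rule continuous_minus, rule isCont_o2[where g="\<lambda>x. S x p' \<eta>"])
      show "isCont (\<lambda>x. S x p' \<eta>) (p' - d *\<^sub>R v)"
        using S_isCont[OF lf ne(2), of p'] ne(1) p by simp
    qed (intro continuous_intros)
    from ge_on_rationals[OF this d, of "-r"] have 2: "S p p' \<eta> \<le> r"
      using j(2) p by (auto simp: jump_def simp del: of_nat_Suc)
    show False using 1 2 rs S_sym[OF lf ne(1,2,3)] by simp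
  qed
  \<comment> \<open>Parameters with equal floor are less than \<open>1 / Suc n\<close> apart, so
    \<open>aux\<close> forces them to be equal: each interval of that length holds at most one
    jump.\<close>
  show "inj_on (\<lambda>t. \<lfloor>t * real (Suc n)\<rfloor>) {t. jump v r s n (x + t *\<^sub>R v) \<eta>}"
  proof (rule inj_onI)
    fix t t' assume tt: "t \<in> {t. jump v r s n (x + t *\<^sub>R v) \<eta>}" "t' \<in> {t. jump v r s n (x + t *\<^sub>R v) \<eta>}"
      and "\<lfloor>t * real (Suc n)\<rfloor> = \<lfloor>t' * real (Suc n)\<rfloor>"
    moreover have "\<bar>a - b\<bar> < 1" if "\<lfloor>a\<rfloor> = \<lfloor>b\<rfloor>" for a b :: real using that by linarith
    ultimately have "\<bar>t * real (Suc n) - t' * real (Suc n)\<bar> < 1" by blast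
    then have "\<bar>t - t'\<bar> * real (Suc n) < 1" by (simp add: abs_mult left_diff_distrib[symmetric] del: of_nat_Suc)
    then have "\<bar>t - t'\<bar> < 1 / real (Suc n)" by (simp add: pos_less_divide_eq)
    then show "t = t'" using aux[of t t'] aux[of t' t] tt by (cases t t' rule: linorder_cases) auto
  qed
qed

lemma measurable_S[measurable]:
  "(\<lambda>p. S (fst p + c) (fst p) (snd p)) \<in> borel_measurable (borel \<Otimes>\<^sub>M config_M)"
  unfolding S_def by measurable

text \<open>On the Lebesgue side of the equation, for the indicator of \<open>jump\<close>, the
  configuration is fixed while \<open>y\<close> is integrated. There
  \<open>null_if_countable_on_lines\<close> applies, so the expected number of points at which a
  jump occurs is 0.\<close>

lemma AE_no_jump:
  assumes v: "v \<noteq> 0" and rs: "r < s"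
  shows "AE \<gamma> in P. \<forall>y\<in>\<gamma>. \<not> jump v r s n y (\<gamma> - {y})"
proof -
  let ?F = "\<lambda>y \<eta>. if jump v r s n y \<eta> then 1 else 0 :: ennreal"
  have mem: "Measurable.pred (borel \<Otimes>\<^sub>M config_M) (\<lambda>p. fst p \<in> (snd p :: 'a set))"
    by (rule measurable_mem_config) auto
  have m2: "(\<lambda>p. S (fst p - c) (fst p) (snd p)) \<in> borel_measurable (borel \<Otimes>\<^sub>M config_M)" for c
    using measurable_S[of "- c"] by simp
  note [measurable] = mem m2
  have Fm: "(\<lambda>p. ?F (fst p) (snd p)) \<in> borel_measurable (borel \<Otimes>\<^sub>M config_M)"
    unfolding jump_def by measurable
  have z: "(\<integral>\<^sup>+y. ?F y \<gamma> * ennreal (z * exp (- \<beta> * h y \<gamma>)) \<partial>lborel) = 0" if \<gamma>: "\<gamma> \<in> space P" for \<gamma>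
  proof -
    have lf: "locally_finite \<gamma>" using \<gamma> by (simp add: space_P)
    have "(\<lambda>y. ?F y \<gamma>) \<in> borel_measurable borel"
      using measurable_compose[OF measurable_Pair2' Fm, of \<gamma>] lf by (simp add: space_config_M)
    then have "{y \<in> space borel. ?F y \<gamma> = 1} \<in> sets borel" by measurable
    then have N: "{y. jump v r s n y \<gamma>} \<in> sets borel" by (simp split: if_splits)
    have "emeasure lborel {y. jump v r s n y \<gamma>} = 0"
      by (rule null_if_countable_on_lines[OF N, of v]) (use countable_jump[OF lf v rs] in simp)
    then have "AE y in lborel. \<not> jump v r s n y \<gamma>"
      using N by (intro AE_I'[of "{y. jump v r s n y \<gamma>}"]) (auto simp: null_sets_def)
    then have "(\<integral>\<^sup>+y. ?F y \<gamma> * ennreal (z * exp (- \<beta> * h y \<gamma>)) \<partial>lborel) = nn_integral lborel (\<lambda>_::'a. 0)"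
      by (intro nn_integral_cong_AE) (auto elim!: eventually_mono)
    then show ?thesis by simp
  qed
  have "(\<integral>\<^sup>+\<gamma>. (\<integral>\<^sup>+y. ?F y (\<gamma> - {y}) \<partial>count_space \<gamma>) \<partial>P) = (\<integral>\<^sup>+\<gamma>. 0 \<partial>P)"
    unfolding GNZ[OF Fm] by (intro nn_integral_cong z)
  then have "AE \<gamma> in P. (\<integral>\<^sup>+y. ?F y (\<gamma> - {y}) \<partial>count_space \<gamma>) = 0"
    using measurable_nn_integral_remove[OF Fm] by (subst nn_integral_0_iff_AE[symmetric]) (auto simp: measurable_P)
  then show ?thesis
    by (rule eventually_mono) (auto simp: nn_integral_0_iff_AE AE_count_space split: if_splits)
qed

text \<open>Between two different limits there is room for rationals \<open>r < s\<close>, and a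
  small enough scale \<open>1 / Suc n\<close> witnesses the gap; countably many such triples leave a
  single null set. Since \<open>jump\<close> detects only a rise along its direction, a fall along
  \<open>v\<close> is treated as a rise along \<open>- v\<close>.\<close>

lemma AE_limits_agree:
  assumes v: "v \<noteq> 0"
  shows "AE \<gamma> in P. \<forall>y\<in>\<gamma>. \<forall>L L'. ((\<lambda>t. S (y + t *\<^sub>R v) y (\<gamma> - {y})) \<longlongrightarrow> L) (at_left 0) \<longrightarrow>
      ((\<lambda>t. S (y + t *\<^sub>R v) y (\<gamma> - {y})) \<longlongrightarrow> L') (at_right 0) \<longrightarrow> L = L'"
proof -
  have gap: "\<exists>n (r::rat) (s::rat). r < s \<and> jump w (of_rat r) (of_rat s) n y (\<gamma> - {y})"
    if L: "((\<lambda>t. S (y + t *\<^sub>R w) y (\<gamma> - {y})) \<longlongrightarrow> L) (at_left 0)" 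
      "((\<lambda>t. S (y + t *\<^sub>R w) y (\<gamma> - {y})) \<longlongrightarrow> L') (at_right 0)" "L < L'" for w y \<gamma> L L'
  proof -
    obtain r where r: "L < of_rat r" "of_rat r < L'" using of_rat_dense[OF L(3)] by auto
    obtain s where s: "of_rat r < (of_rat s :: real)" "of_rat s < L'" using of_rat_dense[OF r(2)] by auto
    obtain a where a: "a < 0" "\<And>t. a < t \<Longrightarrow> t < 0 \<Longrightarrow> S (y + t *\<^sub>R w) y (\<gamma> - {y}) < of_rat r"
      using order_tendstoD(2)[OF L(1) r(1)] unfolding eventually_at_left_field by auto
    obtain b where b: "b > 0" "\<And>t. 0 < t \<Longrightarrow> t < b \<Longrightarrow> S (y + t *\<^sub>R w) y (\<gamma> - {y}) > of_rat s"
      using order_tendstoD(1)[OF L(2) s(2)] unfolding eventually_at_right_field by auto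
    obtain n where n: "1 / real (Suc n) < min (- a) b" using nat_approx_posE[of "min (- a) b"] a b by auto
    have "jump w (of_rat r) (of_rat s) n y (\<gamma> - {y})"
      unfolding jump_def
    proof (intro conjI allI impI)
      fix q :: rat assume q: "0 < q \<and> of_rat q < 1 / real (Suc n)"
      show "of_rat s \<le> S (y + of_rat q *\<^sub>R w) y (\<gamma> - {y})" using b(2)[of "of_rat q"] q n by auto
      show "S (y - of_rat q *\<^sub>R w) y (\<gamma> - {y}) \<le> of_rat r" using a(2)[of "- of_rat q"] q n by auto
    qed simp
    moreover have "r < s" using s(1) by (simp add: of_rat_less)
    ultimately show ?thesis by blast
  qed
  have nj: "AE \<gamma> in P. \<forall>n (r::rat) (s::rat). r < s \<longrightarrow> (\<forall>y\<in>\<gamma>. \<not> jump w (of_rat r) (of_rat s) n y (\<gamma> - {y}))"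
    if "w \<noteq> 0" for w
    unfolding AE_all_countable using AE_no_jump[OF that] by (auto simp: of_rat_less)
  have "- v \<noteq> 0" using v by simp
  from nj[OF v] nj[OF this] show ?thesis
  proof eventually_elim
    case (elim \<gamma>)
    show ?case
    proof (intro ballI allI impI)
      fix y L L' assume y: "y \<in> \<gamma>" and L: "((\<lambda>t. S (y + t *\<^sub>R v) y (\<gamma> - {y})) \<longlongrightarrow> L) (at_left 0)"
        "((\<lambda>t. S (y + t *\<^sub>R v) y (\<gamma> - {y})) \<longlongrightarrow> L') (at_right 0)"
      show "L = L'"
      proof (rule ccontr)
        assume "L \<noteq> L'"
        then consider "L < L'" | "L' < L" by linarith
        then show False
        proof cases
          case 1
          from gap[OF L 1] elim(1) y show False by blast
        next
          case 2
          have "((\<lambda>t. S (y + t *\<^sub>R (- v)) y (\<gamma> - {y})) \<longlongrightarrow> L') (at_left 0)"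
            "((\<lambda>t. S (y + t *\<^sub>R (- v)) y (\<gamma> - {y})) \<longlongrightarrow> L) (at_right 0)"
            using L by (simp_all add: filterlim_at_left_to_right)
          from gap[OF this 2] elim(2) y show False by blast
        qed
      qed
    qed
  qed
qed

end

section \<open>Integration by parts\<close>


text \<open>In finite dimension unconditional summability implies absolute summability, coordinate
  by coordinate. Where there is no summability, both sides take the default value 0.\<close>

lemma infsum_eq_integral_count_space:
  fixes F :: "'b \<Rightarrow> 'a::euclidean_space"
  shows "infsum F A = (\<integral>x. F x \<partial>count_space A)"
proof (cases "integrable (count_space A) F")
  case True
  then show ?thesis
    using infsetsum_infsum[of F A] by (simp add: Infinite_Set_Sum.abs_summable_on_def infsetsum_def)
next
  case False
  have "\<not> F summable_on A"
  proof
    assume s: "F summable_on A"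
    have "(\<lambda>x. norm (F x \<bullet> b)) summable_on A" for b
      using summable_on_bounded_linear[OF bounded_linear_inner_left s, of b]
      by (rule iffD1[OF summable_on_iff_abs_summable_on_real])
    then have "integrable (count_space A) (\<lambda>x. F x \<bullet> b)" for b
      using abs_summable_equivalent[of "\<lambda>x. F x \<bullet> b" A] 
      by (simp add: Infinite_Set_Sum.abs_summable_on_def)
    then have "integrable (count_space A) (\<lambda>x. \<Sum>b\<in>Basis. (F x \<bullet> b) *\<^sub>R b)"
      by (intro Bochner_Integration.integrable_sum integrable_scaleR_left) auto
    then show False using False by (simp add: euclidean_representation)
  qed
  then show ?thesis using False by (simp add: infsum_not_exists not_integrable_integral_eq)
qed

text \<open>The sums over bounded windows are finite partial sums. The inequality carries the
  integrability assumptions, stated with infinite sums, over to integrals against counting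
  measure.\<close>

lemma nn_integral_count_space_le_infsum:
  fixes F :: "'b::euclidean_space \<Rightarrow> ennreal"
  assumes lf: "locally_finite \<gamma>"
  shows "(\<integral>\<^sup>+x. F x \<partial>count_space \<gamma>) \<le> (\<Sum>\<^sub>\<infinity>x\<in>\<gamma>. F x)"
proof (subst nn_integral_count_space_bounded, rule SUP_least)
  fix k :: nat
  have fin: "finite (\<gamma> \<inter> cball 0 (real k))" by (rule locally_finite_Int_bounded[OF lf]) simp
  have "(\<integral>\<^sup>+y. F y * indicator (cball 0 (real k)) y \<partial>count_space \<gamma>)
      = (\<integral>\<^sup>+y. F y \<partial>count_space (\<gamma> \<inter> cball 0 (real k)))"
  proof -
    have "(\<integral>\<^sup>+y. F y * indicator (cball 0 (real k)) y \<partial>count_space \<gamma>)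
       = (\<integral>\<^sup>+y. F y * indicator (cball 0 (real k)) y * indicator \<gamma> y \<partial>count_space UNIV)"
      by (rule nn_integral_count_space_indicator) simp
    also have "\<dots> = (\<integral>\<^sup>+y. F y * indicator (\<gamma> \<inter> cball 0 (real k)) y \<partial>count_space UNIV)"
      by (rule nn_integral_cong) (auto split: split_indicator)
    also have "\<dots> = (\<integral>\<^sup>+y. F y \<partial>count_space (\<gamma> \<inter> cball 0 (real k)))"
      by (rule nn_integral_count_space_indicator[symmetric]) simp
    finally show ?thesis .
  qed
  also have "\<dots> = sum F (\<gamma> \<inter> cball 0 (real k))" using fin by (rule nn_integral_count_space_finite)
  also have "\<dots> \<le> (SUP X\<in>{X. finite X \<and> X \<subseteq> \<gamma>}. sum F X)" using fin by (intro SUP_upper) auto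
  also have "\<dots> = (\<Sum>\<^sub>\<infinity>x\<in>\<gamma>. F x)" by (rule nonneg_infsum_complete[symmetric]) simp
  finally show "(\<integral>\<^sup>+y. F y * indicator (cball 0 (real k)) y \<partial>count_space \<gamma>) \<le> (\<Sum>\<^sub>\<infinity>x\<in>\<gamma>. F x)" .
qed

lemma locally_finite_countable:
  fixes \<gamma> :: "'a::euclidean_space set"
  assumes "locally_finite \<gamma>"
  shows "countable \<gamma>"
proof -
  have "countable (\<Union>k::nat. \<gamma> \<inter> cball 0 (real k))"
    by (rule countable_UN) (auto intro: countable_finite locally_finite_Int_bounded assms)
  also have "(\<Union>k::nat. \<gamma> \<inter> cball 0 (real k)) = \<gamma>" using real_arch_simple by fastforce
  finally show ?thesis .
qed

lemma enn2real_integral: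
  assumes [measurable]: "A \<in> borel_measurable M" and fin: "(\<integral>\<^sup>+w. A w \<partial>M) < \<infinity>"
  shows "integrable M (\<lambda>w. enn2real (A w))" "(\<integral>w. enn2real (A w) \<partial>M) = enn2real (\<integral>\<^sup>+w. A w \<partial>M)"
proof -
  have "AE w in M. A w \<noteq> \<infinity>" using fin by (intro nn_integral_PInf_AE) auto
  then have eq: "(\<integral>\<^sup>+w. ennreal (enn2real (A w)) \<partial>M) = (\<integral>\<^sup>+w. A w \<partial>M)"
    by (intro nn_integral_cong_AE) (auto elim!: eventually_mono simp: less_top)
  then show "integrable M (\<lambda>w. enn2real (A w))" using fin by (intro integrableI_nonneg) auto
  show "(\<integral>w. enn2real (A w) \<partial>M) = enn2real (\<integral>\<^sup>+w. A w \<partial>M)"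
    by (subst integral_eq_nn_integral) (auto simp: eq)
qed

text \<open>The inner measure may vary with \<open>w\<close>, as the counting measure on a
  configuration does, so a product-measure Fubini theorem does not fit. Positive and negative parts
  are treated separately, with measurability of their inner integrals assumed.\<close>

lemma integral_kernel:
  fixes F :: "'w \<Rightarrow> 'x \<Rightarrow> real"
  assumes Fm: "\<And>w. w \<in> space M \<Longrightarrow> F w \<in> borel_measurable (\<kappa> w)"
    and p[measurable]: "(\<lambda>w. \<integral>\<^sup>+x. ennreal (F w x) \<partial>\<kappa> w) \<in> borel_measurable M"
    and n[measurable]: "(\<lambda>w. \<integral>\<^sup>+x. ennreal (- F w x) \<partial>\<kappa> w) \<in> borel_measurable M"
    and fin: "(\<integral>\<^sup>+w. (\<integral>\<^sup>+x. ennreal \<bar>F w x\<bar> \<partial>\<kappa> w) \<partial>M) < \<infinity>"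
  shows "integrable M (\<lambda>w. \<integral>x. F w x \<partial>\<kappa> w)"
    and "AE w in M. integrable (\<kappa> w) (F w)"
    and "(\<integral>w. (\<integral>x. F w x \<partial>\<kappa> w) \<partial>M) = enn2real (\<integral>\<^sup>+w. (\<integral>\<^sup>+x. ennreal (F w x) \<partial>\<kappa> w) \<partial>M)
        - enn2real (\<integral>\<^sup>+w. (\<integral>\<^sup>+x. ennreal (- F w x) \<partial>\<kappa> w) \<partial>M)"
proof -
  let ?p = "\<lambda>w. \<integral>\<^sup>+x. ennreal (F w x) \<partial>\<kappa> w" and ?n = "\<lambda>w. \<integral>\<^sup>+x. ennreal (- F w x) \<partial>\<kappa> w"
  have "(\<integral>\<^sup>+w. ?p w \<partial>M) \<le> (\<integral>\<^sup>+w. (\<integral>\<^sup>+x. ennreal \<bar>F w x\<bar> \<partial>\<kappa> w) \<partial>M)"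
    by (intro nn_integral_mono ennreal_leI) auto
  with fin have pf: "(\<integral>\<^sup>+w. ?p w \<partial>M) < \<infinity>" by auto
  have "(\<integral>\<^sup>+w. ?n w \<partial>M) \<le> (\<integral>\<^sup>+w. (\<integral>\<^sup>+x. ennreal \<bar>F w x\<bar> \<partial>\<kappa> w) \<partial>M)"
    by (intro nn_integral_mono ennreal_leI) auto
  with fin have nf: "(\<integral>\<^sup>+w. ?n w \<partial>M) < \<infinity>" by auto
  have int_iff: "integrable (\<kappa> w) (F w) \<longleftrightarrow> ?p w \<noteq> \<infinity> \<and> ?n w \<noteq> \<infinity>" if "w \<in> space M" for w
    using Fm[OF that] by (simp add: real_integrable_def)
  have "AE w in M. ?p w \<noteq> \<infinity>" "AE w in M. ?n w \<noteq> \<infinity>"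
    using nn_integral_PInf_AE[OF p] nn_integral_PInf_AE[OF n] pf nf by simp_all
  then show ae: "AE w in M. integrable (\<kappa> w) (F w)"
    using AE_space by eventually_elim (simp add: int_iff)
  \<comment> \<open>The inner integral is 0 by default where one of the parts is infinite. Spelling
    out both cases gives measurability everywhere and not just up to a null set.\<close>
  have eq: "(\<integral>x. F w x \<partial>\<kappa> w) = (if ?p w \<noteq> \<infinity> \<and> ?n w \<noteq> \<infinity> then enn2real (?p w) - enn2real (?n w) else 0)"
    if "w \<in> space M" for w
    using int_iff[OF that] by (auto simp: real_lebesgue_integral_def not_integrable_integral_eq)
  have "(\<lambda>w. if ?p w \<noteq> \<infinity> \<and> ?n w \<noteq> \<infinity> then enn2real (?p w) - enn2real (?n w) else 0) \<in> borel_measurable M"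
    by measurable
  then have m: "(\<lambda>w. \<integral>x. F w x \<partial>\<kappa> w) \<in> borel_measurable M" using eq by (subst measurable_cong)
  have ae2: "AE w in M. enn2real (?p w) - enn2real (?n w) = (\<integral>x. F w x \<partial>\<kappa> w)"
    using ae by eventually_elim (simp add: real_lebesgue_integral_def)
  have i: "integrable M (\<lambda>w. enn2real (?p w) - enn2real (?n w))"
    by (intro Bochner_Integration.integrable_diff enn2real_integral p n pf nf)
  show "integrable M (\<lambda>w. \<integral>x. F w x \<partial>\<kappa> w)"
    using i ae2 m by (subst integrable_cong_AE[symmetric]) auto
  have "(\<integral>w. (\<integral>x. F w x \<partial>\<kappa> w) \<partial>M) = (\<integral>w. enn2real (?p w) - enn2real (?n w) \<partial>M)"
    using ae2 m by (intro integral_cong_AE) auto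
  also have "\<dots> = enn2real (\<integral>\<^sup>+w. ?p w \<partial>M) - enn2real (\<integral>\<^sup>+w. ?n w \<partial>M)"
    using enn2real_integral[OF p pf] enn2real_integral[OF n nf] by (simp add: Bochner_Integration.integral_diff)
  finally show "(\<integral>w. (\<integral>x. F w x \<partial>\<kappa> w) \<partial>M) = enn2real (\<integral>\<^sup>+w. ?p w \<partial>M) - enn2real (\<integral>\<^sup>+w. ?n w \<partial>M)" .
qed

lemma at_left_to_0: "at_left a = filtermap (\<lambda>x. x + a) (at_left (0::real))"
  by (simp add: at_left_minus[of a] at_right_to_0[of "- a"] at_left_minus[of 0] filtermap_filtermap)

lemma has_derivative_along:
  fixes \<phi> :: "'a::euclidean_space \<Rightarrow> real"
  assumes "\<phi> differentiable at x"
  shows "((\<lambda>t. \<phi> (x + t *\<^sub>R b)) has_real_derivative frechet_derivative \<phi> (at x) b) (at 0)"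
proof -
  have "(\<phi> has_derivative frechet_derivative \<phi> (at x)) (at (x + 0 *\<^sub>R b))"
    using assms by (simp add: frechet_derivative_works)
  moreover have "((\<lambda>t. x + t *\<^sub>R b) has_derivative (\<lambda>t. t *\<^sub>R b)) (at 0)"
    by (auto intro!: derivative_eq_intros)
  ultimately have "((\<lambda>t. \<phi> (x + t *\<^sub>R b)) has_derivative (\<lambda>t. frechet_derivative \<phi> (at x) (t *\<^sub>R b))) (at 0)"
    by (rule has_derivative_compose[rotated])
  moreover have "(\<lambda>t. frechet_derivative \<phi> (at x) (t *\<^sub>R b)) = (*) (frechet_derivative \<phi> (at x) b)"
    using linear_frechet_derivative[OF assms] by (auto simp: linear_cmul fun_eq_iff)
  ultimately show ?thesis by (simp add: has_field_derivative_def)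
qed

lemma has_derivative_along_shift:
  fixes \<phi> :: "'a::euclidean_space \<Rightarrow> real"
  assumes "\<phi> differentiable at (x + t *\<^sub>R b)"
  shows "((\<lambda>t. \<phi> (x + t *\<^sub>R b)) has_real_derivative frechet_derivative \<phi> (at (x + t *\<^sub>R b)) b) (at t)"
  using has_derivative_along[OF assms, of b] DERIV_shift[of "\<lambda>t. \<phi> (x + t *\<^sub>R b)" _ 0 t]
  by (simp add: algebra_simps)

lemma grad_inner: "b \<in> Basis \<Longrightarrow> grad \<phi> x \<bullet> b = frechet_derivative \<phi> (at x) b"
  by (simp add: grad_def)

text \<open>A directional derivative is the limit of difference quotients along the steps
  \<open>inverse (Suc i)\<close>. Only values at translates of the base point \<open>u w\<close> by
  constants enter, which explains the form of \<open>m\<close>.\<close>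

lemma measurable_frechet_derivative:
  fixes \<phi> :: "'w \<Rightarrow> 'a::euclidean_space \<Rightarrow> real"
  assumes m: "\<And>c. (\<lambda>w. \<phi> w (u w + c)) \<in> borel_measurable M"
    and d: "\<And>w. w \<in> space M \<Longrightarrow> (\<phi> w) differentiable at (u w)"
  shows "(\<lambda>w. frechet_derivative (\<phi> w) (at (u w)) b) \<in> borel_measurable M"
proof (rule borel_measurable_LIMSEQ_real)
  let ?h = "\<lambda>i::nat. inverse (real (Suc i))"
  show "(\<lambda>i. (\<phi> w (u w + ?h i *\<^sub>R b) - \<phi> w (u w + 0)) / ?h i) \<longlonglongrightarrow> frechet_derivative (\<phi> w) (at (u w)) b"
    if "w \<in> space M" for w
  proof -
    have "((\<lambda>t. (\<phi> w (u w + t *\<^sub>R b) - \<phi> w (u w + 0)) / t) \<longlongrightarrow> frechet_derivative (\<phi> w) (at (u w)) b) (at 0)"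
      using has_derivative_along[OF d[OF that], of b] by (simp add: has_field_derivative_iff)
    moreover have "filterlim ?h (at 0) sequentially"
      using LIMSEQ_inverse_real_of_nat by (simp add: filterlim_at del: of_nat_Suc)
    ultimately show ?thesis by (rule filterlim_compose)
  qed
  show "(\<lambda>w. (\<phi> w (u w + ?h i *\<^sub>R b) - \<phi> w (u w + 0)) / ?h i) \<in> borel_measurable M" for i
    by (intro borel_measurable_divide borel_measurable_diff m borel_measurable_const)
qed

section \<open>The Georgii-Nguyen-Zessin equation for integrable functions\<close>

context gibbs
begin

text \<open>The nonnegative equation is used three times. Since \<open>ennreal\<close> truncates
  negative numbers to 0, the identity and \<open>uminus\<close> yield the positive and the negative
  part; \<open>abs\<close> carries the integrability from the sum to the Lebesgue integral.\<close>

lemma GNZ_real: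
  fixes F :: "'a \<Rightarrow> 'a set \<Rightarrow> real"
  assumes F[measurable]: "(\<lambda>p. F (fst p) (snd p)) \<in> borel_measurable (borel \<Otimes>\<^sub>M config_M)"
    and fin: "(\<integral>\<^sup>+\<gamma>. (\<integral>\<^sup>+x. ennreal \<bar>F x (\<gamma> - {x})\<bar> \<partial>count_space \<gamma>) \<partial>P) < \<infinity>"
  shows "AE \<gamma> in P. integrable lborel (\<lambda>x. F x \<gamma> * (z * exp (- \<beta> * h x \<gamma>)))"
    and "integrable P (\<lambda>\<gamma>. \<integral>x. F x \<gamma> * (z * exp (- \<beta> * h x \<gamma>)) \<partial>lborel)"
    and "(\<integral>\<gamma>. (\<integral>x. F x (\<gamma> - {x}) \<partial>count_space \<gamma>) \<partial>P) = (\<integral>\<gamma>. (\<integral>x. F x \<gamma> * (z * exp (- \<beta> * h x \<gamma>)) \<partial>lborel) \<partial>P)"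
    and "integrable P (\<lambda>\<gamma>. \<integral>x. F x (\<gamma> - {x}) \<partial>count_space \<gamma>)"
proof -
  let ?w = "\<lambda>x \<gamma>. z * exp (- \<beta> * h x \<gamma>)"
  have wpos: "?w x \<gamma> \<ge> 0" for x \<gamma> using z_pos by simp
  have swap[measurable]: "(\<lambda>q. F (snd q) (fst q)) \<in> borel_measurable (config_M \<Otimes>\<^sub>M borel)"
    using measurable_compose[OF _ F, of "\<lambda>q. (snd q, fst q)" "config_M \<Otimes>\<^sub>M borel"] by simp
  have mult: "ennreal (a * ?w x \<gamma>) = ennreal a * ennreal (?w x \<gamma>)" for a x \<gamma>
    using wpos by (rule ennreal_mult'')
  have neg: "ennreal (- (a * ?w x \<gamma>)) = ennreal (- a) * ennreal (?w x \<gamma>)" for a x \<gamma>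
    using mult[of "- a"] by simp
  have abs: "ennreal \<bar>a * ?w x \<gamma>\<bar> = ennreal \<bar>a\<bar> * ennreal (?w x \<gamma>)" for a x \<gamma>
    using mult[of "\<bar>a\<bar>" x \<gamma>] z_pos by (simp add: abs_mult)
  have swap_ennreal: "(\<lambda>q. ennreal (k (F (snd q) (fst q))) * ennreal (?w (snd q) (fst q))) 
      \<in> borel_measurable (config_M \<Otimes>\<^sub>M lborel)" if [measurable]: "k \<in> borel_measurable borel" for k
    by measurable
  have Fx: "(\<lambda>x. F x \<gamma> * ?w x \<gamma>) \<in> borel_measurable lborel" if "\<gamma> \<in> space P" for \<gamma>
  proof -
    have [measurable]: "(\<lambda>x. F x \<gamma>) \<in> borel_measurable borel"
      using measurable_compose[OF measurable_Pair2' F, of \<gamma>] that by (simp add: space_P space_config_M)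
    have [measurable]: "(\<lambda>x. h x \<gamma>) \<in> borel_measurable borel"
      using that by (intro measurable_h) (auto simp: space_config_M space_P)
    show ?thesis by measurable
  qed
  have lm: "(\<lambda>\<gamma>. \<integral>\<^sup>+x. ennreal (k (F x \<gamma>)) * ennreal (?w x \<gamma>) \<partial>lborel) \<in> borel_measurable P"
    if "k \<in> borel_measurable borel" for k
    unfolding measurable_P using swap_ennreal[OF that]
    by (intro lborel.borel_measurable_nn_integral) (simp add: split_beta')
  have cm: "(\<lambda>\<gamma>. \<integral>\<^sup>+x. ennreal (k (F x (\<gamma> - {x}))) \<partial>count_space \<gamma>) \<in> borel_measurable P"
    if [measurable]: "k \<in> borel_measurable borel" for k
    unfolding measurable_P by (rule measurable_nn_integral_remove[of "\<lambda>x \<gamma>. ennreal (k (F x \<gamma>))"]) measurable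
  have gnz: "(\<integral>\<^sup>+\<gamma>. (\<integral>\<^sup>+x. ennreal (k (F x (\<gamma> - {x}))) \<partial>count_space \<gamma>) \<partial>P)
     = (\<integral>\<^sup>+\<gamma>. (\<integral>\<^sup>+x. ennreal (k (F x \<gamma>)) * ennreal (?w x \<gamma>) \<partial>lborel) \<partial>P)"
    if [measurable]: "k \<in> borel_measurable borel" for k
    by (rule GNZ[of "\<lambda>x \<gamma>. ennreal (k (F x \<gamma>))"]) measurable
  have fin': "(\<integral>\<^sup>+\<gamma>. (\<integral>\<^sup>+x. ennreal \<bar>F x \<gamma> * ?w x \<gamma>\<bar> \<partial>lborel) \<partial>P) < \<infinity>"
    unfolding abs using fin gnz[of abs] by simp
  have p1: "(\<lambda>\<gamma>. \<integral>\<^sup>+x. ennreal (F x \<gamma> * ?w x \<gamma>) \<partial>lborel) \<in> borel_measurable P"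
    unfolding mult using lm[of "\<lambda>a. a"] by simp
  have p2: "(\<lambda>\<gamma>. \<integral>\<^sup>+x. ennreal (- (F x \<gamma> * ?w x \<gamma>)) \<partial>lborel) \<in> borel_measurable P"
    unfolding neg using lm[of uminus] by simp
  have c1: "(\<lambda>\<gamma>. \<integral>\<^sup>+x. ennreal (F x (\<gamma> - {x})) \<partial>count_space \<gamma>) \<in> borel_measurable P"
    using cm[of "\<lambda>a. a"] by simp
  have c2: "(\<lambda>\<gamma>. \<integral>\<^sup>+x. ennreal (- F x (\<gamma> - {x})) \<partial>count_space \<gamma>) \<in> borel_measurable P"
    using cm[of uminus] by simp
  note ker = integral_kernel[of P "\<lambda>\<gamma> x. F x \<gamma> * ?w x \<gamma>" "\<lambda>_. lborel", OF Fx p1 p2 fin']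
  note ker' = integral_kernel[of P "\<lambda>\<gamma> x. F x (\<gamma> - {x})" "\<lambda>\<gamma>. count_space \<gamma>", OF _ c1 c2 fin]
  show "AE \<gamma> in P. integrable lborel (\<lambda>x. F x \<gamma> * ?w x \<gamma>)" by (rule ker(2)) auto
  show "integrable P (\<lambda>\<gamma>. \<integral>x. F x \<gamma> * ?w x \<gamma> \<partial>lborel)" by (rule ker(1)) auto
  show "integrable P (\<lambda>\<gamma>. \<integral>x. F x (\<gamma> - {x}) \<partial>count_space \<gamma>)" by (rule ker'(1)) auto
  show "(\<integral>\<gamma>. (\<integral>x. F x (\<gamma> - {x}) \<partial>count_space \<gamma>) \<partial>P) = (\<integral>\<gamma>. (\<integral>x. F x \<gamma> * ?w x \<gamma> \<partial>lborel) \<partial>P)"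
    using ker(3) ker'(3) gnz[of "\<lambda>a. a"] gnz[of uminus] unfolding mult neg by simp
qed

text \<open>\<open>GNZ_real\<close> holds for each coordinate. What remains is integrability of the
  vector-valued sum, so that the inner product with \<open>b\<close> may be moved inside the
  expectation.\<close>

lemma GNZ_vector:
  fixes F :: "'a \<Rightarrow> 'a set \<Rightarrow> 'a"
  assumes F[measurable]: "(\<lambda>p. F (fst p) (snd p)) \<in> borel_measurable (borel \<Otimes>\<^sub>M config_M)"
    and fin: "(\<integral>\<^sup>+\<gamma>. (\<integral>\<^sup>+x. ennreal (norm (F x (\<gamma> - {x}))) \<partial>count_space \<gamma>) \<partial>P) < \<infinity>"
    and b: "b \<in> Basis"
  shows "(\<integral>\<gamma>. (\<Sum>\<^sub>\<infinity>x\<in>\<gamma>. F x (\<gamma> - {x})) \<partial>P) \<bullet> b = (\<integral>\<gamma>. (\<integral>x. (F x \<gamma> \<bullet> b) * (z * exp (- \<beta> * h x \<gamma>)) \<partial>lborel) \<partial>P)"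
    and "AE \<gamma> in P. integrable lborel (\<lambda>x. (F x \<gamma> \<bullet> b) * (z * exp (- \<beta> * h x \<gamma>)))"
    and "integrable P (\<lambda>\<gamma>. \<integral>x. (F x \<gamma> \<bullet> b) * (z * exp (- \<beta> * h x \<gamma>)) \<partial>lborel)"
proof -
  have fc: "(\<integral>\<^sup>+\<gamma>. (\<integral>\<^sup>+x. ennreal \<bar>F x (\<gamma> - {x}) \<bullet> c\<bar> \<partial>count_space \<gamma>) \<partial>P) < \<infinity>" if c: "c \<in> Basis" for c
  proof -
    have "(\<integral>\<^sup>+\<gamma>. (\<integral>\<^sup>+x. ennreal \<bar>F x (\<gamma> - {x}) \<bullet> c\<bar> \<partial>count_space \<gamma>) \<partial>P)
       \<le> (\<integral>\<^sup>+\<gamma>. (\<integral>\<^sup>+x. ennreal (norm (F x (\<gamma> - {x}))) \<partial>count_space \<gamma>) \<partial>P)"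
      using c by (intro nn_integral_mono ennreal_leI Basis_le_norm)
    then show ?thesis using fin by auto
  qed
  note comp = GNZ_real[of "\<lambda>x \<gamma>. F x \<gamma> \<bullet> c" for c, OF _ fc]
  show "AE \<gamma> in P. integrable lborel (\<lambda>x. (F x \<gamma> \<bullet> b) * (z * exp (- \<beta> * h x \<gamma>)))"
    "integrable P (\<lambda>\<gamma>. \<integral>x. (F x \<gamma> \<bullet> b) * (z * exp (- \<beta> * h x \<gamma>)) \<partial>lborel)"
    using comp(1,2)[of b] b by auto
  let ?V = "\<lambda>\<gamma>. \<integral>x. F x (\<gamma> - {x}) \<partial>count_space \<gamma>"
  let ?N = "\<lambda>\<gamma>. \<integral>\<^sup>+x. ennreal (norm (F x (\<gamma> - {x}))) \<partial>count_space \<gamma>"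
  have Nm[measurable]: "?N \<in> borel_measurable P"
    unfolding measurable_P by (rule measurable_nn_integral_remove[of "\<lambda>x \<gamma>. ennreal (norm (F x \<gamma>))"]) measurable
  have cm: "(\<lambda>\<gamma>. \<integral>x. F x (\<gamma> - {x}) \<bullet> c \<partial>count_space \<gamma>) \<in> borel_measurable P" if "c \<in> Basis" for c
    using comp(4)[of c] that by auto
  have iff: "integrable (count_space \<gamma>) (\<lambda>x. F x (\<gamma> - {x})) \<longleftrightarrow> ?N \<gamma> < \<infinity>" for \<gamma>
    by (simp add: integrable_iff_bounded)
  \<comment> \<open>Where the sum diverges, the vector integral is 0 although a single coordinate
    may still converge. This happens only on a null set.\<close>
  have Vc: "?V \<gamma> \<bullet> c = (if ?N \<gamma> < \<infinity> then \<integral>x. F x (\<gamma> - {x}) \<bullet> c \<partial>count_space \<gamma> else 0)" for \<gamma> c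
    using iff[of \<gamma>] by (auto simp: integral_inner_left not_integrable_integral_eq)
  have Vm[measurable]: "?V \<in> borel_measurable P"
  proof (subst borel_measurable_euclidean_space, rule ballI)
    fix c :: 'a assume "c \<in> Basis"
    note [measurable] = cm[OF this]
    show "(\<lambda>\<gamma>. ?V \<gamma> \<bullet> c) \<in> borel_measurable P" unfolding Vc by measurable
  qed
  have "(\<integral>\<^sup>+\<gamma>. ennreal (norm (?V \<gamma>)) \<partial>P) \<le> (\<integral>\<^sup>+\<gamma>. ?N \<gamma> \<partial>P)"
  proof (intro nn_integral_mono)
    fix \<gamma>
    show "ennreal (norm (?V \<gamma>)) \<le> ?N \<gamma>"
      by (cases "integrable (count_space \<gamma>) (\<lambda>x. F x (\<gamma> - {x}))")
        (auto simp: not_integrable_integral_eq integral_norm_bound_ennreal)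
  qed
  with fin have Vi: "integrable P ?V" by (intro integrableI_bounded) auto
  have "AE \<gamma> in P. ?N \<gamma> \<noteq> \<infinity>" using fin by (intro nn_integral_PInf_AE) auto
  then have ae: "AE \<gamma> in P. ?V \<gamma> \<bullet> b = (\<integral>x. F x (\<gamma> - {x}) \<bullet> b \<partial>count_space \<gamma>)"
    by eventually_elim (simp add: Vc less_top)
  have "(\<integral>\<gamma>. ?V \<gamma> \<partial>P) \<bullet> b = (\<integral>\<gamma>. ?V \<gamma> \<bullet> b \<partial>P)" using Vi by simp
  also have "\<dots> = (\<integral>\<gamma>. (\<integral>x. F x (\<gamma> - {x}) \<bullet> b \<partial>count_space \<gamma>) \<partial>P)"
    using ae cm[OF b] by (intro integral_cong_AE) auto
  also have "\<dots> = (\<integral>\<gamma>. (\<integral>x. (F x \<gamma> \<bullet> b) * (z * exp (- \<beta> * h x \<gamma>)) \<partial>lborel) \<partial>P)"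
    using comp(3)[of b] b by auto
  finally show "(\<integral>\<gamma>. (\<Sum>\<^sub>\<infinity>x\<in>\<gamma>. F x (\<gamma> - {x})) \<partial>P) \<bullet> b = (\<integral>\<gamma>. (\<integral>x. (F x \<gamma> \<bullet> b) * (z * exp (- \<beta> * h x \<gamma>)) \<partial>lborel) \<partial>P)"
    by (simp add: infsum_eq_integral_count_space)
qed

end

section \<open>Vanishing of the integral of a directional derivative\<close>

context smooth_gibbs
begin

text \<open>Averaging over unit segments in direction \<open>b\<close> turns the integral of the derivative \<open>G\<close> of
  \<open>g\<close> into the integral of \<open>g (x + b) - g x\<close>, which vanishes by translation invariance.\<close>

lemma integral_derivative_zero:
  fixes \<phi> :: "'a \<Rightarrow> real"
  assumes lf: "locally_finite \<gamma>" and \<beta>: "\<beta> \<ge> 0"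
    and diff: "\<And>x. \<phi> differentiable at x" and supp: "compact (closure {x. \<phi> x \<noteq> 0})"
    and agree: "\<forall>y\<in>\<gamma>. \<forall>L L'. ((\<lambda>t. S (y + t *\<^sub>R b) y (\<gamma> - {y})) \<longlongrightarrow> L) (at_left 0) \<longrightarrow>
      ((\<lambda>t. S (y + t *\<^sub>R b) y (\<gamma> - {y})) \<longlongrightarrow> L') (at_right 0) \<longrightarrow> L = L'"
    and b: "b \<noteq> 0"
    and G: "\<And>x. x \<notin> \<gamma> \<Longrightarrow> G x = (frechet_derivative \<phi> (at x) b
        - \<beta> * \<phi> x * frechet_derivative (\<lambda>x. h x \<gamma>) (at x) b) * exp (- \<beta> * h x \<gamma>)"
    and Gint: "integrable lborel G"
  shows "(\<integral>x. G x \<partial>lborel) = 0"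
proof -
  define g where "g x = \<phi> x * exp (- \<beta> * h x \<gamma>)" for x
  have Gm[measurable]: "G \<in> borel_measurable borel" using borel_measurable_integrable[OF Gint] by simp
  have cont: "isCont \<phi> x" for x by (rule differentiable_imp_continuous_within[OF diff])
  have [measurable]: "\<phi> \<in> borel_measurable borel"
    using cont by (intro borel_measurable_continuous_onI continuous_at_imp_continuous_on) auto
  have [measurable]: "(\<lambda>x. h x \<gamma>) \<in> borel_measurable borel"
    using lf by (intro measurable_h) (auto simp: space_config_M)
  have gm[measurable]: "g \<in> borel_measurable borel" unfolding g_def by measurable
  let ?K = "closure {x. \<phi> x \<noteq> 0}"
  have K0: "\<phi> x = 0" if "x \<notin> ?K" for x
    using that subsetD[OF closure_subset, of x "{x. \<phi> x \<noteq> 0}"] by blast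
  have bK: "bounded ?K" by (rule compact_imp_bounded[OF supp])
  \<comment> \<open>Stability enters here: with \<open>\<beta> \<ge> 0\<close> the lower bound on
    \<open>h\<close> bounds the weight on the support of \<phi>, even near the points of
    \<gamma>.\<close>
  obtain c where c: "\<And>x. x \<in> ?K \<Longrightarrow> h x \<gamma> \<ge> c" by (rule h_bounded_below[OF lf bK]) blast
  have gb: "\<bar>g x\<bar> \<le> \<bar>\<phi> x\<bar> * exp (- \<beta> * c)" for x
  proof (cases "x \<in> ?K")
    case True
    have "exp (- \<beta> * h x \<gamma>) \<le> exp (- \<beta> * c)" using mult_left_mono[OF c[OF True] \<beta>] by simp
    then have "\<bar>\<phi> x\<bar> * exp (- \<beta> * h x \<gamma>) \<le> \<bar>\<phi> x\<bar> * exp (- \<beta> * c)" by (rule mult_left_mono) simp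
    then show ?thesis by (simp add: g_def abs_mult)
  next
    case False
    from K0[OF this] show ?thesis by (simp add: g_def)
  qed
  have "compact (\<phi> ` ?K)" using cont supp
    by (intro compact_continuous_image continuous_at_imp_continuous_on) auto
  then have "bounded (\<phi> ` ?K)" by (rule compact_imp_bounded)
  then obtain B where "\<forall>y\<in>\<phi> ` ?K. norm y \<le> B" unfolding bounded_iff by blast
  then have B: "\<bar>\<phi> x\<bar> \<le> B" if "x \<in> ?K" for x using that by simp
  have gint: "integrable lborel g"
  proof (rule integrableI_bounded_set[where A="?K" and B="B * exp (- \<beta> * c)"])
    show "emeasure lborel ?K < \<infinity>" by (rule emeasure_bounded_finite[OF bK])
    have "norm (g x) \<le> B * exp (- \<beta> * c)" if "x \<in> ?K" for x
      using order_trans[OF gb[of x] mult_right_mono[OF B[OF that], of "exp (- \<beta> * c)"]] by simp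
    then show "AE x in lborel. x \<in> ?K \<longrightarrow> norm (g x) \<le> B * exp (- \<beta> * c)" by simp
    have "g x = 0" if "x \<notin> ?K" for x unfolding g_def K0[OF that] by simp
    then show "AE x in lborel. x \<notin> ?K \<longrightarrow> g x = 0" by simp
  qed auto
  have der: "((\<lambda>t. g (x + t *\<^sub>R b)) has_real_derivative G (x + t *\<^sub>R b)) (at t)" if "x + t *\<^sub>R b \<notin> \<gamma>" for x t
  proof -
    note d1 = has_derivative_along_shift[of \<phi> x t b, OF diff]
    note d2 = has_derivative_along_shift[of "\<lambda>x. h x \<gamma>" x t b, OF h_diff[OF lf that]]
    show ?thesis unfolding g_def G[OF that]
      by (rule derivative_eq_intros d1 d2 refl)+ (simp add: algebra_simps)
  qed
  have limits: "L = L'" if y: "y \<in> \<gamma>"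
    and L: "((\<lambda>t. g (y + t *\<^sub>R b)) \<longlongrightarrow> L) (at_left 0)" and L': "((\<lambda>t. g (y + t *\<^sub>R b)) \<longlongrightarrow> L') (at_right 0)" for y L L'
  proof -
    have "isCont (\<lambda>t. \<phi> (y + t *\<^sub>R b)) 0"
      by (rule isCont_o2[where g=\<phi>]) (auto intro!: continuous_intros cont)
    then have f1: "((\<lambda>t. \<phi> (y + t *\<^sub>R b)) \<longlongrightarrow> \<phi> y) (at_left 0)" and f2: "((\<lambda>t. \<phi> (y + t *\<^sub>R b)) \<longlongrightarrow> \<phi> y) (at_right 0)"
      by (auto simp: isCont_def filterlim_at_split)
    show ?thesis
    proof (cases "\<phi> y = 0")
      case True
      have "M = 0" if \<phi>0: "((\<lambda>t. \<phi> (y + t *\<^sub>R b)) \<longlongrightarrow> 0) X" and gM: "((\<lambda>t. g (y + t *\<^sub>R b)) \<longlongrightarrow> M) X" "X \<noteq> bot" for M X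
      proof -
        have "((\<lambda>t. \<bar>\<phi> (y + t *\<^sub>R b)\<bar> * exp (- \<beta> * c)) \<longlongrightarrow> 0) X"
          using tendsto_mult_right[OF tendsto_rabs[OF \<phi>0], of "exp (- \<beta> * c)"] by simp
        then have "((\<lambda>t. g (y + t *\<^sub>R b)) \<longlongrightarrow> 0) X"
          by (rule Lim_null_comparison[rotated]) (use gb in auto)
        then show ?thesis using tendsto_unique[OF gM(2,1)] by blast
      qed
      from this[OF f1[unfolded True] L] this[OF f2[unfolded True] L'] show ?thesis by simp
    next
      case False
      \<comment> \<open>Near \<open>y\<close> the function \<phi> does not vanish, and
        \<open>g / \<phi> * ?c\<close> is the symmetric quantity \<open>S\<close>, whose one-sided
        limits agree by assumption.\<close>
      let ?c = "exp (- \<beta> * h y (\<gamma> - {y}))"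
      have "((\<lambda>t. S (y + t *\<^sub>R b) y (\<gamma> - {y})) \<longlongrightarrow> M / \<phi> y * ?c) X"
        if \<phi>y: "((\<lambda>t. \<phi> (y + t *\<^sub>R b)) \<longlongrightarrow> \<phi> y) X" and gM: "((\<lambda>t. g (y + t *\<^sub>R b)) \<longlongrightarrow> M) X" for M X
      proof -
        have "((\<lambda>t. g (y + t *\<^sub>R b) / \<phi> (y + t *\<^sub>R b) * ?c) \<longlongrightarrow> M / \<phi> y * ?c) X"
          using False by (intro tendsto_intros \<phi>y gM)
        moreover have "eventually (\<lambda>t. \<phi> (y + t *\<^sub>R b) \<noteq> 0) X"
          using tendsto_imp_eventually_ne[OF \<phi>y False] .
        then have "eventually (\<lambda>t. g (y + t *\<^sub>R b) / \<phi> (y + t *\<^sub>R b) * ?c = S (y + t *\<^sub>R b) y (\<gamma> - {y})) X"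
          by eventually_elim (use y in \<open>simp add: g_def S_def insert_absorb mult_exp_exp ring_distribs\<close>)
        ultimately show ?thesis by (rule Lim_transform_eventually)
      qed
      from this[OF f1 L] this[OF f2 L'] agree y have "L / \<phi> y * ?c = L' / \<phi> y * ?c" by blast
      then show ?thesis using False by simp
    qed
  qed
  define Q where "Q x t = G (x + t *\<^sub>R b) * indicator {0..1::real} t" for x t
  have Qm[measurable]: "(\<lambda>p. Q (fst p) (snd p)) \<in> borel_measurable (lborel \<Otimes>\<^sub>M lborel)"
    unfolding Q_def by measurable
  have "(\<integral>\<^sup>+p. ennreal (norm (Q (fst p) (snd p))) \<partial>(lborel \<Otimes>\<^sub>M lborel))
    = (\<integral>\<^sup>+x. (\<integral>\<^sup>+t. ennreal (norm (Q x t)) \<partial>lborel) \<partial>lborel)"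
    by (subst lborel.nn_integral_fst[symmetric]) auto
  also have "\<dots> = (\<integral>\<^sup>+x. (\<integral>\<^sup>+t. ennreal (norm (G (x + t *\<^sub>R b))) * indicator {0..1} t \<partial>lborel) \<partial>lborel)"
    by (intro nn_integral_cong) (auto simp: Q_def split: split_indicator)
  also have "\<dots> = (\<integral>\<^sup>+x. ennreal (norm (G x)) \<partial>lborel)"
    by (rule nn_integral_line_average) measurable
  also have "\<dots> < \<infinity>" using Gint by (simp add: integrable_iff_bounded)
  finally have Qint: "integrable (lborel \<Otimes>\<^sub>M lborel) (case_prod Q)"
    using Qm by (intro integrableI_bounded) (auto simp: split_beta')
  \<comment> \<open>Both end points of the segment must avoid \<gamma>, since only interior
    exceptional points can be removed; this fails for countably many \<open>x\<close>.\<close>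
  have cg: "AE x in lborel. x \<notin> \<gamma>" "AE x in lborel. x + b \<notin> \<gamma>"
  proof -
    have cs: "AE x in lborel. x \<notin> C" if "countable C" for C :: "'a set"
      using that by (intro AE_I'[of C]) (auto simp: countable_imp_null_set_lborel)
    show "AE x in lborel. x \<notin> \<gamma>" by (rule cs[OF locally_finite_countable[OF lf]])
    have "AE x in lborel. x \<notin> (\<lambda>y. y - b) ` \<gamma>" by (intro cs countable_image locally_finite_countable[OF lf])
    then show "AE x in lborel. x + b \<notin> \<gamma>" by eventually_elim (force simp: image_iff)
  qed
  have ftc: "AE x in lborel. (\<integral>t. Q x t \<partial>lborel) = g (x + b) - g x"
    using lborel_pair.AE_integrable_fst'[OF Qint] cg
  proof eventually_elim
    case (elim x)
    let ?T = "{t. x + t *\<^sub>R b \<in> \<gamma>} \<inter> {0..1}"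
    have si: "set_integrable lborel {0..1} (\<lambda>t. G (x + t *\<^sub>R b))"
      using elim(1) by (simp add: set_integrable_def Q_def mult.commute)
    \<comment> \<open>A compact segment meets a locally finite set in finitely many points, and
      \<open>b \<noteq> 0\<close> transfers this to the parameters.\<close>
    have "finite (\<gamma> \<inter> (\<lambda>t. x + t *\<^sub>R b) ` {0..1})"
      by (intro locally_finite_Int_bounded[OF lf] compact_imp_bounded compact_continuous_image continuous_intros) auto
    moreover have "inj_on (\<lambda>t. x + t *\<^sub>R b) ?T" using b by (auto simp: inj_on_def)
    ultimately have fT: "finite ?T" by (rule inj_on_finite[rotated -1]) auto
    have "((\<lambda>t. G (x + t *\<^sub>R b)) has_integral g (x + 1 *\<^sub>R b) - g (x + 0 *\<^sub>R b)) {0..1}"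
    proof (rule FTC_removable[where T="?T", OF fT])
      show "0 \<notin> ?T" "1 \<notin> ?T" using elim by auto
      show "((\<lambda>t. g (x + t *\<^sub>R b)) has_real_derivative G (x + t *\<^sub>R b)) (at t)" if "t \<in> {0..1} - ?T" for t
        using that by (intro der) auto
      show "(\<lambda>t. G (x + t *\<^sub>R b)) integrable_on {0..1}" using set_borel_integral_eq_integral(1)[OF si] .
      fix t L L' assume t: "t \<in> ?T" "((\<lambda>t. g (x + t *\<^sub>R b)) \<longlongrightarrow> L) (at_left t)"
        "((\<lambda>t. g (x + t *\<^sub>R b)) \<longlongrightarrow> L') (at_right t)"
      show "L = L'"
      proof (rule limits[of "x + t *\<^sub>R b"])
        show "((\<lambda>s. g (x + t *\<^sub>R b + s *\<^sub>R b)) \<longlongrightarrow> L) (at_left 0)"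
          using t(2) unfolding at_left_to_0[of t] by (simp add: filterlim_filtermap algebra_simps)
        show "((\<lambda>s. g (x + t *\<^sub>R b + s *\<^sub>R b)) \<longlongrightarrow> L') (at_right 0)"
          using t(3) unfolding at_right_to_0[of t] by (simp add: filterlim_filtermap algebra_simps)
      qed (use t in auto)
    qed
    then have "integral {0..1} (\<lambda>t. G (x + t *\<^sub>R b)) = g (x + b) - g x" by (simp add: integral_unique)
    then show ?case using set_borel_integral_eq_integral(2)[OF si]
      by (simp add: set_lebesgue_integral_def Q_def mult.commute)
  qed
  have "(\<integral>x. G x \<partial>lborel) = (\<integral>t. (\<integral>x. G x \<partial>lborel) * indicator {0..1::real} t \<partial>lborel)" by simp
  also have "\<dots> = (\<integral>t. (\<integral>x. Q x t \<partial>lborel) \<partial>lborel)"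
    by (intro Bochner_Integration.integral_cong refl) (simp add: Q_def integral_lborel_translate)
  also have "\<dots> = (\<integral>x. (\<integral>t. Q x t \<partial>lborel) \<partial>lborel)" by (rule lborel_pair.Fubini_integral[OF Qint])
  also have "\<dots> = (\<integral>x. g (x + b) - g x \<partial>lborel)"
    using ftc lborel_pair.integrable_fst'[OF Qint] by (intro integral_cong_AE) auto
  also have "\<dots> = 0"
    using integrable_lborel_translate[OF gint, of b] gint
    by (simp add: Bochner_Integration.integral_diff integral_lborel_translate)
  finally show ?thesis .
qed

end

theorem theorem9:
  fixes H :: "'a::euclidean_space set \<Rightarrow> ereal"
    and R z \<beta> :: real
    and P :: "'a set measure"
    and f :: "'a \<Rightarrow> 'a set \<Rightarrow> real"
  assumes "energy_function H" and "stationary_energy H"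
    and "R > 0" and "finite_range H R"
    and "z > 0" and "\<beta> \<ge> 0"
    and "gibbs_pp H R z \<beta> P"
    and h_diff: "\<forall>\<gamma>. locally_finite \<gamma> \<longrightarrow>
              (\<forall>x\<in>- \<gamma>. \<bar>loc_energy H R x \<gamma>\<bar> \<noteq> \<infinity>) \<and>
              (\<lambda>x. real_of_ereal (loc_energy H R x \<gamma>)) differentiable_on (- \<gamma>)"
    and f_meas: "(\<lambda>(x, \<gamma>). f x \<gamma>) \<in> borel_measurable (lborel \<Otimes>\<^sub>M config_M)"
    and f_diff: "\<forall>\<gamma>. locally_finite \<gamma> \<longrightarrow>
              (\<lambda>x. f x \<gamma>) differentiable_on UNIV \<and> compact (closure {x. f x \<gamma> \<noteq> 0})"
    and int1: "(\<integral>\<^sup>+ \<gamma>. (\<Sum>\<^sub>\<infinity>x\<in>\<gamma>. ennreal (norm (grad (\<lambda>y. f y (\<gamma> - {x})) x))) \<partial>P) < \<infinity>"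
    and int2: "(\<integral>\<^sup>+ \<gamma>. (\<Sum>\<^sub>\<infinity>x\<in>\<gamma>. ennreal (norm (f x (\<gamma> - {x}) *\<^sub>R
                    grad (\<lambda>y. real_of_ereal (loc_energy H R y (\<gamma> - {x}))) x))) \<partial>P) < \<infinity>"
  shows "(\<integral>\<gamma>. (\<Sum>\<^sub>\<infinity>x\<in>\<gamma>. grad (\<lambda>y. f y (\<gamma> - {x})) x) \<partial>P) =
         \<beta> *\<^sub>R (\<integral>\<gamma>. (\<Sum>\<^sub>\<infinity>x\<in>\<gamma>. f x (\<gamma> - {x}) *\<^sub>R
                    grad (\<lambda>y. real_of_ereal (loc_energy H R y (\<gamma> - {x}))) x) \<partial>P)"
proof -
  interpret finite_range_energy H R
    using assms(1,3,4) h_diff by unfold_locales auto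
  interpret gibbs H R z \<beta> P
    using assms(5,7) by unfold_locales
  have hd: "(\<lambda>x. h x \<gamma>) differentiable at x" if "locally_finite \<gamma>" "x \<notin> \<gamma>" for x \<gamma>
  proof -
    have "open (- \<gamma>)" using locally_finite_closed[OF that(1)] by (rule open_Compl)
    moreover have "(\<lambda>x. h x \<gamma>) differentiable_on (- \<gamma>)" using h_diff that(1) unfolding h_def by blast
    ultimately show ?thesis using that(2) by (simp add: differentiable_on_eq_differentiable_at)
  qed
  interpret smooth_gibbs H R z \<beta> P by unfold_locales (rule hd)
  have f_m: "(\<lambda>p. f (fst p) (snd p)) \<in> borel_measurable (borel \<Otimes>\<^sub>M config_M)"
    using f_meas unfolding split_beta'
    by (subst measurable_cong_sets[OF sets_pair_measure_cong[OF sets_lborel[symmetric] refl] refl])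
  have f_d: "(\<lambda>y. f y \<gamma>) differentiable at x" if "locally_finite \<gamma>" for x \<gamma>
    using f_diff that by (simp add: differentiable_on_def)
  have shift: "(\<lambda>p. (fst p + c, snd p)) \<in> borel \<Otimes>\<^sub>M config_M \<rightarrow>\<^sub>M borel \<Otimes>\<^sub>M config_M" for c :: 'a by measurable
  have mem[measurable]: "Measurable.pred (borel \<Otimes>\<^sub>M config_M) (\<lambda>p. fst p \<in> (snd p :: 'a set))"
    by (rule measurable_mem_config) auto
  define F1 where "F1 x \<eta> = grad (\<lambda>y. f y \<eta>) x" for x \<eta>
  \<comment> \<open>The sums only evaluate \<open>F2\<close> at \<open>\<gamma> - {x}\<close>, where
    the first case does not occur. The value 0 on \<open>x \<in> \<eta>\<close> avoids gradients at
    points where \<open>h\<close> need not be differentiable.\<close>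
  define F2 where "F2 x \<eta> = (if x \<in> \<eta> then 0 else f x \<eta> *\<^sub>R grad (\<lambda>y. h y \<eta>) x)" for x \<eta>
  have F1_m: "(\<lambda>p. F1 (fst p) (snd p)) \<in> borel_measurable (borel \<Otimes>\<^sub>M config_M)"
  proof (subst borel_measurable_euclidean_space, rule ballI)
    fix b :: 'a assume b: "b \<in> Basis"
    show "(\<lambda>p. F1 (fst p) (snd p) \<bullet> b) \<in> borel_measurable (borel \<Otimes>\<^sub>M config_M)"
      unfolding F1_def grad_inner[OF b]
      using measurable_compose[OF shift f_m]
      by (intro measurable_frechet_derivative) (auto simp: space_pair_measure space_config_M intro!: f_d)
  qed
  have F2_m: "(\<lambda>p. F2 (fst p) (snd p)) \<in> borel_measurable (borel \<Otimes>\<^sub>M config_M)"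
  proof (subst borel_measurable_euclidean_space, rule ballI)
    fix b :: 'a assume b: "b \<in> Basis"
    \<comment> \<open>For \<open>fst p \<in> snd p\<close> the whole function of \<open>y\<close> is
      replaced by 0. Thus \<open>?h p\<close> is differentiable at \<open>fst p\<close> for every
      \<open>p\<close>, and otherwise it has the derivative of \<open>h\<close>.\<close>
    let ?h = "\<lambda>p y. if fst p \<in> snd p then 0 else h y (snd p)"
    have "(\<lambda>p. frechet_derivative (?h p) (at (fst p)) b) \<in> borel_measurable (borel \<Otimes>\<^sub>M config_M)"
    proof (rule measurable_frechet_derivative)
      show "(\<lambda>p. ?h p (fst p + c)) \<in> borel_measurable (borel \<Otimes>\<^sub>M config_M)" for c by measurable
      show "?h p differentiable at (fst p)" if "p \<in> space (borel \<Otimes>\<^sub>M config_M)" for p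
        using that hd[of "snd p" "fst p"]
        by (cases "fst p \<in> snd p") (simp_all add: space_pair_measure space_config_M mem_Times_iff)
    qed
    then have "(\<lambda>p. if fst p \<in> snd p then 0 else f (fst p) (snd p) * frechet_derivative (?h p) (at (fst p)) b)
        \<in> borel_measurable (borel \<Otimes>\<^sub>M config_M)" using f_m by measurable
    also have "(\<lambda>p. if fst p \<in> snd p then 0 else f (fst p) (snd p) * frechet_derivative (?h p) (at (fst p)) b)
        = (\<lambda>p. F2 (fst p) (snd p) \<bullet> b)" by (auto simp: F2_def grad_inner[OF b])
    finally show "(\<lambda>p. F2 (fst p) (snd p) \<bullet> b) \<in> borel_measurable (borel \<Otimes>\<^sub>M config_M)" .
  qed
  have F2_eq: "f x (\<gamma> - {x}) *\<^sub>R grad (\<lambda>y. real_of_ereal (loc_energy H R y (\<gamma> - {x}))) x = F2 x (\<gamma> - {x})" for x \<gamma>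
    by (simp add: F2_def h_def)
  have fin1: "(\<integral>\<^sup>+\<gamma>. (\<integral>\<^sup>+x. ennreal (norm (F1 x (\<gamma> - {x}))) \<partial>count_space \<gamma>) \<partial>P) < \<infinity>"
    by (rule le_less_trans[OF nn_integral_mono int1[folded F1_def]])
      (auto simp: space_P intro: nn_integral_count_space_le_infsum)
  have fin2: "(\<integral>\<^sup>+\<gamma>. (\<integral>\<^sup>+x. ennreal (norm (F2 x (\<gamma> - {x}))) \<partial>count_space \<gamma>) \<partial>P) < \<infinity>"
    by (rule le_less_trans[OF nn_integral_mono int2[unfolded F2_eq]])
      (auto simp: space_P intro: nn_integral_count_space_le_infsum)
  show ?thesis
    unfolding F2_eq F1_def[symmetric]
  proof (rule euclidean_eqI)
    fix b :: 'a assume b: "b \<in> Basis"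
    then have b0: "b \<noteq> 0" by auto
    let ?w = "\<lambda>x \<gamma>. z * exp (- \<beta> * h x \<gamma>)"
    let ?I1 = "\<lambda>\<gamma>. \<integral>x. (F1 x \<gamma> \<bullet> b) * ?w x \<gamma> \<partial>lborel" and ?I2 = "\<lambda>\<gamma>. \<integral>x. (F2 x \<gamma> \<bullet> b) * ?w x \<gamma> \<partial>lborel"
    note v1 = GNZ_vector[OF F1_m fin1 b] and v2 = GNZ_vector[OF F2_m fin2 b]
    have "AE \<gamma> in P. ?I1 \<gamma> - \<beta> * ?I2 \<gamma> = 0"
      using v1(2) v2(2) AE_limits_agree[OF b0] AE_P_locally_finite
    proof eventually_elim
      case (elim \<gamma>)
      \<comment> \<open>Off \<gamma> this is the derivative of
        \<open>f x \<gamma> * exp (- \<beta> * h x \<gamma>)\<close> in direction \<open>b\<close>,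
        by the product rule.\<close>
      define G where "G x = ((F1 x \<gamma> \<bullet> b) - \<beta> * (F2 x \<gamma> \<bullet> b)) * exp (- \<beta> * h x \<gamma>)" for x
      have zG: "(F1 x \<gamma> \<bullet> b) * ?w x \<gamma> - \<beta> * ((F2 x \<gamma> \<bullet> b) * ?w x \<gamma>) = z * G x" for x
        by (simp add: G_def algebra_simps)
      have "integrable lborel (\<lambda>x. z * G x)"
        unfolding zG[symmetric] by (intro Bochner_Integration.integrable_diff integrable_mult_right elim)
      then have Gi: "integrable lborel G" using z_pos by simp
      have "(\<integral>x. G x \<partial>lborel) = 0"
      proof (rule integral_derivative_zero[OF elim(4) assms(6) f_d[OF elim(4)] _ elim(3) b0 _ Gi])
        show "compact (closure {x. f x \<gamma> \<noteq> 0})" using f_diff elim(4) by blast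
        show "G x = (frechet_derivative (\<lambda>y. f y \<gamma>) (at x) b
          - \<beta> * f x \<gamma> * frechet_derivative (\<lambda>x. h x \<gamma>) (at x) b) * exp (- \<beta> * h x \<gamma>)" if "x \<notin> \<gamma>" for x
          using that by (simp add: G_def F1_def F2_def grad_inner[OF b])
      qed
      moreover have "?I1 \<gamma> - \<beta> * ?I2 \<gamma> = (\<integral>x. z * G x \<partial>lborel)"
        unfolding zG[symmetric] using elim(1,2) by (simp add: Bochner_Integration.integral_diff)
      ultimately show ?case by simp
    qed
    then have "(\<integral>\<gamma>. ?I1 \<gamma> - \<beta> * ?I2 \<gamma> \<partial>P) = 0" by (rule integral_eq_zero_AE)
    \<comment> \<open>Only the difference vanishes almost surely; integrability of
      \<open>?I1\<close> and \<open>?I2\<close> allows it to be split after integration.\<close>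
    then have "(\<integral>\<gamma>. ?I1 \<gamma> \<partial>P) = \<beta> * (\<integral>\<gamma>. ?I2 \<gamma> \<partial>P)"
      using v1(3) v2(3) by (simp add: Bochner_Integration.integral_diff)
    then show "(\<integral>\<gamma>. (\<Sum>\<^sub>\<infinity>x\<in>\<gamma>. F1 x (\<gamma> - {x})) \<partial>P) \<bullet> b = (\<beta> *\<^sub>R (\<integral>\<gamma>. (\<Sum>\<^sub>\<infinity>x\<in>\<gamma>. F2 x (\<gamma> - {x})) \<partial>P)) \<bullet> b"
      using v1(1) v2(1) by simp
  qed
qed

end
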